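(* For natural numbers $n,N,r$ let $S'(n,N,r)$ be the assertion: for any $N$-dimensional vector subspace $\mathcal{F}^N\subset C^0(\mathbb{R}^1,\mathbb{R}^1)$ there exist systems of $n$ independent conditions $f(a_i)=f(b_i)$, $a_i\ne b_i$, $i=1,\dots,n$, defining subspaces of dimension $\geq r$ in $\mathcal{F}^N$. Then: A. $S'(n,N,2)$ holds if $n$ and $N$ satisfy one of the following: (1) $n\geq 6$, $N=n$; (2) $n\geq 10$, $N=n-1$; (3) $n\geq 14$, $N=n-2$ or $n-3$; (4) $n\geq 16$, $N=n-4$; (5) $n\geq 18$, $N=n-5$; (6) $n\geq 20$, $N=n-6$; (7) $n\geq 24$, $N=n-7$; (8) $n\geq 28$, $N=n-8$ or $n-9$; (9) $n\geq 32$, $N=n-10$ or $n-11$. B. $S'(n,N,3)$ holds if $n$ and $N$ satisfy one of the following: (1) $n\geq 18$, $N=n$ or $n-1$; (2) $n\geq 22$, $N=n-2$; (3) $n\geq 26$, $N=n-3$; (4) $n\geq 30$, $N=n-4$; (5) $n\geq 36$, $N=n-5$; (6) $n\geq 40$, $N=n-6$ or $n-7$; (7) $n\geq 44$, $N=n-8$ or $n-9$. C. $S'(n,N,4)$ holds if $n$ and $N$ satisfy one of the following: (1) $n\geq 30$, $N=n$ or $n-1$; (2) $n\geq 44$, $N=n-2$ or $n-3$; (3) $n\geq 52$, $N=n-4$ or $n-5$; (4) $n\geq 56$, $N=n-6$ or $n-7$. D. $S'(n,N,5)$ holds if $n$ and $N$ satisfy one of the following: (1) $n\geq 48$, $N=n$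 or $n-1$; (2) $n\geq 60$, $N=n-2$ or $n-3$; (3) $n\geq 68$, $N=n-4$ or $n-5$. E. $S'(n,N,6)$ holds if $n$ and $N$ satisfy one of the following: (1) $n\geq 64$, $N=n$ or $n-1$; (2) $n\geq 76$, $N=n-2$ or $n-3$. F. $S'(n,N,7)$ holds if $n\geq 80$ and $N=n$ or $n-1$.
   Context: $C^0(\mathbb{R}^1,\mathbb{R}^1)$ is the space of continuous functions $\mathbb{R}^1\to\mathbb{R}^1$. A system of $n$ conditions $f(a_i)=f(b_i)$, $i=1,\dots,n$, given by $n$ pairwise distinct unordered pairs $(a_i,b_i)$ of distinct points of $\mathbb{R}^1$, is independent if the subalgebra of $C^0(\mathbb{R}^1,\mathbb{R}^1)$ consisting of all functions satisfying these conditions has codimension exactly $n$ in $C^0(\mathbb{R}^1,\mathbb{R}^1)$. *)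

theory Defs
  imports "HOL-Analysis.Analysis"
begin

text \<open>The real algebra of continuous functions on the line (no boundedness is required).\<close>

typedef cont_fun = "{f :: real \<Rightarrow> real. continuous_on UNIV f}"
  morphisms apply_cont Cont_fun
  by (rule exI[of _ "\<lambda>x. 0"]) simp

setup_lifting type_definition_cont_fun

instantiation cont_fun :: "{comm_ring_1, real_algebra_1}"
begin

lift_definition zero_cont_fun :: cont_fun is "\<lambda>x. 0" by simp
lift_definition one_cont_fun :: cont_fun is "\<lambda>x. 1" by simp
lift_definition plus_cont_fun :: "cont_fun \<Rightarrow> cont_fun \<Rightarrow> cont_fun"
  is "\<lambda>f g x. f x + g x" by (rule continuous_on_add)
lift_definition minus_cont_fun :: "cont_fun \<Rightarrow> cont_fun \<Rightarrow> cont_fun"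
  is "\<lambda>f g x. f x - g x" by (rule continuous_on_diff)
lift_definition uminus_cont_fun :: "cont_fun \<Rightarrow> cont_fun"
  is "\<lambda>f x. - f x" by (rule continuous_on_minus)
lift_definition times_cont_fun :: "cont_fun \<Rightarrow> cont_fun \<Rightarrow> cont_fun"
  is "\<lambda>f g x. f x * g x" by (rule continuous_on_mult)
lift_definition scaleR_cont_fun :: "real \<Rightarrow> cont_fun \<Rightarrow> cont_fun"
  is "\<lambda>c f x. c * f x" by (rule continuous_on_mult_left)

instance
  by standard (transfer; simp add: fun_eq_iff algebra_simps)+

end

text \<open>The finiteness clause matters because \<open>dim\<close> is \<open>0\<close> on infinite-dimensional spaces.\<close>

definition subspace_of_dim :: "nat \<Rightarrow> 'a::real_vector set \<Rightarrow> bool" where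
  "subspace_of_dim d V \<longleftrightarrow> subspace V \<and> (\<exists>B. finite B \<and> V \<subseteq> span B) \<and> dim V = d"

text \<open>The quotient by \<open>W\<close> is represented by a complementary subspace \<open>U\<close>, which the
  projection maps isomorphically onto it; \<open>d\<close> does not depend on the choice of \<open>U\<close>.\<close>

definition subspace_of_codim :: "nat \<Rightarrow> 'a::real_vector set \<Rightarrow> bool" where
  "subspace_of_codim d W \<longleftrightarrow> subspace W \<and>
     (\<exists>U. subspace_of_dim d U \<and> U \<inter> W = {0} \<and> {u + w | u w. u \<in> U \<and> w \<in> W} = UNIV)"

definition solutions :: "nat \<Rightarrow> (nat \<Rightarrow> real) \<Rightarrow> (nat \<Rightarrow> real) \<Rightarrow> cont_fun set" where
  "solutions n a b = {f. \<forall>i\<in>{1..n}. apply_cont f (a i) = apply_cont f (b i)}"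

lemma subspace_solutions: "subspace (solutions n a b)"
  by (auto simp: subspace_def solutions_def zero_cont_fun.rep_eq plus_cont_fun.rep_eq
      scaleR_cont_fun.rep_eq)

lemma one_in_solutions: "1 \<in> solutions n a b"
  by (simp add: solutions_def one_cont_fun.rep_eq)

lemma times_in_solutions:
  "f \<in> solutions n a b \<Longrightarrow> g \<in> solutions n a b \<Longrightarrow> f * g \<in> solutions n a b"
  by (simp add: solutions_def times_cont_fun.rep_eq)

definition independent_conditions :: "nat \<Rightarrow> (nat \<Rightarrow> real) \<Rightarrow> (nat \<Rightarrow> real) \<Rightarrow> bool" where
  "independent_conditions n a b \<longleftrightarrow>
     (\<forall>i\<in>{1..n}. a i \<noteq> b i) \<and> inj_on (\<lambda>i. {a i, b i}) {1..n} \<and>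
     subspace_of_codim n (solutions n a b)"

definition S' :: "nat \<Rightarrow> nat \<Rightarrow> nat \<Rightarrow> bool" where
  "S' n N r \<longleftrightarrow> (\<forall>F :: cont_fun set. subspace_of_dim N F \<longrightarrow>
     (\<exists>a b. independent_conditions n a b \<and> dim (F \<inter> solutions n a b) \<ge> r))"

end

theory Submission
  imports Defs "HOL-Library.Z2"
begin

text \<open>Let \<open>b\<^sub>0, \<dots>, b\<^sub>N\<^sub>-\<^sub>1\<close> be independent in the given space (which may be shrunk). The proof looks for \<open>r\<close>
  pairwise orthogonal rows of coefficients, the \<open>i\<close>-th one of \<open>l\<^sup>1\<close>-norm 1 and involving only the
  first \<open>N - r + i + 1\<close> basis functions, whose combinations agree at both ends of \<open>n\<close> chords. The chords
  come in clusters of \<open>2^m\<close> chords with \<open>m \<le> 3\<close>: a cluster consists of two smaller clusters placed at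
  opposite points of a circle, and the directions at all nodes are additional unknowns. The sign changes
  of the rows act freely on the unknowns. Write \<open>u\<^sub>i\<close> for the class of degree one modulo 2 of the \<open>i\<close>-th
  sign. The conditions of one chord have the class \<open>\<Prod>\<^sub>i u\<^sub>i\<close>; the half-turn that exchanges the two halves of a
  cluster replaces the class \<open>x\<close> of the half by the Steenrod square \<open>cup1 x x\<close>, so that a proper
  cluster contributes \<open>\<Sum>\<^sub>i u\<^sub>i \<Prod>\<^sub>l\<^sub>\<noteq>\<^sub>i u\<^sub>l^(2^m)\<close>; orthogonality of the rows \<open>i\<close> and \<open>l\<close> contributes
  \<open>u\<^sub>i + u\<^sub>l\<close>. If the coefficient of \<open>\<Prod>\<^sub>i u\<^sub>i^(N - r + i)\<close> in the product of all these classes is odd, a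
  solution exists: explicit simplicial cochains supported near the solutions yield approximate
  solutions, and compactness an exact one.

  The conditions are independent because the sizes of the nested clusters are chosen such that the chords of
  a cluster, as edges of a bipartite graph, form a forest for all directions. The parity is
  computed for suitable numbers of clusters: dividing by the common powers of the \<open>u\<^sub>i\<close> leaves a product of
  the Vandermonde polynomial and power sums of the inverse variables, where \<open>p\<^sub>m^2 = p\<^sub>2\<^sub>m\<close> modulo 2.\<close>

section \<open>Cochains modulo 2 and Steenrod products\<close>

text \<open>The cochains live on all lists of points, near or far, so their complex sees only the
  group of sign changes: every cohomological step is a formal identity. Geometry enters through
  supports. The cochain of a condition is nonzero on a simplex only if the sign bit of the condition
  changes there, and \<open>fund\<close> proceeds in steps of order 1/M, so a nonzero evaluation
  exhibits a small simplex on which all conditions nearly hold. With single chords alone the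
  coefficient is odd only for N = n + r. A cluster of 2^m chords has 2^m - 1 nodes, and each free
  direction lowers the degree of its class by one; this gain lets N drop to n and below. The price
  is that free directions might let chords form a cycle, and the conditions would become dependent.
  Halves at opposite points of a large circle are disjoint in at least one coordinate. Where the
  other coordinate may fail to separate them, a scale that depends on the direction makes one half
  tiny compared with the other, so that it cannot close a cycle. This is arranged for three levels,
  hence m \<le> 3.\<close>

declare add_bit_eq_xor [simp del] mult_bit_eq_and [simp del]

lemma bit_add_self: "(a::bit) + a = 0"
  by (cases a) auto

lemma bit_add_self_left: "(a::bit) + (a + b) = b"
  by (cases a; cases b) auto

text \<open>A nonempty list is an ordered simplex on its entries, so a function on lists is a cochain of mixed
  degree; \<open>cup1\<close> and \<open>cup2\<close> are Steenrod's products of degree \<open>-1\<close> and \<open>-2\<close>.\<close>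

fun cob_fun :: "('a list \<Rightarrow> bit) \<Rightarrow> 'a list \<Rightarrow> bit" where
  "cob_fun f [] = 0"
| "cob_fun f (x # xs) = f xs + cob_fun (\<lambda>l. f (x # l)) xs"

fun cup_fun :: "('a list \<Rightarrow> bit) \<Rightarrow> ('a list \<Rightarrow> bit) \<Rightarrow> 'a list \<Rightarrow> bit" where
  "cup_fun f g [] = 0"
| "cup_fun f g (x # xs) = f [x] * g (x # xs) + cup_fun (\<lambda>l. f (x # l)) g xs"

fun cup1_fun :: "('a list \<Rightarrow> bit) \<Rightarrow> ('a list \<Rightarrow> bit) \<Rightarrow> 'a list \<Rightarrow> bit" where
  "cup1_fun f g [] = 0"
| "cup1_fun f g (x # xs) = cup_fun (\<lambda>l. g (x # l)) (\<lambda>l. f (x # l)) xs + cup1_fun (\<lambda>l. f (x # l)) g xs"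

fun cup2_fun :: "('a list \<Rightarrow> bit) \<Rightarrow> ('a list \<Rightarrow> bit) \<Rightarrow> 'a list \<Rightarrow> bit" where
  "cup2_fun f g [] = 0"
| "cup2_fun f g (x # xs) = cup1_fun (\<lambda>l. g (x # l)) (\<lambda>l. f (x # l)) xs + cup2_fun (\<lambda>l. f (x # l)) g xs"

text \<open>The usual triangulation of a prism: a simplex runs along \<open>f\<close> up to some
  vertex, whose image under \<open>g\<close> follows, and goes on along \<open>g\<close>. This is
  the chain homotopy from \<open>f\<close> to \<open>g\<close>.\<close>

fun prism_fun :: "('a \<Rightarrow> 'b) \<Rightarrow> ('a \<Rightarrow> 'b) \<Rightarrow> ('b list \<Rightarrow> bit) \<Rightarrow> 'a list \<Rightarrow> bit" where
  "prism_fun f g \<phi> [] = 0"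
| "prism_fun f g \<phi> (x # xs) = \<phi> (f x # g x # map g xs) + prism_fun f g (\<lambda>l. \<phi> (f x # l)) xs"

section \<open>Identities for cochains as functions on lists\<close>

lemma cob_fun_add: "cob_fun (\<lambda>l. f l + g l) l = cob_fun f l + cob_fun g l"
  by (induction l arbitrary: f g) (simp_all add: ac_simps)

lemma cob_fun_mult: "cob_fun (\<lambda>l. c * g l) l = c * cob_fun g l"
  by (induction l arbitrary: g) (simp_all add: algebra_simps)

lemma cob_fun_zero: "cob_fun (\<lambda>l. 0) l = 0"
  by (induction l) simp_all

lemma cup_fun_add_left: "cup_fun (\<lambda>l. f l + g l) h l = cup_fun f h l + cup_fun g h l"
  by (induction l arbitrary: f g) (simp_all add: algebra_simps)

lemma cup_fun_add_right: "cup_fun h (\<lambda>l. f l + g l) l = cup_fun h f l + cup_fun h g l"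
  by (induction l arbitrary: h) (simp_all add: algebra_simps)

lemma cup_fun_mult_left: "cup_fun (\<lambda>l. c * f l) h l = c * cup_fun f h l"
  by (induction l arbitrary: f) (simp_all add: algebra_simps)

lemma cup_fun_mult_right: "cup_fun h (\<lambda>l. c * f l) l = c * cup_fun h f l"
  by (induction l arbitrary: h) (simp_all add: algebra_simps)

lemma cup1_fun_add_left: "cup1_fun (\<lambda>l. f l + g l) h l = cup1_fun f h l + cup1_fun g h l"
  by (induction l arbitrary: f g) (simp_all add: algebra_simps cup_fun_add_right)

lemma cup1_fun_add_right: "cup1_fun h (\<lambda>l. f l + g l) l = cup1_fun h f l + cup1_fun h g l"
  by (induction l arbitrary: h) (simp_all add: algebra_simps cup_fun_add_left)

lemma cup1_fun_mult_left: "cup1_fun (\<lambda>l. c * f l) h l = c * cup1_fun f h l"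
  by (induction l arbitrary: f) (simp_all add: algebra_simps cup_fun_mult_right)

text \<open>The induction fixes the first vertex, which leaves functions that need not vanish at the
  empty list. The last two terms correct for this; they disappear for elements of
  \<open>cochain\<close>.\<close>

lemma cob_fun_cup_fun:
  "cob_fun (cup_fun f g) l = cup_fun (cob_fun f) g l + cup_fun f (cob_fun g) l + f [] * g l + f l * g []"
proof (induction l arbitrary: f)
  case Nil
  show ?case by (simp add: bit_add_self)
next
  case (Cons x xs)
  show ?case
    by (simp add: cob_fun_add cob_fun_mult cup_fun_add_left cup_fun_add_right Cons.IH algebra_simps bit_add_self bit_add_self_left)
qed

lemma cob_fun_cup1_fun:
  "cob_fun (cup1_fun f g) l = cup1_fun (cob_fun f) g l + cup1_fun f (cob_fun g) l + cup_fun f g l + cup_fun g f l"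
proof (induction l arbitrary: f)
  case Nil
  show ?case by simp
next
  case (Cons x xs)
  show ?case
    by (simp add: cob_fun_add cob_fun_cup_fun cob_fun_mult cup_fun_add_left cup_fun_add_right cup1_fun_add_left Cons.IH algebra_simps bit_add_self bit_add_self_left)
qed

lemma cob_fun_cup2_fun:
  "cob_fun (cup2_fun f g) l = cup2_fun (cob_fun f) g l + cup2_fun f (cob_fun g) l + cup1_fun f g l + cup1_fun g f l"
proof (induction l arbitrary: f)
  case Nil
  show ?case by simp
next
  case (Cons x xs)
  have *: "cup2_fun (\<lambda>l. f l + h l) g l = cup2_fun f g l + cup2_fun h g l" for f h l
    by (induction l arbitrary: f h) (simp_all add: algebra_simps cup1_fun_add_right)
  show ?case
    by (simp add: cob_fun_add cob_fun_cup1_fun cob_fun_mult cup_fun_add_left cup_fun_add_right cup1_fun_add_left cup1_fun_add_right * Cons.IH algebra_simps bit_add_self bit_add_self_left)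
qed

lemma cup_fun_assoc: "cup_fun (cup_fun f g) h l = cup_fun f (cup_fun g h) l"
  by (induction l arbitrary: f)
    (simp_all add: cup_fun_add_left cup_fun_add_right cup_fun_mult_left cup_fun_mult_right algebra_simps)

text \<open>The interval evaluated by \<open>h\<close> lies on one side of the cut between
  \<open>f\<close> and \<open>g\<close>. Hence in the first argument the Hirsch formula holds
  exactly and not only up to a coboundary.\<close>

lemma hirsch_fun: "cup1_fun (cup_fun f g) h l = cup_fun f (cup1_fun g h) l + cup_fun (cup1_fun f h) g l"
  by (induction l arbitrary: f)
   (simp_all add: cup_fun_add_left cup_fun_add_right cup1_fun_add_left cup1_fun_mult_left cup_fun_mult_left cup_fun_mult_right cup_fun_assoc algebra_simps)

lemma prism_fun_add: "prism_fun f g (\<lambda>l. \<phi> l + \<psi> l) l = prism_fun f g \<phi> l + prism_fun f g \<psi> l"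
  by (induction l arbitrary: \<phi> \<psi>) (simp_all add: algebra_simps)

lemma cob_fun_map: "cob_fun (\<lambda>l. \<phi> (map f l)) l = cob_fun \<phi> (map f l)"
  by (induction l arbitrary: \<phi>) simp_all

lemma cob_fun_prism_fun:
  "cob_fun (prism_fun f g \<phi>) l + prism_fun f g (cob_fun \<phi>) l = \<phi> (map f l) + \<phi> (map g l)"
proof (induction l arbitrary: \<phi>)
  case Nil
  show ?case by (simp add: bit_add_self)
next
  case (Cons x xs)
  have "prism_fun f g (cob_fun (\<lambda>l. \<phi> (f x # l))) xs = cob_fun (prism_fun f g (\<lambda>l. \<phi> (f x # l))) xs + \<phi> (f x # map f xs) + \<phi> (f x # map g xs)"
    using Cons.IH[of "\<lambda>l. \<phi> (f x # l)"] by (metis add.assoc bit_add_self_left)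
  then show ?case
    by (simp add: cob_fun_add prism_fun_add cob_fun_map algebra_simps bit_add_self bit_add_self_left cob_fun_map[of "\<lambda>l. \<phi> (f x # g x # l)"])
qed

text \<open>Locality: the two factors are nonzero on simplices with vertices among the given ones.
  In this way approximate zeros of the single conditions are recovered from a product.\<close>

lemma cup_fun_nonzero:
  "cup_fun f g l \<noteq> 0 \<Longrightarrow>
    \<exists>l1 l2. l1 \<noteq> [] \<and> l2 \<noteq> [] \<and> set l1 \<subseteq> set l \<and> set l2 \<subseteq> set l \<and> f l1 \<noteq> 0 \<and> g l2 \<noteq> 0"
proof (induction l arbitrary: f)
  case (Cons x xs)
  show ?case
  proof (cases "f [x] * g (x # xs) = 0")
    case True
    with Cons.prems have "cup_fun (\<lambda>l. f (x # l)) g xs \<noteq> 0" by simp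
    from Cons.IH[OF this] obtain l1 l2 where
      "l2 \<noteq> []" "set l1 \<subseteq> set xs" "set l2 \<subseteq> set xs" "f (x # l1) \<noteq> 0" "g l2 \<noteq> 0" by blast
    then show ?thesis by (intro exI[of _ "x # l1"] exI[of _ l2]) auto
  next
    case False
    then have "f [x] \<noteq> 0" "g (x # xs) \<noteq> 0" by auto
    then show ?thesis by (intro exI[of _ "[x]"] exI[of _ "x # xs"]) auto
  qed
qed simp

lemma cup1_fun_nonzero:
  "cup1_fun f g l \<noteq> 0 \<Longrightarrow>
    \<exists>l1 l2. l1 \<noteq> [] \<and> l2 \<noteq> [] \<and> set l1 \<subseteq> set l \<and> set l2 \<subseteq> set l \<and> f l1 \<noteq> 0 \<and> g l2 \<noteq> 0"
proof (induction l arbitrary: f)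
  case (Cons x xs)
  show ?case
  proof (cases "cup_fun (\<lambda>l. g (x # l)) (\<lambda>l. f (x # l)) xs = 0")
    case True
    with Cons.prems have "cup1_fun (\<lambda>l. f (x # l)) g xs \<noteq> 0" by simp
    from Cons.IH[OF this] obtain l1 l2 where
      "l2 \<noteq> []" "set l1 \<subseteq> set xs" "set l2 \<subseteq> set xs" "f (x # l1) \<noteq> 0" "g l2 \<noteq> 0" by blast
    then show ?thesis by (intro exI[of _ "x # l1"] exI[of _ l2]) auto
  next
    case False
    from cup_fun_nonzero[OF this] obtain l1 l2 where
      "set l1 \<subseteq> set xs" "set l2 \<subseteq> set xs" "g (x # l1) \<noteq> 0" "f (x # l2) \<noteq> 0" by blast
    then show ?thesis by (intro exI[of _ "x # l2"] exI[of _ "x # l1"]) auto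
  qed
qed simp

lemma prism_fun_nonzero:
  "prism_fun f g \<phi> l \<noteq> 0 \<Longrightarrow> \<exists>l'. set l' \<subseteq> f ` set l \<union> g ` set l \<and> length l' = Suc (length l) \<and> \<phi> l' \<noteq> 0"
proof (induction l arbitrary: \<phi>)
  case (Cons x xs)
  show ?case
  proof (cases "\<phi> (f x # g x # map g xs) = 0")
    case True
    with Cons.prems have "prism_fun f g (\<lambda>l. \<phi> (f x # l)) xs \<noteq> 0" by simp
    from Cons.IH[OF this] obtain l' where
      "set l' \<subseteq> f ` set xs \<union> g ` set xs" "length l' = Suc (length xs)" "\<phi> (f x # l') \<noteq> 0" by blast
    then show ?thesis by (intro exI[of _ "f x # l'"]) auto
  next
    case False
    then show ?thesis by (intro exI[of _ "f x # g x # map g xs"]) auto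
  qed
qed simp

lemma cup_fun_map: "cup_fun (\<lambda>l. \<phi> (map f l)) (\<lambda>l. \<psi> (map f l)) l = cup_fun \<phi> \<psi> (map f l)"
  by (induction l arbitrary: \<phi>) (simp_all add: algebra_simps)

lemma cup1_fun_map: "cup1_fun (\<lambda>l. \<phi> (map f l)) (\<lambda>l. \<psi> (map f l)) l = cup1_fun \<phi> \<psi> (map f l)"
proof (induction l arbitrary: \<phi>)
  case (Cons x xs)
  show ?case
    using cup_fun_map[of "\<lambda>l. \<psi> (f x # l)" f "\<lambda>l. \<phi> (f x # l)" xs] Cons.IH[of "\<lambda>l. \<phi> (f x # l)"] by simp
qed simp

lemma prism_fun_map:
  assumes "\<And>x. f (h x) = h' (f' x)" "\<And>x. g (h x) = h' (g' x)"
  shows "prism_fun f g \<phi> (map h l) = prism_fun f' g' (\<lambda>l. \<phi> (map h' l)) l"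
proof (induction l arbitrary: \<phi>)
  case (Cons x xs)
  have "map g (map h xs) = map h' (map g' xs)"
    by (simp add: assms(2))
  with Cons.IH[of "\<lambda>l. \<phi> (h' (f' x) # l)"] show ?case
    by (simp only: list.map prism_fun.simps assms)
qed simp

lemma cup_fun_one_left: "l \<noteq> [] \<Longrightarrow> cup_fun (\<lambda>l. of_bool (length l = 1)) g l = g l"
proof (cases l)
  case (Cons x xs)
  have *: "cup_fun (\<lambda>l. 0) g xs = 0" for xs by (induction xs) simp_all
  have "cup_fun (\<lambda>l. of_bool (l = [])) g xs = 0" by (cases xs) (simp_all add: *)
  with Cons show ?thesis by simp
qed simp

lemma cup_fun_one_right: "l \<noteq> [] \<Longrightarrow> cup_fun g (\<lambda>l. of_bool (length l = 1)) l = g l"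
proof (induction l arbitrary: g)
  case (Cons x xs)
  show ?case by (cases "xs = []") (simp_all add: Cons.IH[simplified])
qed simp

section \<open>The ring of cochains and its operations\<close>

typedef 'a cochain = "{\<phi> :: 'a list \<Rightarrow> bit. \<phi> [] = 0}"
  morphisms cval Abs_cochain
  by (rule exI[of _ "\<lambda>l. 0"]) simp

setup_lifting type_definition_cochain

lemma cval_Nil [simp]: "cval \<phi> [] = 0"
  using cval[of \<phi>] by simp

lemma cochain_eqI: "(\<And>l. l \<noteq> [] \<Longrightarrow> cval \<phi> l = cval \<psi> l) \<Longrightarrow> \<phi> = \<psi>"
  by (metis cval_Nil cval_inject ext)

instantiation cochain :: (type) ring_1
begin

lift_definition zero_cochain :: "'a cochain" is "\<lambda>l. 0" by simp
lift_definition one_cochain :: "'a cochain" is "\<lambda>l. of_bool (length l = 1)" by simp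
lift_definition plus_cochain :: "'a cochain \<Rightarrow> 'a cochain \<Rightarrow> 'a cochain" is "\<lambda>f g l. f l + g l" by simp
lift_definition minus_cochain :: "'a cochain \<Rightarrow> 'a cochain \<Rightarrow> 'a cochain" is "\<lambda>f g l. f l + g l" by simp
lift_definition uminus_cochain :: "'a cochain \<Rightarrow> 'a cochain" is "\<lambda>f. f" by simp
lift_definition times_cochain :: "'a cochain \<Rightarrow> 'a cochain \<Rightarrow> 'a cochain" is cup_fun by simp

instance
proof
  fix a b c :: "'a cochain"
  show "a * b * c = a * (b * c)"
    by (transfer, rule ext) (simp add: cup_fun_assoc)
  show "1 * a = a"
    by (rule cochain_eqI, transfer) (rule cup_fun_one_left)
  show "a * 1 = a"
    by (rule cochain_eqI, transfer) (rule cup_fun_one_right)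
  show "(a + b) * c = a * c + b * c"
    by (transfer, rule ext) (simp add: cup_fun_add_left)
  show "a * (b + c) = a * b + a * c"
    by (transfer, rule ext) (simp add: cup_fun_add_right)
  show "(0::'a cochain) \<noteq> 1"
    by transfer (auto simp: fun_eq_iff intro: exI[of _ "[undefined]"])
qed (transfer; simp add: fun_eq_iff ac_simps bit_add_self)+

end

lemma cochain_add_self [simp]: "(a::'a cochain) + a = 0"
  by transfer (simp add: bit_add_self)

lemma cochain_add_self_left [simp]: "(a::'a cochain) + (a + b) = b"
  by (metis add.assoc add_0 cochain_add_self)

lemma cochain_eq_iff_add: "(a::'a cochain) = b \<longleftrightarrow> a + b = 0"
  by (metis add.right_neutral cochain_add_self cochain_add_self_left)

lift_definition cob :: "'a cochain \<Rightarrow> 'a cochain" is cob_fun by simp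
lift_definition cup1 :: "'a cochain \<Rightarrow> 'a cochain \<Rightarrow> 'a cochain" is cup1_fun by simp
lift_definition cup2 :: "'a cochain \<Rightarrow> 'a cochain \<Rightarrow> 'a cochain" is cup2_fun by simp
lift_definition pull :: "('a \<Rightarrow> 'b) \<Rightarrow> 'b cochain \<Rightarrow> 'a cochain" is "\<lambda>f \<phi> l. \<phi> (map f l)" by simp
lift_definition prism :: "('a \<Rightarrow> 'b) \<Rightarrow> ('a \<Rightarrow> 'b) \<Rightarrow> 'b cochain \<Rightarrow> 'a cochain" is prism_fun by simp

lemma cob_add: "cob (a + b) = cob a + cob b"
  by (transfer, rule ext) (simp add: cob_fun_add)

lemma cob_0 [simp]: "cob 0 = 0"
  by (metis cob_add cochain_add_self)

lemma cob_mult: "cob (a * b) = cob a * b + a * cob b"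
  by (transfer, rule ext) (simp add: cob_fun_cup_fun)

lemma cob_cup1: "cob (cup1 a b) = cup1 (cob a) b + cup1 a (cob b) + a * b + b * a"
  by (transfer, rule ext) (simp add: cob_fun_cup1_fun)

lemma cob_cup2: "cob (cup2 a b) = cup2 (cob a) b + cup2 a (cob b) + cup1 a b + cup1 b a"
  by (transfer, rule ext) (simp add: cob_fun_cup2_fun)

lemma cup1_add_left: "cup1 (a + b) c = cup1 a c + cup1 b c"
  by (transfer, rule ext) (simp add: cup1_fun_add_left)

lemma cup1_add_right: "cup1 a (b + c) = cup1 a b + cup1 a c"
  by (transfer, rule ext) (simp add: cup1_fun_add_right)

lemma cup1_0_left [simp]: "cup1 0 a = 0"
  by (metis cup1_add_left cochain_add_self)

lemma cup1_0_right [simp]: "cup1 a 0 = 0"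
  by (metis cup1_add_right cochain_add_self)

lemma cup2_0_left [simp]: "cup2 0 a = 0"
proof -
  have *: "cup1_fun g (\<lambda>l. 0) xs = 0" for g :: "'a list \<Rightarrow> bit" and xs
    using cup1_fun_add_right[of g "\<lambda>l. 0" "\<lambda>l. 0" xs] by simp
  have "cup2_fun (\<lambda>l. 0) g xs = 0" for g :: "'a list \<Rightarrow> bit" and xs
    by (induction xs) (simp_all add: *)
  then show ?thesis by (intro cochain_eqI) (simp add: cup2.rep_eq zero_cochain.rep_eq)
qed

lemma cup2_0_right [simp]: "cup2 a 0 = 0"
proof -
  have *: "cup1_fun (\<lambda>l. 0) g xs = 0" for g :: "'a list \<Rightarrow> bit" and xs
    using cup1_fun_add_left[of "\<lambda>l. 0" "\<lambda>l. 0" g xs] by simp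
  have "cup2_fun g (\<lambda>l. 0) xs = 0" for g :: "'a list \<Rightarrow> bit" and xs
    by (induction xs arbitrary: g) (simp_all add: *)
  then show ?thesis by (intro cochain_eqI) (simp add: cup2.rep_eq zero_cochain.rep_eq)
qed

lemma hirsch: "cup1 (a * b) c = a * cup1 b c + cup1 a c * b"
  by (transfer, rule ext) (simp add: hirsch_fun)

lemma cob_cob: "cob (cob a) = 0"
proof -
  have "cob_fun (cob_fun f) l = 0" for f :: "'a list \<Rightarrow> bit" and l
    by (induction l arbitrary: f) (simp_all add: cob_fun_add bit_add_self)
  then show ?thesis by (intro cochain_eqI) (simp add: cob.rep_eq zero_cochain.rep_eq)
qed

lemma pull_add: "pull f (a + b) = pull f a + pull f b"
  by transfer simp

lemma pull_0 [simp]: "pull f 0 = 0"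
  by transfer simp

lemma pull_1 [simp]: "pull f 1 = 1"
  by transfer simp

lemma pull_mult: "pull f (a * b) = pull f a * pull f b"
  by (transfer, rule ext) (simp add: cup_fun_map)

lemma pull_cup1: "pull f (cup1 a b) = cup1 (pull f a) (pull f b)"
  by (transfer, rule ext) (simp add: cup1_fun_map)

lemma pull_cob: "pull f (cob a) = cob (pull f a)"
  by (transfer, rule ext) (simp add: cob_fun_map)

lemma pull_pull: "pull f (pull g a) = pull (g \<circ> f) a"
  by transfer (simp add: comp_def)

lemma pull_id: "pull (\<lambda>x. x) a = a"
  by transfer simp

lemma prism_add: "prism f g (a + b) = prism f g a + prism f g b"
  by (transfer, rule ext) (simp add: prism_fun_add)

lemma prism_0 [simp]: "prism f g 0 = 0"
  by (metis prism_add cochain_add_self)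

lemma cob_prism: "cob (prism f g a) + prism f g (cob a) = pull f a + pull g a"
  by (transfer, rule ext) (simp add: cob_fun_prism_fun)

lemma pull_prism:
  assumes "\<And>x. f (h x) = h' (f' x)" "\<And>x. g (h x) = h' (g' x)"
  shows "pull h (prism f g a) = prism f' g' (pull h' a)"
  using assms by (transfer, intro ext) (rule prism_fun_map)

lemma cval_mult_nonzero:
  "cval (a * b) l \<noteq> 0 \<Longrightarrow>
    \<exists>l1 l2. l1 \<noteq> [] \<and> l2 \<noteq> [] \<and> set l1 \<subseteq> set l \<and> set l2 \<subseteq> set l \<and> cval a l1 \<noteq> 0 \<and> cval b l2 \<noteq> 0"
  by transfer (rule cup_fun_nonzero)

lemma cval_cup1_nonzero:
  "cval (cup1 a b) l \<noteq> 0 \<Longrightarrow>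
    \<exists>l1 l2. l1 \<noteq> [] \<and> l2 \<noteq> [] \<and> set l1 \<subseteq> set l \<and> set l2 \<subseteq> set l \<and> cval a l1 \<noteq> 0 \<and> cval b l2 \<noteq> 0"
  by transfer (rule cup1_fun_nonzero)

lemma cval_prism_nonzero:
  "cval (prism f g \<phi>) l \<noteq> 0 \<Longrightarrow>
    \<exists>l'. set l' \<subseteq> f ` set l \<union> g ` set l \<and> length l' = Suc (length l) \<and> cval \<phi> l' \<noteq> 0"
  by transfer (rule prism_fun_nonzero)

lemma cval_pull: "cval (pull f \<phi>) l = cval \<phi> (map f l)"
  by transfer simp

lemma cval_add: "cval (a + b) l = cval a l + cval b l"
  by transfer simp

lemma cval_0: "cval 0 l = 0"
  by transfer simp

lemma pull_map_eq: "pull f \<phi> = pull g \<phi>" if "\<And>x. f x = g x" for f g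
proof -
  have "f = g" using that by (rule ext)
  then show ?thesis by simp
qed

text \<open>If a sign change adds 1 to \<open>s\<close>, then \<open>cob (vertex s)\<close> is
  invariant although \<open>vertex s\<close> is not; nontrivial classes of degree one arise in this
  way from coboundaries.\<close>

lift_definition vertex :: "('a \<Rightarrow> bit) \<Rightarrow> 'a cochain" is
  "\<lambda>s l. if length l = 1 then s (hd l) else 0" by simp

lemma vertex_add: "vertex (\<lambda>x. s x + t x) = vertex s + vertex t"
  by (transfer, rule ext) simp

lemma vertex_1: "vertex (\<lambda>x. 1) = 1"
  by (transfer, rule ext) simp

lemma pull_vertex: "pull f (vertex s) = vertex (\<lambda>x. s (f x))"
proof (rule cochain_eqI)
  fix l :: "'a list" assume "l \<noteq> []"
  then show "cval (pull f (vertex s)) l = cval (vertex (\<lambda>x. s (f x))) l"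
    by (cases l) (simp_all add: cval_pull vertex.rep_eq)
qed

lemma cval_cob_vertex: "cval (cob (vertex s)) l = (if length l = 2 then s (l ! 0) + s (l ! 1) else 0)"
proof (cases l)
  case (Cons x xs)
  have *: "cob_fun (\<lambda>l. 0) xs = 0" for xs :: "'a list" by (rule cob_fun_zero)
  have **: "cob_fun (\<lambda>l. if l = [] then c else 0) xs = (if length xs = 1 then c else 0)" for c and xs :: "'a list"
    by (cases xs) (simp_all add: *)
  show ?thesis
    by (cases xs) (simp_all add: Cons cob.rep_eq vertex.rep_eq ** * cong: if_cong)
qed (simp add: cob.rep_eq)

lemma cob_1 [simp]: "cob 1 = 0"
proof -
  have "cval (cob 1) l = 0" for l :: "'a list"
    unfolding vertex_1[symmetric] cval_cob_vertex by (simp add: bit_add_self)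
  then show ?thesis by (intro cochain_eqI) (simp add: cval_0)
qed

lemma cup1_vertex_left: "cup1 (vertex s) c = 0"
proof -
  have z: "cup_fun g (\<lambda>l. 0) xs = 0" "cup1_fun (\<lambda>l. 0) g xs = 0" for g :: "'a list \<Rightarrow> bit" and xs
    using cup_fun_add_right[of g "\<lambda>l. 0" "\<lambda>l. 0" xs] cup1_fun_add_left[of "\<lambda>l. 0" "\<lambda>l. 0" g xs] by simp_all
  have e: "cup_fun g (\<lambda>l. if l = [] then c else 0) xs = 0" "cup1_fun (\<lambda>l. if l = [] then c else 0) g xs = 0"
    for g :: "'a list \<Rightarrow> bit" and xs c
  proof (induction xs arbitrary: g)
    case (Cons x xs)
    { case 1 show ?case using Cons.IH(1)[of "\<lambda>l. g (x # l)"] by simp }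
    { case 2 show ?case by (simp add: z) }
  qed simp_all
  have "cup1_fun (\<lambda>l. if length l = 1 then s (hd l) else 0) (cval c) l = 0" for l
    by (cases l) (simp_all add: e cong: if_cong)
  then show ?thesis
    by (intro cochain_eqI) (simp add: cup1.rep_eq vertex.rep_eq cval_0)
qed

text \<open>\<open>cup1\<close> vanishes when its left argument has degree 0, so its coboundary
  formula reduces to this commutator.\<close>

lemma cup1_cob_vertex:
  assumes "cob c = 0"
  shows "cup1 (cob (vertex s)) c = vertex s * c + c * vertex s"
proof -
  have "cup1 (cob (vertex s)) c + (vertex s * c + c * vertex s) = 0"
    using cob_cup1[of "vertex s" c] by (simp add: cup1_vertex_left assms add.assoc)
  then show ?thesis by (simp only: cochain_eq_iff_add[symmetric])
qed

text \<open>With \<open>cup1_cob_vertex\<close> this says \<open>cup1 u u = u\<close> for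
  \<open>u = cob (vertex s)\<close>: the lower square of a class of degree one is the class itself.
  On an edge it is an identity between two bits.\<close>

lemma vertex_cob_vertex:
  "vertex s * cob (vertex s) + cob (vertex s) * vertex s = cob (vertex s)"
proof (rule cochain_eqI)
  fix l :: "'a list" assume "l \<noteq> []"
  then obtain x xs where l: "l = x # xs" by (cases l) auto
  have v: "cval (a * b) [x] = cval a [x] * cval b [x]"
    "cval (a * b) [x, y] = cval a [x] * cval b [x, y] + cval a [x, y] * cval b [y]" for a b :: "'a cochain" and x y
    by (simp_all add: times_cochain.rep_eq)
  show "cval (vertex s * cob (vertex s) + cob (vertex s) * vertex s) l = cval (cob (vertex s)) l"
  proof (cases xs)
    case Nil
    then show ?thesis by (simp add: l cval_add v cval_cob_vertex)
  next
    case (Cons y ys)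
    show ?thesis
    proof (cases ys)
      case Nil
      have "a * (a + b) + (a + b) * b = a + b" for a b :: bit
        by (cases a; cases b) simp_all
      then show ?thesis by (simp add: l Cons Nil cval_add v cval_cob_vertex vertex.rep_eq)
    next
      case (Cons z zs)
      have "cval (vertex s * cob (vertex s)) l = 0"
      proof (rule ccontr)
        assume "\<not> ?thesis"
        moreover have "cup_fun (\<lambda>l. if l = [] then c else 0) g xs = 0" for g :: "'a list \<Rightarrow> bit" and xs c
        proof (cases xs)
          case (Cons a as)
          have "cup_fun (\<lambda>l. 0) g as = 0" using cup_fun_add_left[of "\<lambda>l. 0" "\<lambda>l. 0" g as] by simp
          then show ?thesis by (simp add: Cons)
        qed simp
        ultimately show False
          by (simp add: l \<open>xs = y # ys\<close> Cons times_cochain.rep_eq vertex.rep_eq cval_cob_vertex cong: if_cong)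
      qed
      moreover have "cval (cob (vertex s) * vertex s) l = 0"
      proof -
        have "cup_fun g (\<lambda>l. if length l = 1 then s (hd l) else 0) l = g l * s (last l)" if "l \<noteq> []" for g and l :: "'a list"
          using that
        proof (induction l arbitrary: g)
          case (Cons a as)
          then show ?case by (cases "as = []") simp_all
        qed simp
        from this[of l] show ?thesis
          by (simp add: l \<open>xs = y # ys\<close> Cons times_cochain.rep_eq vertex.rep_eq cval_cob_vertex del: cup_fun.simps)
      qed
      ultimately show ?thesis
        by (simp add: cval_add) (simp add: l \<open>xs = y # ys\<close> Cons cval_cob_vertex)
    qed
  qed
qed

section \<open>Invariant cochains up to coboundaries of invariant cochains\<close>

definition invariant :: "('i \<Rightarrow> 'a \<Rightarrow> 'a) \<Rightarrow> 'a cochain \<Rightarrow> bool" where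
  "invariant T \<phi> \<longleftrightarrow> (\<forall>i. pull (T i) \<phi> = \<phi>)"

text \<open>Invariance of the primitive is the point: coning makes every cocycle of positive degree
  the coboundary of some cochain, which in general is not invariant.\<close>

definition cohomologous :: "('i \<Rightarrow> 'a \<Rightarrow> 'a) \<Rightarrow> 'a cochain \<Rightarrow> 'a cochain \<Rightarrow> bool" where
  "cohomologous T a b \<longleftrightarrow> (\<exists>\<kappa>. invariant T \<kappa> \<and> a + b = cob \<kappa>)"

definition cocycle :: "('i \<Rightarrow> 'a \<Rightarrow> 'a) \<Rightarrow> 'a cochain \<Rightarrow> bool" where
  "cocycle T a \<longleftrightarrow> invariant T a \<and> cob a = 0"

lemma invariant_add: "invariant T a \<Longrightarrow> invariant T b \<Longrightarrow> invariant T (a + b)"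
  by (simp add: invariant_def pull_add)

lemma invariant_mult: "invariant T a \<Longrightarrow> invariant T b \<Longrightarrow> invariant T (a * b)"
  by (simp add: invariant_def pull_mult)

lemma invariant_0 [simp]: "invariant T 0"
  by (simp add: invariant_def)

lemma invariant_1 [simp]: "invariant T 1"
  by (simp add: invariant_def)

lemma invariant_cob: "invariant T a \<Longrightarrow> invariant T (cob a)"
  by (metis invariant_def pull_cob)

lemma invariant_cup1: "invariant T a \<Longrightarrow> invariant T b \<Longrightarrow> invariant T (cup1 a b)"
  by (simp add: invariant_def pull_cup1)

lemma pull_cup2: "pull f (cup2 a b) = cup2 (pull f a) (pull f b)"
proof -
  have "cup2_fun (\<lambda>l. \<phi> (map f l)) (\<lambda>l. \<psi> (map f l)) l = cup2_fun \<phi> \<psi> (map f l)" for \<phi> \<psi> l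
  proof (induction l arbitrary: \<phi>)
    case (Cons x xs)
    show ?case
      using cup1_fun_map[of "\<lambda>l. \<psi> (f x # l)" f "\<lambda>l. \<phi> (f x # l)" xs] Cons.IH[of "\<lambda>l. \<phi> (f x # l)"] by simp
  qed simp
  then show ?thesis by (intro cochain_eqI) (simp add: cup2.rep_eq cval_pull pull.rep_eq)
qed

lemma invariant_cup2: "invariant T a \<Longrightarrow> invariant T b \<Longrightarrow> invariant T (cup2 a b)"
  by (simp add: invariant_def pull_cup2)

lemma invariant_pull:
  assumes "invariant T' a" "\<And>i x. f (T i x) = T' i (f x)"
  shows "invariant T (pull f a)"
proof -
  have "pull (T i) (pull f a) = pull f (pull (T' i) a)" for i
    unfolding pull_pull by (rule pull_map_eq) (simp add: assms(2))
  then show ?thesis using assms(1) by (simp add: invariant_def)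
qed

lemma invariant_prism:
  assumes "invariant T' a" "\<And>i x. f (T i x) = T' i (f x)" "\<And>i x. g (T i x) = T' i (g x)"
  shows "invariant T (prism f g a)"
  unfolding invariant_def
proof
  fix i
  have "pull (T i) (prism f g a) = prism f g (pull (T' i) a)"
    by (rule pull_prism) (simp_all add: assms(2,3))
  then show "pull (T i) (prism f g a) = prism f g a"
    using assms(1) by (simp add: invariant_def)
qed

lemma cohomologous_refl [simp]: "cohomologous T a a"
  unfolding cohomologous_def by (rule exI[of _ 0]) simp

lemma cohomologous_trans: "cohomologous T a b \<Longrightarrow> cohomologous T b c \<Longrightarrow> cohomologous T a c"
proof -
  assume "cohomologous T a b" "cohomologous T b c"
  then obtain k k' where "invariant T k" "invariant T k'" "a + b = cob k" "b + c = cob k'"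
    unfolding cohomologous_def by blast
  moreover have "a + c = (a + b) + (b + c)" by (simp add: ac_simps)
  ultimately show ?thesis
    unfolding cohomologous_def by (intro exI[of _ "k + k'"]) (simp add: invariant_add cob_add)
qed

lemma cohomologous_add:
  assumes "cohomologous T a b" "cohomologous T c d" shows "cohomologous T (a + c) (b + d)"
proof -
  from assms obtain k k' where "invariant T k" "invariant T k'" "a + b = cob k" "c + d = cob k'"
    unfolding cohomologous_def by blast
  moreover have "(a + c) + (b + d) = (a + b) + (c + d)" by (simp add: ac_simps)
  ultimately show ?thesis
    unfolding cohomologous_def by (intro exI[of _ "k + k'"]) (simp add: invariant_add cob_add)
qed

lemma cohomologous_mult:
  assumes "cohomologous T a b" "cohomologous T c d" "cocycle T a" "cocycle T d"
  shows "cohomologous T (a * c) (b * d)"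
proof -
  from assms obtain k k' where k: "invariant T k" "invariant T k'" "a + b = cob k" "c + d = cob k'"
    unfolding cohomologous_def by blast
  have "a * c + b * d = a * (c + d) + (a + b) * d" by (simp add: algebra_simps)
  also have "\<dots> = cob (a * k' + k * d)"
    using assms(3,4) by (simp add: k cob_add cob_mult cocycle_def)
  finally show ?thesis
    using k assms(3,4) unfolding cohomologous_def cocycle_def
    by (intro exI[of _ "a * k' + k * d"]) (auto intro: invariant_add invariant_mult)
qed

lemma cohomologous_pull:
  assumes "cohomologous T' a b" "\<And>i x. f (T i x) = T' i (f x)"
  shows "cohomologous T (pull f a) (pull f b)"
proof -
  from assms(1) obtain k where "invariant T' k" "a + b = cob k" unfolding cohomologous_def by blast
  then show ?thesis unfolding cohomologous_def
    by (intro exI[of _ "pull f k"]) (auto simp: pull_add[symmetric] pull_cob intro: invariant_pull assms(2))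
qed

lemma cocycle_add: "cocycle T a \<Longrightarrow> cocycle T b \<Longrightarrow> cocycle T (a + b)"
  by (simp add: cocycle_def invariant_add cob_add)

lemma cocycle_mult: "cocycle T a \<Longrightarrow> cocycle T b \<Longrightarrow> cocycle T (a * b)"
  by (simp add: cocycle_def invariant_mult cob_mult)

lemma cocycle_0 [simp]: "cocycle T 0" by (simp add: cocycle_def)

lemma cocycle_1 [simp]: "cocycle T 1" by (simp add: cocycle_def)

lemma cocycle_pull:
  assumes "cocycle T' a" "\<And>i x. f (T i x) = T' i (f x)"
  shows "cocycle T (pull f a)"
  using assms(1) invariant_pull[of T' a f T, OF _ assms(2)] by (simp add: cocycle_def pull_cob[symmetric])

text \<open>The mixed terms \<open>cup1 x y + cup1 y x\<close> are the coboundary of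
  \<open>cup2 x y\<close>.\<close>

lemma Sq_add:
  assumes "cocycle T x" "cocycle T y"
  shows "cohomologous T (cup1 (x + y) (x + y)) (cup1 x x + cup1 y y)"
  unfolding cohomologous_def
  using assms cob_cup2[of x y]
  by (intro exI[of _ "cup2 x y"]) (auto simp: cocycle_def cup1_add_left cup1_add_right invariant_cup2 ac_simps)

lemma cocycle_Sq: "cocycle T x \<Longrightarrow> cocycle T (cup1 x x)"
  by (simp add: cocycle_def invariant_cup1 cob_cup1)

text \<open>The Cartan formula for the square below the top degree, with one factor of degree one.\<close>

lemma Sq_mult_vertex:
  fixes x u :: "'a cochain"
  assumes x: "cocycle T x" and u: "u = cob (vertex s)" "invariant T u"
  shows "cohomologous T (cup1 (x * u) (x * u)) (x * x * u + cup1 x x * u * u)"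
proof -
  have cx: "cob x = 0" and cu: "cob u = 0" using x u(1) by (simp_all add: cocycle_def cob_cob)
  have cxu: "cob (x * u) = 0" by (simp add: cob_mult cx cu)
  \<comment> \<open>On cocycles \<open>cup1 u\<close> is the commutator with
    \<open>vertex s\<close>, which is a derivation.\<close>
  define D where "D c = vertex s * c + c * vertex s" for c :: "'a cochain"
  have D: "cob c = 0 \<Longrightarrow> cup1 u c = D c" for c unfolding u(1) D_def by (rule cup1_cob_vertex)
  have Du: "D u = u" unfolding D_def u(1) by (rule vertex_cob_vertex)
  have Dm: "D (x * u) = D x * u + x * D u" by (simp add: D_def algebra_simps)
  have h1: "cup1 (x * u) (x * u) = x * (D x * u + x * u) + cup1 x (x * u) * u"
    unfolding hirsch by (simp add: D cxu Dm Du)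
  \<comment> \<open>The Hirsch formula accepts a product only on the left, so the arguments are
    exchanged at the cost of a coboundary.\<close>
  have c2: "cup1 x (x * u) = cob (cup2 x (x * u)) + cup1 (x * u) x"
    using cob_cup2[of x "x * u"] by (simp add: cx cxu)
  have h2: "cup1 (x * u) x = x * D x + cup1 x x * u"
    unfolding hirsch by (simp add: D cx)
  have "cup1 (x * u) (x * u) + (x * x * u + cup1 x x * u * u) = cob (cup2 x (x * u)) * u"
    unfolding h1 c2 h2 by (simp add: algebra_simps)
  also have "\<dots> = cob (cup2 x (x * u) * u)" by (simp add: cob_mult cu)
  finally show ?thesis unfolding cohomologous_def
    using x u by (intro exI[of _ "cup2 x (x * u) * u"]) (auto simp: cocycle_def invariant_cup2 invariant_mult)
qed

section \<open>Doubling\<close>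

text \<open>Integration over the unit interval. The \<open>M\<close> steps serve locality: each
  prism joins parameters at distance 1/M.\<close>

definition path_int :: "nat \<Rightarrow> ('w \<times> real) cochain \<Rightarrow> 'w cochain" where
  "path_int M \<gamma> = (\<Sum>j<M. prism (\<lambda>w. (w, real j / real M)) (\<lambda>w. (w, real (Suc j) / real M)) \<gamma>)"

lemma cob_sum: "cob (sum f A) = (\<Sum>x\<in>A. cob (f x))"
  by (induction A rule: infinite_finite_induct) (simp_all add: cob_add)

lemma path_int_add: "path_int M (a + b) = path_int M a + path_int M b"
  by (simp add: path_int_def prism_add sum.distrib)

lemma path_int_0 [simp]: "path_int M 0 = 0"
  by (simp add: path_int_def)

lemma cochain_telescope: "(\<Sum>j<M. f j + f (Suc j)) = f 0 + (f M :: 'a cochain)"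
  by (induction M) (simp_all add: ac_simps)

lemma cob_path_int:
  assumes "M > 0"
  shows "cob (path_int M \<gamma>) = path_int M (cob \<gamma>) + pull (\<lambda>w. (w, 0)) \<gamma> + pull (\<lambda>w. (w, 1)) \<gamma>"
proof -
  let ?p = "\<lambda>j. pull (\<lambda>w. (w, real j / real M)) \<gamma>"
  have "cob (path_int M \<gamma>) + path_int M (cob \<gamma>) = (\<Sum>j<M. ?p j + ?p (Suc j))"
    by (simp only: path_int_def cob_sum sum.distrib[symmetric] cob_prism)
  also have "\<dots> = ?p 0 + ?p M" by (rule cochain_telescope)
  also have "\<dots> = pull (\<lambda>w. (w, 0)) \<gamma> + pull (\<lambda>w. (w, 1)) \<gamma>" using assms by simp
  finally show ?thesis by (metis add.assoc add.commute cochain_add_self_left)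
qed

lemma invariant_sum: "(\<And>x. x \<in> A \<Longrightarrow> invariant T (f x)) \<Longrightarrow> invariant T (sum f A)"
  by (induction A rule: infinite_finite_induct) (simp_all add: invariant_add)

lemma invariant_path_int:
  assumes "invariant (\<lambda>i (w, t). (T i w, t)) \<gamma>"
  shows "invariant T (path_int M \<gamma>)"
  unfolding path_int_def by (intro invariant_sum invariant_prism[OF assms]) simp_all

text \<open>The maps \<open>f\<close> and \<open>g\<close> exchange their roles along the path; the \<open>cup1\<close> term is the homotopy between
  \<open>a b\<close> and \<open>b a\<close> that closes up the integral over the path.\<close>

definition double :: "nat \<Rightarrow> ('w \<times> real \<Rightarrow> 'w) \<Rightarrow> ('w \<times> real \<Rightarrow> 'w) \<Rightarrow> 'w cochain \<Rightarrow> 'w cochain" where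
  "double M f g \<beta> = path_int M (pull f \<beta> * pull g \<beta>)
     + cup1 (pull (\<lambda>w. f (w, 0)) \<beta>) (pull (\<lambda>w. g (w, 0)) \<beta>)"

lemma pull_at: "pull (\<lambda>w. (w, c)) (pull f \<beta>) = pull (\<lambda>w. f (w, c)) \<beta>"
  by (simp add: pull_pull comp_def)

context
  fixes M :: nat and f g :: "'w \<times> real \<Rightarrow> 'w" and T :: "'i \<Rightarrow> 'w \<Rightarrow> 'w"
  assumes M: "M > 0"
    and swap: "\<And>w. f (w, 1) = g (w, 0)" "\<And>w. g (w, 1) = f (w, 0)"
    and equi: "\<And>i w t. f (T i w, t) = T i (f (w, t))" "\<And>i w t. g (T i w, t) = T i (g (w, t))"
begin

lemma double_invariants:
  assumes "invariant T a"
  shows "invariant (\<lambda>i (w, t). (T i w, t)) (pull f a)" "invariant (\<lambda>i (w, t). (T i w, t)) (pull g a)"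
    "invariant T (pull (\<lambda>w. f (w, c)) a)" "invariant T (pull (\<lambda>w. g (w, c)) a)"
  by (rule invariant_pull[OF assms]; auto simp: equi)+

lemma cocycle_double:
  assumes "cocycle T \<beta>"
  shows "cocycle T (double M f g \<beta>)"
proof -
  have c: "cob \<beta> = 0" and i: "invariant T \<beta>" using assms by (simp_all add: cocycle_def)
  have "cob (double M f g \<beta>) = 0"
    by (simp add: double_def cob_add cob_path_int[OF M] cob_mult cob_cup1 pull_cob[symmetric] c
        pull_mult pull_at swap ac_simps)
  then show ?thesis
    unfolding cocycle_def double_def
    by (auto intro!: invariant_add invariant_path_int invariant_mult invariant_cup1 double_invariants i)
qed

text \<open>\<open>double\<close> is quadratic, so linearity does not suffice; a primitive of the
  difference has to be assembled from mixed terms.\<close>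

lemma cohomologous_double:
  assumes b: "cocycle T \<beta>'" and "cohomologous T \<beta> \<beta>'"
  shows "cohomologous T (double M f g \<beta>) (double M f g \<beta>')"
proof -
  obtain \<kappa> where \<kappa>: "invariant T \<kappa>" "\<beta> + \<beta>' = cob \<kappa>"
    using assms(2) unfolding cohomologous_def by blast
  then have \<beta>: "\<beta> = \<beta>' + cob \<kappa>" by (metis add.commute cochain_add_self_left)
  have cb: "cob \<beta>' = 0" and ib: "invariant T \<beta>'" using b by (simp_all add: cocycle_def)
  let ?A = "pull f \<beta>'"
  let ?B = "pull g \<beta>'"
  let ?a = "pull f \<kappa>"
  let ?b = "pull g \<kappa>"
  let ?Az = "pull (\<lambda>w. f (w, 0)) \<beta>'"
  let ?Bz = "pull (\<lambda>w. g (w, 0)) \<beta>'"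
  let ?az = "pull (\<lambda>w. f (w, 0)) \<kappa>"
  let ?bz = "pull (\<lambda>w. g (w, 0)) \<kappa>"
  \<comment> \<open>A primitive of the difference of the two products. It treats \<open>f\<close>
    and \<open>g\<close> unequally, so its values at the two ends do not cancel.\<close>
  define h where "h = ?A * ?b + ?a * ?B + ?a * cob ?b"
  have cz: "cob ?A = 0" "cob ?B = 0" "cob ?Az = 0" "cob ?Bz = 0"
    by (simp_all add: pull_cob[symmetric] cb)
  have g: "pull f \<beta> * pull g \<beta> = ?A * ?B + cob h"
    by (simp add: \<beta> h_def pull_add pull_cob algebra_simps cob_add cob_mult cz cob_cob)
  have ends: "pull (\<lambda>w. (w, 0)) h = ?Az * ?bz + ?az * ?Bz + ?az * cob ?bz"
    "pull (\<lambda>w. (w, 1)) h = ?Bz * ?az + ?bz * ?Az + ?bz * cob ?az"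
    by (simp_all add: h_def pull_add pull_mult pull_cob pull_at swap)
  \<comment> \<open>The \<open>cup1\<close> terms absorb the commutators left over at the ends;
    \<open>?bz * ?az\<close> trades \<open>cob ?bz * ?az\<close> for \<open>?bz * cob ?az\<close>,
    which repairs the asymmetry of \<open>h\<close>.\<close>
  define K where "K = path_int M h + cup1 ?Az ?bz + cup1 ?az ?Bz + cup1 ?az (cob ?bz) + ?bz * ?az"
  have cobI: "path_int M (cob h) = cob (path_int M h) + pull (\<lambda>w. (w, 0)) h + pull (\<lambda>w. (w, 1)) h"
    by (simp add: cob_path_int[OF M] ac_simps)
  have "double M f g \<beta> + double M f g \<beta>' = path_int M (cob h)
      + cup1 ?Az (cob ?bz) + cup1 (cob ?az) ?Bz + cup1 (cob ?az) (cob ?bz)"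
    unfolding double_def g
    by (simp add: \<beta> pull_add pull_cob path_int_add cup1_add_left cup1_add_right ac_simps)
  also have "\<dots> = cob K"
    unfolding K_def cobI ends
    by (simp add: cob_add cob_mult cob_cup1 cz cob_cob ac_simps)
  finally show ?thesis
    unfolding cohomologous_def K_def h_def
    by (intro exI conjI) (auto intro!: invariant_add invariant_path_int invariant_mult invariant_cup1
        invariant_cob double_invariants ib \<kappa>(1))
qed

end

text \<open>Vanishing on degenerate simplices, which makes the prism of a constant homotopy zero
  (\<open>prism_same\<close>).\<close>

definition normalized :: "'a cochain \<Rightarrow> bool" where
  "normalized a \<longleftrightarrow> (\<forall>xs v ys. cval a (xs @ v # v # ys) = 0)"

lemma normalized_mult:
  assumes "normalized a" "normalized b" shows "normalized (a * b)"
proof -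
  have "cup_fun f h (xs @ v # v # ys) = 0"
    if "\<And>xs v ys. f (xs @ v # v # ys) = 0" "\<And>xs v ys. h (xs @ v # v # ys) = 0"
    for f h :: "'a list \<Rightarrow> bit" and xs v ys
    using that(1)
  proof (induction xs arbitrary: f)
    case Nil
    have "f (v # v # l) = 0" for l using Nil[of "[]" v l] by simp
    moreover have "cup_fun (\<lambda>l. 0) h ys = 0" using cup_fun_add_left[of "\<lambda>l. 0" "\<lambda>l. 0" h ys] by simp
    ultimately show ?case using that(2)[of "[]" v ys] by simp
  next
    case (Cons x xs)
    have "cup_fun (\<lambda>l. f (x # l)) h (xs @ v # v # ys) = 0"
    proof (rule Cons.IH)
      fix us w zs
      show "f (x # us @ w # w # zs) = 0" using Cons.prems[of "x # us" w zs] by simp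
    qed
    then show ?case using that(2)[of "x # xs" v ys] by simp
  qed
  then show ?thesis using assms by (simp add: normalized_def times_cochain.rep_eq)
qed

lemma normalized_add: "normalized a \<Longrightarrow> normalized b \<Longrightarrow> normalized (a + b)"
  by (simp add: normalized_def cval_add)

lemma normalized_0: "normalized 0" by (simp add: normalized_def cval_0)

lemma normalized_1: "normalized 1" by (simp add: normalized_def one_cochain.rep_eq)

lemma normalized_cob_vertex: "normalized (cob (vertex s))"
proof -
  have "length (xs @ v # v # ys) = 2 \<Longrightarrow> xs = [] \<and> ys = []" for xs ys :: "'a list" and v by auto
  then show ?thesis
    by (auto simp: normalized_def cval_cob_vertex bit_add_self)
qed

lemma prism_pull: "prism f g (pull m a) = prism (\<lambda>x. m (f x)) (\<lambda>x. m (g x)) a"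
proof (rule cochain_eqI)
  fix l :: "'a list"
  have "prism_fun f g (\<lambda>l. \<phi> (map m l)) l = prism_fun (\<lambda>x. m (f x)) (\<lambda>x. m (g x)) \<phi> l" for \<phi> :: "'c list \<Rightarrow> bit"
    by (induction l arbitrary: \<phi>) (simp_all add: comp_def)
  then show "cval (prism f g (pull m a)) l = cval (prism (\<lambda>x. m (f x)) (\<lambda>x. m (g x)) a) l"
    by (simp add: prism.rep_eq pull.rep_eq)
qed

lemma prism_same: "normalized a \<Longrightarrow> prism f f a = 0"
proof (rule cochain_eqI)
  fix l :: "'b list" assume "normalized a"
  moreover have "prism_fun f f \<phi> l = 0" if "\<And>xs v ys. \<phi> (xs @ v # v # ys) = 0" for \<phi> :: "'a list \<Rightarrow> bit"
    using that
  proof (induction l arbitrary: \<phi>)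
    case (Cons x xs)
    have "prism_fun f f (\<lambda>l. \<phi> (f x # l)) xs = 0"
    proof (rule Cons.IH)
      fix us w zs
      show "\<phi> (f x # us @ w # w # zs) = 0" using Cons.prems[of "f x # us" w zs] by simp
    qed
    then show ?case using Cons.prems[of "[]" "f x"] by simp
  qed simp
  ultimately show "cval (prism f f a) l = cval 0 l"
    by (simp add: prism.rep_eq cval_0 normalized_def)
qed

text \<open>A normalized cochain that ignores the second component is constant along the path, so
  the integral vanishes and only the \<open>cup1\<close> term remains. This is why the half-turn
  acts on classes as a Steenrod square.\<close>

lemma double_const:
  fixes f g :: "('p \<times> 'q) \<times> real \<Rightarrow> 'p \<times> 'q"
  assumes "normalized \<sigma>" "\<And>w. fst (f w) = fst (fst w)" "\<And>w. fst (g w) = fst (fst w)"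
  shows "double M f g (pull fst \<sigma>) = pull fst (cup1 \<sigma> \<sigma>)"
proof -
  have e: "pull f (pull fst \<sigma>) = pull fst (pull fst \<sigma>)" "pull g (pull fst \<sigma>) = pull fst (pull fst \<sigma>)"
    "pull (\<lambda>w. f (w, 0)) (pull fst \<sigma>) = pull fst \<sigma>" "pull (\<lambda>w. g (w, 0)) (pull fst \<sigma>) = pull fst \<sigma>"
    by (auto simp: pull_pull assms intro!: pull_map_eq)
  have *: "prism (\<lambda>w. (w, c)) (\<lambda>w. (w, d)) (pull fst (pull fst \<sigma>) * pull fst (pull fst \<sigma>)) = 0" for c d :: real
    unfolding pull_mult[symmetric] prism_pull by (simp add: prism_same normalized_mult assms)
  show ?thesis
    unfolding double_def e path_int_def by (simp add: pull_cup1 *)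
qed

text \<open>The head is the rightmost factor because \<open>Sq_mult_vertex\<close> and
  \<open>fund_word\<close> split off the last factor. The order of letters is kept, since cup
  products commute only up to coboundaries; the evaluation will forget it.\<close>

primrec word :: "('i \<Rightarrow> 'a cochain) \<Rightarrow> 'i list \<Rightarrow> 'a cochain" where
  "word u [] = 1"
| "word u (i # w) = word u w * u i"

definition words :: "('i \<Rightarrow> 'a cochain) \<Rightarrow> 'i list list \<Rightarrow> 'a cochain" where
  "words u ws = sum_list (map (word u) ws)"

text \<open>The Cartan formula iterated: in each term one letter stays simple and all others are
  doubled.\<close>

primrec sq_word :: "'i list \<Rightarrow> 'i list list" where
  "sq_word [] = []"
| "sq_word (i # w) = (i # w @ w) # map (\<lambda>v. i # i # v) (sq_word w)"

lemma word_append: "word u (v @ w) = word u w * word u v"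
  by (induction v) (simp_all add: mult.assoc)

lemma words_append: "words u (vs @ ws) = words u vs + words u ws"
  by (simp add: words_def)

lemma words_Cons: "words u (w # ws) = word u w + words u ws"
  by (simp add: words_def)

lemma words_Nil: "words u [] = 0"
  by (simp add: words_def)

lemma words_map_Cons2: "words u (map (\<lambda>v. i # i # v) ws) = words u ws * u i * u i"
  by (induction ws) (simp_all add: words_def algebra_simps)

lemma cup1_1: "cup1 1 1 = 0"
  by (metis cup1_vertex_left vertex_1)

context
  fixes u :: "'i \<Rightarrow> 'a cochain" and T :: "'j \<Rightarrow> 'a \<Rightarrow> 'a" and s :: "'i \<Rightarrow> 'a \<Rightarrow> bit"
  assumes u: "\<And>i. u i = cob (vertex (s i))" and inv: "\<And>i. invariant T (u i)"
begin

lemma cocycle_letter: "cocycle T (u i)"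
  using inv by (simp add: cocycle_def u cob_cob)

lemma cocycle_word: "cocycle T (word u w)"
  by (induction w) (simp_all add: cocycle_mult cocycle_letter)

lemma cocycle_words: "cocycle T (words u ws)"
  by (induction ws) (simp_all add: words_Nil words_Cons cocycle_add cocycle_word)

lemma normalized_words: "normalized (words u ws)"
proof -
  have "normalized (word u w)" for w
    by (induction w) (simp_all add: normalized_1 normalized_mult normalized_cob_vertex u)
  then show ?thesis by (induction ws) (simp_all add: words_Nil words_Cons normalized_0 normalized_add)
qed

lemma Sq_word: "cohomologous T (cup1 (word u w) (word u w)) (words u (sq_word w))"
proof (induction w)
  case Nil
  show ?case by (simp add: cup1_1 words_Nil)
next
  case (Cons i w)
  have "cohomologous T (cup1 (word u w * u i) (word u w * u i))
      (word u w * word u w * u i + cup1 (word u w) (word u w) * u i * u i)"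
    by (rule Sq_mult_vertex[OF cocycle_word u inv])
  also have "cohomologous T \<dots> (word u w * word u w * u i + words u (sq_word w) * u i * u i)"
    by (intro cohomologous_add cohomologous_mult Cons.IH cohomologous_refl cocycle_mult cocycle_Sq
        cocycle_word cocycle_letter)
  finally (cohomologous_trans) show ?case
    by (simp add: words_Cons words_map_Cons2 word_append)
qed

lemma Sq_words: "cohomologous T (cup1 (words u ws) (words u ws)) (words u (concat (map sq_word ws)))"
proof (induction ws)
  case (Cons w ws)
  have "cohomologous T (cup1 (words u (w # ws)) (words u (w # ws)))
      (cup1 (word u w) (word u w) + cup1 (words u ws) (words u ws))"
    unfolding words_Cons by (rule Sq_add[OF cocycle_word cocycle_words])
  also have "cohomologous T \<dots> (words u (sq_word w) + words u (concat (map sq_word ws)))"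
    by (intro cohomologous_add Sq_word Cons.IH)
  finally (cohomologous_trans) show ?case
    by (simp add: words_append)
qed (simp add: words_Nil)

end

section \<open>Evaluation on the product of spheres\<close>

type_synonym point = "(nat \<Rightarrow> nat \<Rightarrow> real) \<times> (nat \<Rightarrow> bit)"

text \<open>A point carries, besides the coefficient rows, a formal sign for every row; this makes the
  action of the sign changes free, and the sign serves as a tie-break where a row evaluates to 0.\<close>

definition flip :: "nat \<Rightarrow> point \<Rightarrow> point" where
  "flip i p = ((fst p)(i := (\<lambda>j. - fst p i j)), (snd p)(i := snd p i + 1))"

definition pole :: "nat \<Rightarrow> (nat \<Rightarrow> nat) \<Rightarrow> point" where
  "pole r k = ((\<lambda>i j. if i < r \<and> j = k i then 1 else 0), (\<lambda>i. 0))"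

text \<open>A straight motion towards the pole. Signs cannot be deformed, so the last stage replaces
  the whole point by the pole; the coefficients of the rows move little even there.\<close>

definition contract :: "nat \<Rightarrow> nat \<Rightarrow> (nat \<Rightarrow> nat) \<Rightarrow> nat \<Rightarrow> point \<Rightarrow> point" where
  "contract r M k n p = (if n < M then
     ((\<lambda>i j. if i < r then (1 - real n / real M) * fst p i j + real n / real M * of_bool (j = k i) else fst p i j), snd p)
     else pole r k)"

definition pole_cone :: "nat \<Rightarrow> nat \<Rightarrow> (nat \<Rightarrow> nat) \<Rightarrow> point cochain \<Rightarrow> point cochain" where
  "pole_cone r M k \<phi> = (\<Sum>n<M. prism (contract r M k n) (contract r M k (Suc n)) \<phi>)"

text \<open>Evaluation on a chain modelling the product of the upper half-spheres of dimensions \<open>k i\<close>: the boundary of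
  each half-sphere is the union of a half-sphere of one dimension less and its image under \<open>flip i\<close>.\<close>

primrec fund :: "nat \<Rightarrow> nat \<Rightarrow> nat \<Rightarrow> (nat \<Rightarrow> nat) \<Rightarrow> point cochain \<Rightarrow> bit" where
  "fund r M 0 k \<phi> = cval \<phi> [pole r k]"
| "fund r M (Suc m) k \<phi> = (\<Sum>i | i < r \<and> 0 < k i.
     fund r M m (k(i := k i - 1)) (pole_cone r M k \<phi> + pull (flip i) (pole_cone r M k \<phi>)))"

lemma flip_flip: "flip i (flip i p) = p"
  by (simp add: flip_def add.assoc bit_add_self fun_eq_iff)

lemma flip_commute: "flip i (flip j p) = flip j (flip i p)"
  by (auto simp: flip_def)

lemma pull_flip_flip: "pull (flip i) (pull (flip i) \<phi>) = \<phi>"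
  by (simp add: pull_pull comp_def flip_flip pull_id)

lemma pull_flip_commute: "pull (flip i) (pull (flip j) \<phi>) = pull (flip j) (pull (flip i) \<phi>)"
  by (simp add: pull_pull comp_def flip_commute)

lemma cone_add: "pole_cone r M k (a + b) = pole_cone r M k a + pole_cone r M k b"
  by (simp add: pole_cone_def prism_add sum.distrib)

lemma cob_cone:
  assumes "M > 0"
  shows "pole_cone r M k (cob \<phi>) = cob (pole_cone r M k \<phi>) + \<phi> + pull (\<lambda>p. pole r k) \<phi>"
proof -
  let ?p = "\<lambda>n. pull (contract r M k n) \<phi>"
  have "cob (pole_cone r M k \<phi>) + pole_cone r M k (cob \<phi>) = (\<Sum>n<M. ?p n + ?p (Suc n))"
    by (simp only: pole_cone_def cob_sum sum.distrib[symmetric] cob_prism)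
  also have "\<dots> = ?p 0 + ?p M" by (rule cochain_telescope)
  also have "?p 0 = \<phi>"
    by (subst pull_map_eq[of _ "\<lambda>x. x"]) (use assms in \<open>auto simp: contract_def pull_id prod_eq_iff fun_eq_iff\<close>)
  also have "?p M = pull (\<lambda>p. pole r k) \<phi>"
    by (rule pull_map_eq) (simp add: contract_def)
  finally have "cob (pole_cone r M k \<phi>) + pole_cone r M k (cob \<phi>) = \<phi> + pull (\<lambda>p. pole r k) \<phi>" .
  then have "pole_cone r M k (cob \<phi>) = cob (pole_cone r M k \<phi>) + (\<phi> + pull (\<lambda>p. pole r k) \<phi>)"
    using cochain_add_self_left by metis
  then show ?thesis by (simp only: add.assoc)
qed

lemma fund_add: "fund r M m k (a + b) = fund r M m k a + fund r M m k b"
proof (induction m arbitrary: k a b)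
  case (Suc m)
  have "pole_cone r M k (a + b) + pull (flip i) (pole_cone r M k (a + b)) =
      (pole_cone r M k a + pull (flip i) (pole_cone r M k a)) + (pole_cone r M k b + pull (flip i) (pole_cone r M k b))" for i
    by (simp add: cone_add pull_add ac_simps)
  then show ?case by (simp only: fund.simps Suc.IH sum.distrib)
qed (simp add: cval_add)

lemma fund_0 [simp]: "fund r M m k 0 = 0"
  by (metis fund_add cochain_add_self bit_add_self)

lemma symmetric_sum_bit:
  assumes "finite A" "\<And>i. G i i = (0::bit)" "\<And>i j. i \<in> A \<Longrightarrow> j \<in> A \<Longrightarrow> G i j = G j i"
  shows "(\<Sum>i\<in>A. \<Sum>j\<in>A. G i j) = 0"
  using assms(1,3)
proof (induction A rule: finite_induct)
  case (insert a A)
  have "(\<Sum>i\<in>A. G i a) = (\<Sum>i\<in>A. G a i)" by (rule sum.cong) (use insert.prems in auto)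
  moreover have "(\<Sum>i\<in>A. \<Sum>j\<in>A. G i j) = 0" using insert by auto
  ultimately show ?case using insert(1,2) assms(2)
    by (simp add: sum.distrib bit_add_self)
qed simp

text \<open>Stokes' theorem for the product of half-spheres: the boundary of each factor consists of
  a smaller half-sphere and its flipped copy.\<close>

lemma fund_cob:
  assumes M: "M > 0"
  shows "fund r M (Suc m) k (cob \<phi>) =
    (\<Sum>i | i < r \<and> 0 < k i. fund r M m (k(i := k i - 1)) (\<phi> + pull (flip i) \<phi>))"
proof (induction m arbitrary: k \<phi>)
  case 0
  let ?c = "pole_cone r M k \<phi>"
  have e: "pole_cone r M k (cob \<phi>) + pull (flip i) (pole_cone r M k (cob \<phi>)) =
     (\<phi> + pull (flip i) \<phi>) + cob (?c + pull (flip i) ?c)" for i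
    unfolding cob_cone[OF M] by (simp add: pull_add pull_cob cob_add pull_pull comp_def ac_simps)
  have z: "fund r M 0 k' (cob a) = 0" for k' a by (simp add: cob.rep_eq)
  show ?case
    unfolding fund.simps(2)[of r M 0] e fund_add[of r M 0] by (simp only: z add_0_right)
next
  case (Suc m)
  let ?c = "pole_cone r M k \<phi>" and ?S = "{i. i < r \<and> 0 < k i}"
  have e: "pole_cone r M k (cob \<phi>) + pull (flip i) (pole_cone r M k (cob \<phi>)) =
     (\<phi> + pull (flip i) \<phi>) + cob (?c + pull (flip i) ?c)" for i
    unfolding cob_cone[OF M] by (simp add: pull_add pull_cob cob_add pull_pull comp_def ac_simps)
  \<comment> \<open>The contributions of the second boundary. They are symmetric because flips
    commute and vanish on the diagonal because flips are involutions, so they cancel in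
    pairs.\<close>
  define G where "G i l = fund r M m (k(i := k i - 1, l := (k(i := k i - 1)) l - 1))
      ((?c + pull (flip i) ?c) + pull (flip l) (?c + pull (flip i) ?c))" for i l
  have G0: "G i i = 0" for i
    by (simp add: G_def pull_add pull_flip_flip add.commute[of "pull (flip i) ?c"] del: fun_upd_apply)
  have Gs: "G i l = G l i" for i l
  proof (cases "i = l")
    case False
    then have "k(i := k i - 1, l := (k(i := k i - 1)) l - 1) = k(l := k l - 1, i := (k(l := k l - 1)) i - 1)"
      by auto
    moreover have "(?c + pull (flip i) ?c) + pull (flip l) (?c + pull (flip i) ?c) =
       (?c + pull (flip l) ?c) + pull (flip i) (?c + pull (flip l) ?c)"
      by (simp add: pull_add pull_flip_commute[of i l] ac_simps)
    ultimately show ?thesis unfolding G_def by metis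
  qed simp
  have "(\<Sum>i\<in>?S. fund r M (Suc m) (k(i := k i - 1)) (cob (?c + pull (flip i) ?c))) = (\<Sum>i\<in>?S. \<Sum>l\<in>?S. G i l)"
  proof (rule sum.cong[OF refl])
    fix i assume i: "i \<in> ?S"
    have "fund r M (Suc m) (k(i := k i - 1)) (cob (?c + pull (flip i) ?c)) =
       (\<Sum>l | l < r \<and> 0 < (k(i := k i - 1)) l. G i l)"
      unfolding Suc.IH G_def ..
    also have "\<dots> = (\<Sum>l\<in>?S. G i l)"
      by (rule sum.mono_neutral_left) (auto split: if_splits simp: G0)
    finally show "fund r M (Suc m) (k(i := k i - 1)) (cob (?c + pull (flip i) ?c)) = (\<Sum>l\<in>?S. G i l)" .
  qed
  also have "\<dots> = 0" by (rule symmetric_sum_bit) (auto simp: G0 Gs)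
  finally have "(\<Sum>i\<in>?S. fund r M (Suc m) (k(i := k i - 1)) (cob (?c + pull (flip i) ?c))) = 0" .
  then show ?case
    unfolding fund.simps(2)[of r M "Suc m"] e fund_add sum.distrib by simp
qed

lemma fund_cob_invariant:
  assumes "M > 0" "invariant flip \<kappa>"
  shows "fund r M m k (cob \<kappa>) = 0"
proof (cases m)
  case 0
  then show ?thesis by (simp add: cob.rep_eq)
next
  case (Suc m)
  then show ?thesis using assms(2) by (simp only: fund_cob[OF assms(1)]) (simp add: invariant_def)
qed

lemma fund_cohomologous:
  assumes "M > 0" "cohomologous flip a b"
  shows "fund r M m k a = fund r M m k b"
proof -
  from assms(2) obtain \<kappa> where "invariant flip \<kappa>" "a + b = cob \<kappa>" unfolding cohomologous_def by blast
  then have "fund r M m k a + fund r M m k b = 0"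
    using fund_cob_invariant[OF assms(1)] by (metis fund_add)
  then show ?thesis by (metis add.right_neutral bit_add_self_left)
qed

lemma vertex_0: "vertex (\<lambda>x. 0) = 0"
  by (transfer, rule ext) simp

definition sign_letter :: "nat \<Rightarrow> point cochain" where
  "sign_letter i = cob (vertex (\<lambda>p. snd p i))"

lemma pull_flip_sign: "pull (flip l) (vertex (\<lambda>p. snd p i)) = vertex (\<lambda>p. snd p i) + (if l = i then 1 else 0)"
proof -
  have "(\<lambda>p. snd (flip l p) i) = (\<lambda>p. snd p i + (if l = i then 1 else 0))"
    by (auto simp: flip_def)
  then show ?thesis by (simp add: pull_vertex vertex_add vertex_1 vertex_0)
qed

lemma invariant_sign_letter: "invariant flip (sign_letter i)"
  unfolding invariant_def sign_letter_def pull_cob pull_flip_sign by (simp add: cob_add)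

lemma cocycle_word_sign: "cocycle flip (word sign_letter w)"
  by (rule cocycle_word[OF _ invariant_sign_letter]) (rule sign_letter_def)

lemma cob_word_sign: "cob (word sign_letter w) = 0"
  using cocycle_word_sign by (simp add: cocycle_def)

lemma cone_1: "pole_cone r M k 1 = 0"
proof -
  have "prism f g (1 :: point cochain) = 0" for f g :: "point \<Rightarrow> point"
  proof (rule cochain_eqI, rule ccontr)
    fix l :: "point list" assume l: "l \<noteq> []" "cval (prism f g 1) l \<noteq> cval 0 l"
    then have "cval (prism f g 1) l \<noteq> 0" by (simp add: cval_0)
    from cval_prism_nonzero[OF this] obtain l' :: "point list" where
      "length l' = Suc (length l)" "cval 1 l' \<noteq> 0" by auto
    then show False using l(1) by (auto simp: one_cochain.rep_eq)
  qed
  then show ?thesis by (simp add: pole_cone_def)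
qed

text \<open>A word with head \<open>i\<close> is the coboundary of the shorter word times the sign
  of row \<open>i\<close>. In Stokes' theorem only the flip that alters this sign survives, so the
  head is removed and the \<open>i\<close>-th dimension drops by one.\<close>

lemma fund_word:
  assumes M: "M > 0" and "(\<Sum>i<r. k i) = m" "set w \<subseteq> {..<r}"
  shows "fund r M m k (word sign_letter w) = of_bool (\<forall>i<r. count_list w i = k i)"
  using assms(2,3)
proof (induction w arbitrary: m k)
  case Nil
  show ?case
  proof (cases m)
    case 0
    then show ?thesis using Nil by (simp add: one_cochain.rep_eq)
  next
    case (Suc n)
    have "\<not> (\<forall>i<r. k i = 0)"
    proof
      assume "\<forall>i<r. k i = 0"
      then have "(\<Sum>i<r. k i) = 0" by simp
      then show False using Nil Suc by simp
    qed
    then show ?thesis by (auto simp: Suc cone_1)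
  qed
next
  case (Cons i w)
  have i: "i < r" using Cons.prems by simp
  show ?case
  proof (cases m)
    case 0
    have "cval (a * sign_letter i) [p] = 0" for a p
      by (simp add: times_cochain.rep_eq sign_letter_def cval_cob_vertex)
    moreover have "k i = 0" using Cons.prems 0 i by simp
    ultimately show ?thesis using i by (auto simp: 0 intro!: exI[of _ i])
  next
    case (Suc n)
    let ?\<phi> = "word sign_letter w * vertex (\<lambda>p. snd p i)"
    have w: "word sign_letter (i # w) = cob ?\<phi>"
      by (simp add: cob_mult cob_word_sign sign_letter_def)
    have inv: "pull (flip l) (word sign_letter w) = word sign_letter w" for l
      using cocycle_word_sign by (simp add: cocycle_def invariant_def)
    have "?\<phi> + pull (flip l) ?\<phi> = (if l = i then word sign_letter w else 0)" for l
      by (simp add: pull_mult inv pull_flip_sign algebra_simps)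
    then have "fund r M m k (word sign_letter (i # w)) =
       (\<Sum>l | l < r \<and> 0 < k l. if l = i then fund r M n (k(l := k l - 1)) (word sign_letter w) else 0)"
      unfolding w Suc fund_cob[OF M] by (intro sum.cong) auto
    also have "\<dots> = (if 0 < k i then fund r M n (k(i := k i - 1)) (word sign_letter w) else 0)"
      using i by (simp add: sum.delta)
    also have "\<dots> = of_bool (\<forall>l<r. count_list (i # w) l = k l)"
    proof (cases "0 < k i")
      case True
      have "(\<Sum>l<r. k l) = k i + (\<Sum>l\<in>{..<r} - {i}. k l)" using i by (simp add: sum.remove)
      moreover have "(\<Sum>l<r. (k(i := k i - 1)) l) = (k i - 1) + (\<Sum>l\<in>{..<r} - {i}. k l)"
        using i by (subst sum.remove[of _ i]) auto
      ultimately have "(\<Sum>l<r. (k(i := k i - 1)) l) = n" using Cons.prems(1) Suc True by simp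
      moreover have "set w \<subseteq> {..<r}" using Cons.prems(2) by simp
      ultimately have "fund r M n (k(i := k i - 1)) (word sign_letter w) = of_bool (\<forall>l<r. count_list w l = (k(i := k i - 1)) l)"
        by (rule Cons.IH)
      also have "(\<forall>l<r. count_list w l = (k(i := k i - 1)) l) = (\<forall>l<r. count_list (i # w) l = k l)"
        using True by (auto split: if_splits)
      finally show ?thesis by (simp only: True if_True)
    qed (use i in \<open>auto intro!: exI[of _ i]\<close>)
    finally show ?thesis .
  qed
qed

section \<open>Small simplices from a nonzero evaluation\<close>

definition hemi :: "nat \<Rightarrow> (nat \<Rightarrow> nat) \<Rightarrow> (nat \<Rightarrow> nat \<Rightarrow> real) \<Rightarrow> bool" where
  "hemi r k y \<longleftrightarrow> (\<forall>i<r. (\<Sum>j\<le>k i. \<bar>y i j\<bar>) = 1 \<and> (\<forall>j>k i. y i j = 0) \<and> y i (k i) \<ge> 0)"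

definition close :: "nat \<Rightarrow> real \<Rightarrow> point list \<Rightarrow> bool" where
  "close r \<epsilon> l \<longleftrightarrow> (\<forall>p\<in>set l. \<forall>q\<in>set l. \<forall>i<r. \<forall>j. \<bar>fst p i j - fst q i j\<bar> \<le> \<epsilon>)"

lemma hemi_bound: "hemi r k y \<Longrightarrow> i < r \<Longrightarrow> \<bar>y i j\<bar> \<le> 1"
proof (cases "j \<le> k i")
  case True
  assume a: "hemi r k y" "i < r"
  have "\<bar>y i j\<bar> \<le> (\<Sum>j\<le>k i. \<bar>y i j\<bar>)" using True by (intro member_le_sum) auto
  then show ?thesis using a by (auto simp: hemi_def)
qed (auto simp: hemi_def)

lemma contract_eq:
  assumes "n \<le> M" "M > 0" "i < r"
  shows "fst (contract r M k n p) i j =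
    (1 - real n / real M) * fst p i j + real n / real M * of_bool (j = k i)"
  using assms by (cases "n = M") (auto simp: contract_def pole_def)

text \<open>This is the reason for the l1-norm: the coordinate at the pole is nonnegative on the
  upper half, so absolute values add up along the segment to the pole and the norm stays 1 without
  any rescaling.\<close>

lemma hemi_contract:
  assumes "n \<le> M" "M > 0" "hemi r k (fst p)"
  shows "hemi r k (fst (contract r M k n p))"
  unfolding hemi_def
proof (intro allI impI conjI)
  fix i assume i: "i < r"
  let ?t = "real n / real M"
  have t: "0 \<le> ?t" "?t \<le> 1" using assms by (auto simp: field_simps)
  have h: "(\<Sum>j\<le>k i. \<bar>fst p i j\<bar>) = 1" "\<And>j. j > k i \<Longrightarrow> fst p i j = 0" "fst p i (k i) \<ge> 0"
    using assms(3) i by (auto simp: hemi_def)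
  note e = contract_eq[OF assms(1,2) i, of k p]
  show "fst (contract r M k n p) i (k i) \<ge> 0" using t h(3) by (simp add: e)
  { fix j assume "k i < j" then show "fst (contract r M k n p) i j = 0" by (simp add: e h(2)) }
  have "(\<Sum>j\<le>k i. \<bar>fst (contract r M k n p) i j\<bar>) =
      (\<Sum>j\<le>k i. (1 - ?t) * \<bar>fst p i j\<bar> + ?t * of_bool (j = k i))"
  proof (rule sum.cong[OF refl])
    fix j
    have "\<bar>(1 - ?t) * fst p i j\<bar> = (1 - ?t) * \<bar>fst p i j\<bar>" using t by (simp add: abs_mult)
    then show "\<bar>fst (contract r M k n p) i j\<bar> = (1 - ?t) * \<bar>fst p i j\<bar> + ?t * of_bool (j = k i)"
      unfolding e using t h(3) by (cases "j = k i") (auto intro!: abs_of_nonneg)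
  qed
  also have "\<dots> = (1 - ?t) * 1 + ?t"
    unfolding sum.distrib sum_distrib_left[symmetric] h(1) by simp
  finally show "(\<Sum>j\<le>k i. \<bar>fst (contract r M k n p) i j\<bar>) = 1" by simp
qed

lemma contract_close:
  assumes "n \<le> M" "n' \<le> M" "M > 0" "i < r" "hemi r k (fst q)"
    "\<bar>fst p i j - fst q i j\<bar> \<le> \<epsilon>" "\<bar>real n - real n'\<bar> \<le> 1"
  shows "\<bar>fst (contract r M k n p) i j - fst (contract r M k n' q) i j\<bar> \<le> \<epsilon> + 2 / real M"
proof -
  let ?t = "real n / real M" and ?t' = "real n' / real M" and ?b = "of_bool (j = k i) :: real"
  have t: "0 \<le> ?t" "?t \<le> 1" using assms by (auto simp: field_simps)
  have "fst (contract r M k n p) i j - fst (contract r M k n' q) i j =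
     (1 - ?t) * (fst p i j - fst q i j) + (?t - ?t') * (?b - fst q i j)"
    using assms by (simp add: contract_eq algebra_simps)
  also have "\<bar>\<dots>\<bar> \<le> \<bar>(1 - ?t) * (fst p i j - fst q i j)\<bar> + \<bar>(?t - ?t') * (?b - fst q i j)\<bar>"
    by (rule abs_triangle_ineq)
  also have "\<dots> = \<bar>1 - ?t\<bar> * \<bar>fst p i j - fst q i j\<bar> + \<bar>?t - ?t'\<bar> * \<bar>?b - fst q i j\<bar>"
    by (simp add: abs_mult)
  also have "\<dots> \<le> 1 * \<epsilon> + 1 / real M * 2"
  proof (intro add_mono mult_mono)
    have "?t - ?t' = (real n - real n') / real M" by (simp add: diff_divide_distrib)
    then show "\<bar>?t - ?t'\<bar> \<le> 1 / real M" using assms by (simp add: abs_divide divide_right_mono)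
    show "\<bar>?b - fst q i j\<bar> \<le> 2" using hemi_bound[OF assms(5,4), of j] by (cases "j = k i") auto
  qed (use t assms in auto)
  finally show ?thesis by simp
qed

lemma sum_nonzero_bit: "sum f A \<noteq> (0::bit) \<Longrightarrow> \<exists>x\<in>A. f x \<noteq> 0"
  by (meson sum.neutral)

lemma cval_sum: "cval (sum f A) l = (\<Sum>x\<in>A. cval (f x) l)"
  by (induction A rule: infinite_finite_induct) (simp_all add: cval_add cval_0)

text \<open>Each of the \<open>m\<close> cones enlarges a simplex by at most 2/M: only consecutive
  stages of the contraction are mixed, and no coordinate is further than 2 from that of the pole.
  Flips do not change distances.\<close>

lemma fund_nonzero:
  assumes M: "M > 0" and "(\<Sum>i<r. k i) = m" "fund r M m k \<phi> \<noteq> 0"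
  shows "\<exists>l. cval \<phi> l \<noteq> 0 \<and> (\<forall>p\<in>set l. hemi r k (fst p)) \<and> close r (2 * real m / real M) l"
  using assms(2,3)
proof (induction m arbitrary: k \<phi>)
  case 0
  have "hemi r k (fst (pole r k))" using 0 by (simp add: hemi_def pole_def)
  then show ?case using 0 by (intro exI[of _ "[pole r k]"]) (auto simp: close_def)
next
  case (Suc m)
  from sum_nonzero_bit[OF Suc.prems(2)[unfolded fund.simps]] obtain i where i: "i < r" "0 < k i" and
    "fund r M m (k(i := k i - 1)) (pole_cone r M k \<phi> + pull (flip i) (pole_cone r M k \<phi>)) \<noteq> 0"
    by auto
  then have "\<exists>\<psi>. (\<psi> = pole_cone r M k \<phi> \<or> \<psi> = pull (flip i) (pole_cone r M k \<phi>)) \<and> fund r M m (k(i := k i - 1)) \<psi> \<noteq> 0"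
    unfolding fund_add by (metis add.right_neutral)
  then obtain \<psi> where \<psi>: "\<psi> = pole_cone r M k \<phi> \<or> \<psi> = pull (flip i) (pole_cone r M k \<phi>)"
      "fund r M m (k(i := k i - 1)) \<psi> \<noteq> 0" by blast
  have "(\<Sum>l<r. k l) = k i + (\<Sum>l\<in>{..<r} - {i}. k l)" using i by (simp add: sum.remove)
  moreover have "(\<Sum>l<r. (k(i := k i - 1)) l) = (k i - 1) + (\<Sum>l\<in>{..<r} - {i}. k l)"
    using i by (subst sum.remove[of _ i]) auto
  ultimately have "(\<Sum>l<r. (k(i := k i - 1)) l) = m" using Suc.prems(1) i by simp
  from Suc.IH[OF this \<psi>(2)] obtain l where l: "cval \<psi> l \<noteq> 0" "\<And>p. p \<in> set l \<Longrightarrow> hemi r (k(i := k i - 1)) (fst p)"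
    "close r (2 * real m / real M) l" by blast
  have sum_k: "(\<Sum>j\<le>k i. f j) = (\<Sum>j\<le>k i - 1. f j) + f (k i)" for f :: "nat \<Rightarrow> real"
    using i(2) by (cases "k i") auto
  have hemi: "hemi r k (fst p)" "hemi r k (fst (flip i p))" if "hemi r (k(i := k i - 1)) (fst p)" for p
    using that i by (auto simp: hemi_def flip_def sum_k split: if_splits)
  obtain l' where l': "cval (pole_cone r M k \<phi>) l' \<noteq> 0" "\<And>p. p \<in> set l' \<Longrightarrow> hemi r k (fst p)"
    "close r (2 * real m / real M) l'"
    using \<psi>(1)
  proof
    assume "\<psi> = pole_cone r M k \<phi>"
    then show ?thesis using that[of l] l hemi by auto
  next
    assume "\<psi> = pull (flip i) (pole_cone r M k \<phi>)"
    moreover have "close r (2 * real m / real M) (map (flip i) l)"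
      using l(3) unfolding close_def by (auto simp: flip_def abs_minus_commute)
    moreover have "\<And>p. p \<in> set (map (flip i) l) \<Longrightarrow> hemi r k (fst p)"
      using l(2) hemi(2) unfolding set_map by blast
    ultimately show ?thesis using that[of "map (flip i) l"] l(1) by (simp add: cval_pull)
  qed
  from sum_nonzero_bit[OF l'(1)[unfolded pole_cone_def cval_sum]] obtain n where n: "n < M" "cval (prism (contract r M k n) (contract r M k (Suc n)) \<phi>) l' \<noteq> 0"
    by auto
  from cval_prism_nonzero[OF n(2)] obtain l'' where l'':
    "set l'' \<subseteq> contract r M k n ` set l' \<union> contract r M k (Suc n) ` set l'" "cval \<phi> l'' \<noteq> 0" by blast
  have rep: "\<exists>q a. q \<in> set l' \<and> p = contract r M k a q \<and> (a = n \<or> a = Suc n)" if "p \<in> set l''" for p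
    using l''(1) that by blast
  show ?case
  proof (intro exI conjI ballI)
    show "cval \<phi> l'' \<noteq> 0" by fact
    fix p assume "p \<in> set l''"
    from rep[OF this] show "hemi r k (fst p)" using l'(2) n(1) M by (auto intro!: hemi_contract)
  next
    show "close r (2 * real (Suc m) / real M) l''"
      unfolding close_def
    proof (intro ballI allI impI)
      fix p q i j assume "p \<in> set l''" "q \<in> set l''" "i < r"
      then obtain p' a q' b where pq: "p' \<in> set l'" "p = contract r M k a p'" "a = n \<or> a = Suc n"
        "q' \<in> set l'" "q = contract r M k b q'" "b = n \<or> b = Suc n"
        using rep by metis
      have "\<bar>fst p i j - fst q i j\<bar> \<le> 2 * real m / real M + 2 / real M"
        unfolding pq(2,5) using pq(1,3,4,6) l'(2,3) n(1) M \<open>i < r\<close>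
        by (intro contract_close) (auto simp: close_def)
      also have "\<dots> = 2 * real (Suc m) / real M" by (simp add: add_divide_distrib[symmetric])
      finally show "\<bar>fst p i j - fst q i j\<bar> \<le> 2 * real (Suc m) / real M" .
    qed
  qed
qed

section \<open>Clusters of chords\<close>

definition ev :: "(nat \<Rightarrow> real \<Rightarrow> real) \<Rightarrow> (nat \<Rightarrow> nat) \<Rightarrow> point \<Rightarrow> nat \<Rightarrow> real \<Rightarrow> real" where
  "ev bas k p i t = (\<Sum>j\<le>k i. fst p i j * bas j t)"

definition chord_val :: "(nat \<Rightarrow> real \<Rightarrow> real) \<Rightarrow> (nat \<Rightarrow> nat) \<Rightarrow> point \<Rightarrow> nat \<Rightarrow> real \<times> real \<Rightarrow> real" where
  "chord_val bas k p i z = ev bas k p i (fst z) - ev bas k p i (snd z)"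

definition sign_bit :: "real \<Rightarrow> bit \<Rightarrow> bit" where
  "sign_bit v \<tau> = (if v < 0 then 1 else if v > 0 then 0 else \<tau>)"

lemma sign_bit_uminus: "sign_bit (- v) (\<tau> + 1) = sign_bit v \<tau> + 1"
  by (auto simp: sign_bit_def)

text \<open>This replaces the intermediate value theorem: where the bit changes within a simplex,
  the value is bounded by its variation. A tie does no harm, as the value is 0 there.\<close>

lemma sign_bit_neq: "sign_bit v \<tau> + sign_bit v' \<tau>' \<noteq> 0 \<Longrightarrow> \<bar>v\<bar> \<le> \<bar>v - v'\<bar>"
  by (auto simp: sign_bit_def split: if_splits)

text \<open>A shape consists of the centre and the scale of a cluster of chords.\<close>

type_synonym shape = "real \<times> real \<times> real"

text \<open>A square instead of a round circle: some coordinate always has absolute value 1, and the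
  half-turn is piecewise linear.\<close>

definition sup_circle :: "(real \<times> real) set" where
  "sup_circle = {d. max \<bar>fst d\<bar> \<bar>snd d\<bar> = 1}"

text \<open>The halves at levels 0, 1, 2 have extents 0, 1, 12 in units of their own scale, which
  may be twice that of the cluster. The values satisfy \<open>radius m > 8 * extent m\<close>;
  therefore the halves are disjoint in every coordinate in which the direction exceeds 1/4 in
  absolute value.\<close>

definition radius :: "nat \<Rightarrow> real" where
  "radius m = (if m = 0 then 1 else if m = 1 then 10 else 120)"

text \<open>Near an axis one scale factor is at least 3/4 and the other is this minimum. The value
  1/10 then separates the sizes of two pairs by the factor 4; 1/1000 makes one half of a cluster of
  8 chords narrower than the robustness of the other.\<close>

definition min_scale :: "nat \<Rightarrow> real" where
  "min_scale m = (if m = 1 then 1 / 10 else 1 / 1000)"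

text \<open>The scale is continuous in the direction, and yet near an axis, where the halves may
  share ends, it is very unequal for \<open>d\<close> and \<open>- d\<close>. Its symmetry in the
  two coordinates allows a reduction to one axis.\<close>

definition sub_shape :: "nat \<Rightarrow> shape \<Rightarrow> real \<times> real \<Rightarrow> shape" where
  "sub_shape m q d = (fst q + radius m * snd (snd q) * fst d, fst (snd q) + radius m * snd (snd q) * snd d,
     snd (snd q) * max (min_scale m) (fst d + snd d))"

text \<open>Half of the square, from (1, -1) through (1, 1) to (-1, 1).\<close>

definition half_turn :: "real \<Rightarrow> real \<times> real" where
  "half_turn t = (min 1 (3 - 4 * t), min 1 (4 * t - 1))"

lemma half_turn_ends: "half_turn 1 = - half_turn 0"
  by (simp add: half_turn_def)

lemma half_turn_circle: "0 \<le> t \<Longrightarrow> t \<le> 1 \<Longrightarrow> half_turn t \<in> sup_circle"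
  by (auto simp: half_turn_def sup_circle_def min_def max_def)

lemma sup_circle_uminus: "d \<in> sup_circle \<Longrightarrow> - d \<in> sup_circle"
  by (simp add: sup_circle_def)

definition flip_fst :: "nat \<Rightarrow> point \<times> 'q \<Rightarrow> point \<times> 'q" where
  "flip_fst i w = (flip i (fst w), snd w)"

context
  fixes bas :: "nat \<Rightarrow> real \<Rightarrow> real" and k :: "nat \<Rightarrow> nat" and r :: nat
begin

definition chord_letter :: "nat \<Rightarrow> (point \<times> shape) cochain" where
  "chord_letter i = cob (vertex (\<lambda>w.
     sign_bit (chord_val bas k (fst w) i (fst (snd w), fst (snd (snd w)))) (snd (fst w) i)))"

primrec cluster :: "nat \<Rightarrow> nat \<Rightarrow> (point \<times> shape) cochain" where
  "cluster M 0 = word chord_letter [0..<r]"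
| "cluster M (Suc m) = double M
     (\<lambda>x. (fst (fst x), sub_shape m (snd (fst x)) (half_turn (snd x))))
     (\<lambda>x. (fst (fst x), sub_shape m (snd (fst x)) (- half_turn (snd x)))) (cluster M m)"

primrec cluster_words :: "nat \<Rightarrow> nat list list" where
  "cluster_words 0 = [[0..<r]]"
| "cluster_words (Suc m) = concat (map sq_word (cluster_words m))"

lemma chord_val_flip: "chord_val bas k (flip l p) i z = (if l = i then - 1 else 1) * chord_val bas k p i z"
  by (auto simp: chord_val_def ev_def flip_def sum_negf)

lemma pull_flip_chord:
  "pull (flip_fst l) (vertex (\<lambda>w. sign_bit (chord_val bas k (fst w) i (fst (snd w), fst (snd (snd w)))) (snd (fst w) i)))
    = vertex (\<lambda>w :: point \<times> shape. sign_bit (chord_val bas k (fst w) i (fst (snd w), fst (snd (snd w)))) (snd (fst w) i))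
      + (if l = i then 1 else 0)"
proof (cases "l = i")
  case True
  have "sign_bit (chord_val bas k (flip i p) i z) (snd (flip i p) i) =
    sign_bit (chord_val bas k p i z) (snd p i) + 1" for p z
    using sign_bit_uminus[of "chord_val bas k p i z" "snd p i"] by (simp add: chord_val_flip) (simp add: flip_def)
  then show ?thesis
    using True by (simp add: pull_vertex flip_fst_def vertex_add vertex_1)
next
  case False
  then show ?thesis by (simp add: pull_vertex flip_fst_def chord_val_flip) (simp add: flip_def)
qed

lemma cocycle_chord_letter: "cocycle flip_fst (chord_letter i)"
  unfolding cocycle_def invariant_def chord_letter_def pull_cob pull_flip_chord
  by (simp add: cob_add cob_cob)

lemma pull_fst_sign: "pull fst (sign_letter i) = cob (vertex (\<lambda>w :: point \<times> 'q. snd (fst w) i))"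
  by (simp add: sign_letter_def pull_cob pull_vertex)

text \<open>Both bits are altered by the flip of row \<open>i\<close> and by no other flip, so their
  sum is an invariant primitive of the difference.\<close>

lemma cohomologous_chord_letter: "cohomologous flip_fst (chord_letter i) (pull fst (sign_letter i))"
proof -
  let ?v = "vertex (\<lambda>w :: point \<times> shape. sign_bit (chord_val bas k (fst w) i (fst (snd w), fst (snd (snd w)))) (snd (fst w) i))"
  let ?t = "vertex (\<lambda>w :: point \<times> shape. snd (fst w) i)"
  have t: "pull (flip_fst l) ?t = ?t + (if l = i then 1 else 0)" for l
  proof -
    have "?t = pull fst (vertex (\<lambda>p. snd p i))" by (simp add: pull_vertex)
    moreover have "pull (flip_fst l) (pull fst a :: (point \<times> shape) cochain) = pull fst (pull (flip l) a)" for a :: "point cochain"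
      unfolding pull_pull by (rule pull_map_eq) (simp add: flip_fst_def)
    ultimately show ?thesis by (simp add: pull_flip_sign pull_add)
  qed
  have "invariant flip_fst (?v + ?t)"
    unfolding invariant_def pull_add pull_flip_chord t by (auto simp: ac_simps)
  moreover have "chord_letter i + pull fst (sign_letter i) = cob (?v + ?t)"
    by (simp add: chord_letter_def pull_fst_sign cob_add)
  ultimately show ?thesis unfolding cohomologous_def by blast
qed

lemma cohomologous_word:
  assumes "\<And>i. cohomologous T (u i) (v i)" "\<And>i. cocycle T (u i)" "\<And>i. cocycle T (v i)"
  shows "cohomologous T (word u w) (word v w)" "cocycle T (word u w)"
proof -
  have c: "cocycle T (word u w)" if "\<And>i. cocycle T (u i)" for u w
    by (induction w) (simp_all add: cocycle_mult that)
  show "cocycle T (word u w)" by (rule c) (rule assms)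
  show "cohomologous T (word u w) (word v w)"
    by (induction w) (auto intro!: cohomologous_mult assms c)
qed

lemma pull_word: "pull f (word u w) = word (\<lambda>i. pull f (u i)) w"
  by (induction w) (simp_all add: pull_mult)

lemma cocycle_words_sign: "cocycle flip (words sign_letter ws)"
  by (rule cocycle_words[OF _ invariant_sign_letter]) (rule sign_letter_def)

lemma normalized_words_sign: "normalized (words sign_letter ws)"
  by (rule normalized_words[OF _ invariant_sign_letter]) (rule sign_letter_def)

lemma Sq_words_sign: "cohomologous flip (cup1 (words sign_letter ws) (words sign_letter ws))
    (words sign_letter (concat (map sq_word ws)))"
  by (rule Sq_words[OF _ invariant_sign_letter]) (rule sign_letter_def)

text \<open>Doubling respects the relation, so the half may first be replaced by a class that
  ignores the shape; on such a class doubling is \<open>cup1\<close>.\<close>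

lemma cluster_class:
  assumes M: "M > 0"
  shows "cocycle flip_fst (cluster M m)"
    "cohomologous flip_fst (cluster M m) (pull fst (words sign_letter (cluster_words m)))"
proof (induction m)
  case 0
  have "cocycle flip (sign_letter i)" for i
    by (simp add: cocycle_def invariant_sign_letter) (simp add: sign_letter_def cob_cob)
  then have c: "cocycle flip_fst (pull fst (sign_letter i) :: (point \<times> shape) cochain)" for i
    by (rule cocycle_pull) (simp add: flip_fst_def)
  note w = cohomologous_word[of flip_fst chord_letter, OF cohomologous_chord_letter cocycle_chord_letter c]
  { case 1 show ?case using w(2) by simp }
  { case 2 show ?case using w(1) by (simp add: words_def pull_word) }
next
  case (Suc m)
  let ?f = "\<lambda>x :: (point \<times> shape) \<times> real. (fst (fst x), sub_shape m (snd (fst x)) (half_turn (snd x)))"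
  let ?g = "\<lambda>x :: (point \<times> shape) \<times> real. (fst (fst x), sub_shape m (snd (fst x)) (- half_turn (snd x)))"
  have swap: "?f (w, 1) = ?g (w, 0)" "?g (w, 1) = ?f (w, 0)" for w
    by (simp_all add: half_turn_ends)
  have equi: "?f (flip_fst i w, t) = flip_fst i (?f (w, t))" "?g (flip_fst i w, t) = flip_fst i (?g (w, t))" for i w t
    by (simp_all add: flip_fst_def)
  { case 1
    show ?case unfolding cluster.simps by (rule cocycle_double[OF M swap equi Suc.IH(1)]) }
  { case 2
    let ?s = "words sign_letter (cluster_words m)"
    have eq: "double M ?f ?g (pull fst ?s) = pull fst (cup1 ?s ?s)"
      by (rule double_const[OF normalized_words_sign]) auto
    have c: "cocycle flip_fst (pull fst ?s :: (point \<times> shape) cochain)"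
      by (rule cocycle_pull[OF cocycle_words_sign]) (simp add: flip_fst_def)
    have "cohomologous flip_fst (cluster M (Suc m)) (pull fst (cup1 ?s ?s))"
      unfolding cluster.simps eq[symmetric] by (rule cohomologous_double[OF M swap equi c Suc.IH(2)])
    also have "cohomologous flip_fst \<dots> (pull fst (words sign_letter (cluster_words (Suc m))))"
      unfolding cluster_words.simps
      by (rule cohomologous_pull[OF Sq_words_sign]) (simp add: flip_fst_def)
    finally (cohomologous_trans) show ?case . }
qed

end

text \<open>\<open>bs\<close> addresses a chord in a binary tree, shorter lists \<open>p\<close>
  address inner nodes, and \<open>D p\<close> is the direction at the node \<open>p\<close>; its two
  branches use opposite directions.\<close>

primrec leaf :: "bool list \<Rightarrow> (bool list \<Rightarrow> real \<times> real) \<Rightarrow> shape \<Rightarrow> real \<times> real" where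
  "leaf [] D q = (fst q, fst (snd q))"
| "leaf (b # bs) D q = leaf bs (\<lambda>p. D (b # p)) (sub_shape (length bs) q (if b then D [] else - D []))"

section \<open>Bounds and uniform continuity for clusters\<close>

lemma dist_Pair_le: "dist (a, b) (c, d) \<le> dist a c + dist b d"
  by (simp add: dist_Pair_Pair sqrt_sum_squares_le_sum)

lemma compact_sup_circle: "compact sup_circle"
proof (rule compact_eq_bounded_closed[THEN iffD2], rule conjI)
  have "norm d \<le> 2" if "d \<in> sup_circle" for d :: "real \<times> real"
  proof -
    have "norm d \<le> norm (fst d) + norm (snd d)" by (metis norm_Pair_le prod.collapse)
    then show ?thesis using that by (auto simp: sup_circle_def)
  qed
  then show "bounded sup_circle" unfolding bounded_iff by blast
  show "closed sup_circle" unfolding sup_circle_def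
    by (intro closed_Collect_eq continuous_intros)
qed

lemma continuous_sub_shape: "continuous_on S (\<lambda>x. sub_shape m (fst x) (snd x))"
  unfolding sub_shape_def by (intro continuous_intros)

lemma sub_shape_bounded: "\<exists>B'. \<forall>q d. norm q \<le> B \<longrightarrow> d \<in> sup_circle \<longrightarrow> norm (sub_shape m q d) \<le> B'"
proof -
  have "compact ((\<lambda>x. sub_shape m (fst x) (snd x)) ` (cball 0 B \<times> sup_circle))"
    by (intro compact_continuous_image continuous_sub_shape compact_Times compact_cball compact_sup_circle)
  from compact_imp_bounded[OF this] obtain B' where
    B': "\<forall>x\<in>(\<lambda>x. sub_shape m (fst x) (snd x)) ` (cball 0 B \<times> sup_circle). norm x \<le> B'"
    unfolding bounded_iff by blast
  have "norm (sub_shape m q d) \<le> B'" if "norm q \<le> B" "d \<in> sup_circle" for q d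
  proof -
    have "sub_shape m q d \<in> (\<lambda>x. sub_shape m (fst x) (snd x)) ` (cball 0 B \<times> sup_circle)"
      using that by (intro image_eqI[of _ _ "(q, d)"]) auto
    then show ?thesis using B' by blast
  qed
  then show ?thesis by blast
qed

lemma sub_shape_uniform:
  assumes "\<epsilon> > 0"
  shows "\<exists>\<delta>>0. \<forall>q q' d d'. norm q \<le> B \<longrightarrow> norm q' \<le> B \<longrightarrow> d \<in> sup_circle \<longrightarrow> d' \<in> sup_circle \<longrightarrow>
    dist q q' \<le> \<delta> \<longrightarrow> dist d d' \<le> \<delta> \<longrightarrow> dist (sub_shape m q d) (sub_shape m q' d') \<le> \<epsilon>"
proof -
  have "uniformly_continuous_on (cball 0 B \<times> sup_circle) (\<lambda>x. sub_shape m (fst x) (snd x))"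
    by (intro compact_uniformly_continuous continuous_sub_shape compact_Times compact_cball compact_sup_circle)
  then obtain \<delta> where \<delta>: "\<delta> > 0" "\<And>x x'. x \<in> cball 0 B \<times> sup_circle \<Longrightarrow> x' \<in> cball 0 B \<times> sup_circle \<Longrightarrow> dist x' x < \<delta> \<Longrightarrow>
      dist (sub_shape m (fst x') (snd x')) (sub_shape m (fst x) (snd x)) < \<epsilon>"
    using assms unfolding uniformly_continuous_on_def by blast
  show ?thesis
  proof (intro exI[of _ "\<delta> / 3"] conjI allI impI)
    fix q q' :: shape and d d' :: "real \<times> real"
    assume a: "norm q \<le> B" "norm q' \<le> B" "d \<in> sup_circle" "d' \<in> sup_circle" "dist q q' \<le> \<delta> / 3" "dist d d' \<le> \<delta> / 3"
    have "dist (q, d) (q', d') \<le> dist q q' + dist d d'" by (rule dist_Pair_le)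
    then have "dist (q, d) (q', d') < \<delta>" using a \<delta>(1) by simp
    then show "dist (sub_shape m q d) (sub_shape m q' d') \<le> \<epsilon>"
      using \<delta>(2)[of "(q', d')" "(q, d)"] a by simp
  qed (use \<delta> in simp)
qed

lemma leaf_bounded:
  "\<exists>B'. \<forall>bs D q. length bs = m \<longrightarrow> range D \<subseteq> sup_circle \<longrightarrow> norm q \<le> B \<longrightarrow> norm (leaf bs D q) \<le> B'"
proof (induction m arbitrary: B)
  case 0
  have *: "norm (fst q, fst (snd q)) \<le> 2 * norm q" for q :: shape
  proof -
    have "norm (fst q, fst (snd q)) \<le> norm (fst q) + norm (fst (snd q))" by (rule norm_Pair_le)
    also have "\<dots> \<le> norm q + norm q"
      using norm_fst_le[of "fst q" "snd q"] norm_snd_le[of "snd q" "fst q"] norm_fst_le[of "fst (snd q)" "snd (snd q)"]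
      by (intro add_mono) simp_all
    finally show ?thesis by simp
  qed
  then have "norm (fst q, fst (snd q)) \<le> 2 * B" if "norm q \<le> B" for q :: shape
    using *[of q] that by linarith
  then show ?case by (intro exI[of _ "2 * B"]) simp
next
  case (Suc m)
  obtain B1 where B1: "\<And>q d. norm q \<le> B \<Longrightarrow> d \<in> sup_circle \<Longrightarrow> norm (sub_shape m q d) \<le> B1"
    using sub_shape_bounded[of B m] by blast
  obtain B2 where B2: "\<And>bs D q. length bs = m \<Longrightarrow> range D \<subseteq> sup_circle \<Longrightarrow> norm q \<le> B1 \<Longrightarrow> norm (leaf bs D q) \<le> B2"
    using Suc.IH[of B1] by blast
  show ?case
  proof (intro exI[of _ B2] allI impI)
    fix bs :: "bool list" and D :: "bool list \<Rightarrow> real \<times> real" and q :: shape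
    assume a: "length bs = Suc m" "range D \<subseteq> sup_circle" "norm q \<le> B"
    then obtain b bs' where bs: "bs = b # bs'" "length bs' = m" by (cases bs) auto
    have c: "(if b then D [] else - D []) \<in> sup_circle" using a(2) by (auto intro: sup_circle_uminus)
    have "range (\<lambda>p. D (b # p)) \<subseteq> sup_circle" using a(2) by auto
    from B2[OF bs(2) this B1[OF a(3) c]] show "norm (leaf bs D q) \<le> B2" by (simp add: bs)
  qed
qed

lemma leaf_uniform:
  "\<epsilon> > 0 \<Longrightarrow> \<exists>\<delta>>0. \<forall>bs D q q'. length bs = m \<longrightarrow> range D \<subseteq> sup_circle \<longrightarrow> norm q \<le> B \<longrightarrow> norm q' \<le> B \<longrightarrow>
    dist q q' \<le> \<delta> \<longrightarrow> dist (leaf bs D q) (leaf bs D q') \<le> \<epsilon>"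
proof (induction m arbitrary: B \<epsilon>)
  case 0
  have *: "dist (fst q, fst (snd q)) (fst q', fst (snd q')) \<le> 2 * dist q q'" for q q' :: shape
  proof -
    have "dist (fst q, fst (snd q)) (fst q', fst (snd q')) \<le> dist (fst q) (fst q') + dist (fst (snd q)) (fst (snd q'))"
      by (rule dist_Pair_le)
    also have "\<dots> \<le> dist q q' + dist q q'"
      by (intro add_mono dist_fst_le order_trans[OF dist_fst_le dist_snd_le])
    finally show ?thesis by simp
  qed
  then have "dist (fst q, fst (snd q)) (fst q', fst (snd q')) \<le> \<epsilon>" if "dist q q' \<le> \<epsilon> / 2" for q q' :: shape
    using *[of q q'] that by linarith
  then show ?case using 0 by (intro exI[of _ "\<epsilon> / 2"]) simp
next
  case (Suc m)
  obtain B1 where B1: "\<And>q d. norm q \<le> B \<Longrightarrow> d \<in> sup_circle \<Longrightarrow> norm (sub_shape m q d) \<le> B1"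
    using sub_shape_bounded[of B m] by blast
  obtain \<delta>1 where d1: "\<delta>1 > 0" "\<And>bs D q q'. length bs = m \<Longrightarrow> range D \<subseteq> sup_circle \<Longrightarrow> norm q \<le> B1 \<Longrightarrow> norm q' \<le> B1 \<Longrightarrow>
      dist q q' \<le> \<delta>1 \<Longrightarrow> dist (leaf bs D q) (leaf bs D q') \<le> \<epsilon>"
    using Suc.IH[OF Suc.prems, of B1] by blast
  obtain \<delta> where d: "\<delta> > 0" "\<And>q q' d d'. norm q \<le> B \<Longrightarrow> norm q' \<le> B \<Longrightarrow> d \<in> sup_circle \<Longrightarrow> d' \<in> sup_circle \<Longrightarrow>
    dist q q' \<le> \<delta> \<Longrightarrow> dist d d' \<le> \<delta> \<Longrightarrow> dist (sub_shape m q d) (sub_shape m q' d') \<le> \<delta>1"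
    using sub_shape_uniform[OF d1(1), of B m] by blast
  show ?case
  proof (intro exI[of _ \<delta>] conjI d(1) allI impI)
    fix bs :: "bool list" and D :: "bool list \<Rightarrow> real \<times> real" and q q' :: shape
    assume a: "length bs = Suc m" "range D \<subseteq> sup_circle" "norm q \<le> B" "norm q' \<le> B" "dist q q' \<le> \<delta>"
    then obtain b bs' where bs: "bs = b # bs'" "length bs' = m" by (cases bs) auto
    have c: "(if b then D [] else - D []) \<in> sup_circle" using a(2) by (auto intro: sup_circle_uminus)
    have "range (\<lambda>p. D (b # p)) \<subseteq> sup_circle" using a(2) by auto
    then have "dist (leaf bs' (\<lambda>p. D (b # p)) (sub_shape m q (if b then D [] else - D [])))
       (leaf bs' (\<lambda>p. D (b # p)) (sub_shape m q' (if b then D [] else - D []))) \<le> \<epsilon>"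
      by (intro d1(2) bs(2) B1 a c d(2)) (use d(1) in simp_all)
    then show "dist (leaf bs D q) (leaf bs D q') \<le> \<epsilon>" by (simp add: bs)
  qed
qed

text \<open>The bounds by \<open>B\<close> and 1 confine the relevant data to a compact set, where
  continuity is uniform; \<open>\<delta>\<close> controls the diameter.\<close>

definition tame :: "nat \<Rightarrow> real \<Rightarrow> real \<Rightarrow> (point \<times> shape) set \<Rightarrow> bool" where
  "tame r B \<delta> X \<longleftrightarrow> (\<forall>w\<in>X. norm (snd w) \<le> B \<and> (\<forall>i<r. \<forall>j. \<bar>fst (fst w) i j\<bar> \<le> 1)) \<and>
     (\<forall>w\<in>X. \<forall>w'\<in>X. dist (snd w) (snd w') \<le> \<delta> \<and> (\<forall>i<r. \<forall>j. \<bar>fst (fst w) i j - fst (fst w') i j\<bar> \<le> \<delta>))"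

lemma tame_subset: "tame r B \<delta> X \<Longrightarrow> Y \<subseteq> X \<Longrightarrow> tame r B \<delta> Y"
  unfolding tame_def by blast

lemma tame_mono: "tame r B \<delta> X \<Longrightarrow> \<delta> \<le> \<delta>' \<Longrightarrow> tame r B \<delta>' X"
  unfolding tame_def by (meson order_trans)

definition near_zero :: "(nat \<Rightarrow> real \<Rightarrow> real) \<Rightarrow> (nat \<Rightarrow> nat) \<Rightarrow> nat \<Rightarrow> real \<Rightarrow> nat \<Rightarrow>
    (bool list \<Rightarrow> real \<times> real) \<Rightarrow> (point \<times> shape) set \<Rightarrow> bool" where
  "near_zero bas k r \<epsilon> m D X \<longleftrightarrow> (\<forall>w\<in>X. \<forall>bs. length bs = m \<longrightarrow> (\<forall>i<r. \<bar>chord_val bas k (fst w) i (leaf bs D (snd w))\<bar> \<le> \<epsilon>))"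

context
  fixes bas :: "nat \<Rightarrow> real \<Rightarrow> real" and k :: "nat \<Rightarrow> nat" and r :: nat
  assumes bas: "\<And>j. continuous_on UNIV (bas j)"
begin

lemma bas_uniform:
  assumes "\<epsilon> > 0"
  shows "\<exists>\<delta>>0. \<forall>j\<le>n. \<forall>t t'. \<bar>t\<bar> \<le> B \<longrightarrow> \<bar>t'\<bar> \<le> B \<longrightarrow> \<bar>t - t'\<bar> \<le> \<delta> \<longrightarrow> \<bar>bas j t - bas j t'\<bar> \<le> \<epsilon>"
proof (induction n)
  have *: "\<exists>\<delta>>0. \<forall>t t'. \<bar>t\<bar> \<le> B \<longrightarrow> \<bar>t'\<bar> \<le> B \<longrightarrow> \<bar>t - t'\<bar> \<le> \<delta> \<longrightarrow> \<bar>bas j t - bas j t'\<bar> \<le> \<epsilon>" for j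
  proof -
    have "uniformly_continuous_on {-B..B} (bas j)"
      using bas continuous_on_subset by (intro compact_uniformly_continuous) blast+
    then obtain \<delta> where \<delta>: "\<delta> > 0" "\<And>t t'. t \<in> {-B..B} \<Longrightarrow> t' \<in> {-B..B} \<Longrightarrow> dist t' t < \<delta> \<Longrightarrow> dist (bas j t') (bas j t) < \<epsilon>"
      using assms unfolding uniformly_continuous_on_def by blast
    show ?thesis
    proof (intro exI[of _ "\<delta> / 2"] conjI allI impI)
      fix t t' assume a: "\<bar>t\<bar> \<le> B" "\<bar>t'\<bar> \<le> B" "\<bar>t - t'\<bar> \<le> \<delta> / 2"
      then have "t \<in> {-B..B}" "t' \<in> {-B..B}" "dist t t' < \<delta>" using \<delta>(1) by (auto simp: dist_real_def)
      from \<delta>(2)[OF this(2,1,3)] show "\<bar>bas j t - bas j t'\<bar> \<le> \<epsilon>" by (simp add: dist_real_def)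
    qed (use \<delta> in simp)
  qed
  { case 0 show ?case using *[of 0] by simp }
  { case (Suc n)
    then obtain \<delta>1 where d1: "\<delta>1 > 0" "\<And>j t t'. j \<le> n \<Longrightarrow> \<bar>t\<bar> \<le> B \<Longrightarrow> \<bar>t'\<bar> \<le> B \<Longrightarrow> \<bar>t - t'\<bar> \<le> \<delta>1 \<Longrightarrow> \<bar>bas j t - bas j t'\<bar> \<le> \<epsilon>"
      by blast
    obtain \<delta>2 where d2: "\<delta>2 > 0" "\<And>t t'. \<bar>t\<bar> \<le> B \<Longrightarrow> \<bar>t'\<bar> \<le> B \<Longrightarrow> \<bar>t - t'\<bar> \<le> \<delta>2 \<Longrightarrow> \<bar>bas (Suc n) t - bas (Suc n) t'\<bar> \<le> \<epsilon>"
      using *[of "Suc n"] by blast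
    show ?case using d1 d2 by (intro exI[of _ "min \<delta>1 \<delta>2"]) (auto simp: le_Suc_eq) }
qed

lemma bas_bounded: "\<exists>C. \<forall>j\<le>n. \<forall>t. \<bar>t\<bar> \<le> B \<longrightarrow> \<bar>bas j t\<bar> \<le> C"
proof (induction n)
  have *: "\<exists>C. \<forall>t. \<bar>t\<bar> \<le> B \<longrightarrow> \<bar>bas j t\<bar> \<le> C" for j
  proof -
    have "compact (bas j ` {-B..B})"
      using bas continuous_on_subset by (intro compact_continuous_image) blast+
    from compact_imp_bounded[OF this] obtain a where "\<forall>x\<in>bas j ` {-B..B}. norm x \<le> a"
      unfolding bounded_iff by blast
    then show ?thesis by (intro exI[of _ a]) (auto simp: abs_le_iff)
  qed
  { case 0 show ?case using *[of 0] by simp }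
  { case (Suc n)
    then obtain C1 where "\<And>j t. j \<le> n \<Longrightarrow> \<bar>t\<bar> \<le> B \<Longrightarrow> \<bar>bas j t\<bar> \<le> C1" by blast
    moreover obtain C2 where "\<And>t. \<bar>t\<bar> \<le> B \<Longrightarrow> \<bar>bas (Suc n) t\<bar> \<le> C2" using *[of "Suc n"] by blast
    ultimately show ?case by (intro exI[of _ "max C1 C2"]) (auto simp: le_Suc_eq le_max_iff_disj) }
qed

lemma ev_uniform:
  assumes "\<epsilon> > 0"
  shows "\<exists>\<delta>>0. \<forall>p p' t t'. \<forall>i<r. (\<forall>j. \<bar>fst p i j\<bar> \<le> 1 \<and> \<bar>fst p' i j\<bar> \<le> 1 \<and> \<bar>fst p i j - fst p' i j\<bar> \<le> \<delta>) \<longrightarrow>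
    \<bar>t\<bar> \<le> B \<longrightarrow> \<bar>t'\<bar> \<le> B \<longrightarrow> \<bar>t - t'\<bar> \<le> \<delta> \<longrightarrow> \<bar>ev bas k p i t - ev bas k p' i t'\<bar> \<le> \<epsilon>"
proof -
  define n where "n = (\<Sum>i<r. k i)"
  have kn: "k i \<le> n" if "i < r" for i
    unfolding n_def using that by (intro member_le_sum) auto
  obtain C where "\<And>j t. j \<le> n \<Longrightarrow> \<bar>t\<bar> \<le> B \<Longrightarrow> \<bar>bas j t\<bar> \<le> C" using bas_bounded by blast
  then have C: "\<bar>bas j t\<bar> \<le> \<bar>C\<bar> + 1" if "j \<le> n" "\<bar>t\<bar> \<le> B" for j t using that by force
  let ?e = "\<epsilon> / (2 * (real n + 1))"
  have e: "?e > 0" using assms by simp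
  obtain \<delta> where \<delta>: "\<delta> > 0" "\<And>j t t'. j \<le> n \<Longrightarrow> \<bar>t\<bar> \<le> B \<Longrightarrow> \<bar>t'\<bar> \<le> B \<Longrightarrow> \<bar>t - t'\<bar> \<le> \<delta> \<Longrightarrow> \<bar>bas j t - bas j t'\<bar> \<le> ?e"
    using bas_uniform[OF e, of n B] by blast
  let ?d = "min \<delta> (?e / (\<bar>C\<bar> + 1))"
  show ?thesis
  proof (intro exI[of _ ?d] conjI allI impI)
    have "?e / (\<bar>C\<bar> + 1) > 0" using assms by (intro divide_pos_pos) auto
    then show "?d > 0" using \<delta>(1) by (simp only: min_less_iff_conj)
    fix p p' :: point and t t' i
    assume i: "i < r" and p: "\<forall>j. \<bar>fst p i j\<bar> \<le> 1 \<and> \<bar>fst p' i j\<bar> \<le> 1 \<and> \<bar>fst p i j - fst p' i j\<bar> \<le> ?d"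
      and t: "\<bar>t\<bar> \<le> B" "\<bar>t'\<bar> \<le> B" "\<bar>t - t'\<bar> \<le> ?d"
    have "\<bar>fst p i j * bas j t - fst p' i j * bas j t'\<bar> \<le> 2 * ?e" if "j \<le> k i" for j
    proof -
      have j: "j \<le> n" using that kn[OF i] by simp
      have "fst p i j * bas j t - fst p' i j * bas j t' = (fst p i j - fst p' i j) * bas j t + fst p' i j * (bas j t - bas j t')"
        by (simp add: algebra_simps)
      also have "\<bar>\<dots>\<bar> \<le> \<bar>(fst p i j - fst p' i j) * bas j t\<bar> + \<bar>fst p' i j * (bas j t - bas j t')\<bar>"
        by (rule abs_triangle_ineq)
      also have "\<dots> = \<bar>fst p i j - fst p' i j\<bar> * \<bar>bas j t\<bar> + \<bar>fst p' i j\<bar> * \<bar>bas j t - bas j t'\<bar>"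
        by (simp add: abs_mult)
      also have "\<dots> \<le> (?e / (\<bar>C\<bar> + 1)) * (\<bar>C\<bar> + 1) + 1 * ?e"
        by (intro add_mono mult_mono C j t \<delta>(2)) (use p t e in auto)
      also have "\<dots> = 2 * ?e" by (simp add: add_nonneg_eq_0_iff)
      finally show ?thesis .
    qed
    then have "\<bar>\<Sum>j\<le>k i. fst p i j * bas j t - fst p' i j * bas j t'\<bar> \<le> (\<Sum>j\<le>k i. 2 * ?e)"
      by (intro order_trans[OF sum_abs] sum_mono) simp
    also have "\<dots> = (real (k i) + 1) * (2 * ?e)" by simp
    also have "\<dots> \<le> (real n + 1) * (2 * ?e)"
      using kn[OF i] e by (intro mult_right_mono) auto
    also have "\<dots> = \<epsilon>" by (simp add: field_simps)
    finally show "\<bar>ev bas k p i t - ev bas k p' i t'\<bar> \<le> \<epsilon>"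
      by (simp add: ev_def sum_subtractf)
  qed
qed

lemma chord_val_uniform:
  assumes "\<epsilon> > 0"
  shows "\<exists>\<delta>>0. \<forall>w w' D bs i. tame r B \<delta> {w, w'} \<longrightarrow> range D \<subseteq> sup_circle \<longrightarrow> length bs = m \<longrightarrow> i < r \<longrightarrow>
    \<bar>chord_val bas k (fst w) i (leaf bs D (snd w)) - chord_val bas k (fst w') i (leaf bs D (snd w'))\<bar> \<le> \<epsilon>"
proof -
  obtain B1 where B1: "\<And>bs D q. length bs = m \<Longrightarrow> range D \<subseteq> sup_circle \<Longrightarrow> norm q \<le> B \<Longrightarrow> norm (leaf bs D q) \<le> B1"
    using leaf_bounded[of m B] by blast
  have e: "\<epsilon> / 2 > 0" using assms by simp
  obtain \<delta>1 where d1: "\<delta>1 > 0" "\<And>p p' t t' i. i < r \<Longrightarrow> (\<And>j. \<bar>fst p i j\<bar> \<le> 1 \<and> \<bar>fst p' i j\<bar> \<le> 1 \<and> \<bar>fst p i j - fst p' i j\<bar> \<le> \<delta>1) \<Longrightarrow>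
    \<bar>t\<bar> \<le> B1 \<Longrightarrow> \<bar>t'\<bar> \<le> B1 \<Longrightarrow> \<bar>t - t'\<bar> \<le> \<delta>1 \<Longrightarrow> \<bar>ev bas k p i t - ev bas k p' i t'\<bar> \<le> \<epsilon> / 2"
    using ev_uniform[OF e, of B1] by blast
  obtain \<delta>2 where d2: "\<delta>2 > 0" "\<And>bs D q q'. length bs = m \<Longrightarrow> range D \<subseteq> sup_circle \<Longrightarrow> norm q \<le> B \<Longrightarrow> norm q' \<le> B \<Longrightarrow>
    dist q q' \<le> \<delta>2 \<Longrightarrow> dist (leaf bs D q) (leaf bs D q') \<le> \<delta>1"
    using leaf_uniform[OF d1(1), of m B] by blast
  show ?thesis
  proof (intro exI[of _ "min \<delta>1 \<delta>2"] conjI allI impI)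
    fix w w' :: "point \<times> shape" and D :: "bool list \<Rightarrow> real \<times> real" and bs :: "bool list" and i
    assume t: "tame r B (min \<delta>1 \<delta>2) {w, w'}" and D: "range D \<subseteq> sup_circle" and bs: "length bs = m" and i: "i < r"
    let ?z = "leaf bs D (snd w)" and ?z' = "leaf bs D (snd w')"
    have z: "norm ?z \<le> B1" "norm ?z' \<le> B1" using t by (auto intro!: B1 bs D simp: tame_def)
    have zz: "dist ?z ?z' \<le> \<delta>1" using t by (auto intro!: d2(2) bs D simp: tame_def)
    have p: "\<bar>fst (fst w) i j\<bar> \<le> 1 \<and> \<bar>fst (fst w') i j\<bar> \<le> 1 \<and> \<bar>fst (fst w) i j - fst (fst w') i j\<bar> \<le> \<delta>1" for j
      using t i by (auto simp: tame_def)
    have 1: "\<bar>ev bas k (fst w) i (fst ?z) - ev bas k (fst w') i (fst ?z')\<bar> \<le> \<epsilon> / 2"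
      using d1(2)[OF i p, of "fst ?z" "fst ?z'"] z zz norm_fst_le[of "fst ?z" "snd ?z"] norm_fst_le[of "fst ?z'" "snd ?z'"]
        dist_fst_le[of ?z ?z'] by (simp add: dist_real_def)
    have 2: "\<bar>ev bas k (fst w) i (snd ?z) - ev bas k (fst w') i (snd ?z')\<bar> \<le> \<epsilon> / 2"
      using d1(2)[OF i p, of "snd ?z" "snd ?z'"] z zz norm_snd_le[of "snd ?z" "fst ?z"] norm_snd_le[of "snd ?z'" "fst ?z'"]
        dist_snd_le[of ?z ?z'] by (simp add: dist_real_def)
    show "\<bar>chord_val bas k (fst w) i ?z - chord_val bas k (fst w') i ?z'\<bar> \<le> \<epsilon>"
      using 1 2 unfolding chord_val_def by linarith
  qed (use d1(1) d2(1) in simp)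
qed

lemma cval_word_nonzero:
  "cval (word u w) l \<noteq> 0 \<Longrightarrow> i \<in> set w \<Longrightarrow> \<exists>l'. l' \<noteq> [] \<and> set l' \<subseteq> set l \<and> cval (u i) l' \<noteq> 0"
proof (induction w arbitrary: l)
  case (Cons a w)
  from cval_mult_nonzero[of "word u w" "u a" l] Cons.prems(1) obtain l1 l2 where
    l: "l2 \<noteq> []" "set l1 \<subseteq> set l" "set l2 \<subseteq> set l" "cval (word u w) l1 \<noteq> 0" "cval (u a) l2 \<noteq> 0" by auto
  show ?case
  proof (cases "i = a")
    case True then show ?thesis using l by blast
  next
    case False
    then show ?thesis using Cons.IH[OF l(4)] Cons.prems(2) l(2) by auto
  qed
qed simp

text \<open>A nonzero value of the doubled cochain forces the half to be nonzero both near some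
  direction and near its opposite. Directions for all nodes are thus read off from one simplex, and
  uniform continuity carries the estimates to its other vertices.\<close>

lemma cluster_support:
  "\<epsilon> > 0 \<Longrightarrow> \<exists>\<delta>>0. \<exists>M0. \<forall>M\<ge>M0. M > 0 \<longrightarrow> (\<forall>l. tame r B \<delta> (set l) \<longrightarrow> cval (cluster bas k r M m) l \<noteq> 0 \<longrightarrow>
     (\<exists>D. range D \<subseteq> sup_circle \<and> near_zero bas k r \<epsilon> m D (set l)))"
proof (induction m arbitrary: B \<epsilon>)
  case 0
  have e: "\<epsilon> / 2 > 0" using 0 by simp
  obtain \<delta> where \<delta>: "\<delta> > 0" "\<And>w w' D bs i. tame r B \<delta> {w, w'} \<Longrightarrow> range D \<subseteq> sup_circle \<Longrightarrow> length bs = 0 \<Longrightarrow> i < r \<Longrightarrow>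
    \<bar>chord_val bas k (fst w) i (leaf bs D (snd w)) - chord_val bas k (fst w') i (leaf bs D (snd w'))\<bar> \<le> \<epsilon> / 2"
    using chord_val_uniform[OF e, of B 0] by blast
  \<comment> \<open>A single chord has no node, so any assignment of directions will do.\<close>
  let ?D = "\<lambda>_ :: bool list. (1, 0) :: real \<times> real"
  have D: "range ?D \<subseteq> sup_circle" by (auto simp: sup_circle_def)
  show ?case
  proof (rule exI[of _ \<delta>], rule conjI[OF \<delta>(1)], rule exI[of _ 0], intro allI impI, rule exI[of _ ?D], rule conjI[OF D])
    fix M l assume t: "tame r B \<delta> (set l)" and nz: "cval (cluster bas k r M 0) l \<noteq> 0"
    show "near_zero bas k r \<epsilon> 0 ?D (set l)"
      unfolding near_zero_def
    proof (intro ballI allI impI)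
      fix w :: "point \<times> shape" and bs :: "bool list" and i assume w: "w \<in> set l" and bs: "length bs = 0" and i: "i < r"
      let ?c = "\<lambda>w :: point \<times> shape. chord_val bas k (fst w) i (fst (snd w), fst (snd (snd w)))"
      obtain l' where l': "set l' \<subseteq> set l" "cval (chord_letter bas k i) l' \<noteq> 0"
        using cval_word_nonzero[of "chord_letter bas k" "[0..<r]" l i] nz i by auto
      define a b where "a = l' ! 0" and "b = l' ! 1"
      have len: "length l' = 2" and ab: "sign_bit (?c a) (snd (fst a) i) + sign_bit (?c b) (snd (fst b) i) \<noteq> 0"
        using l'(2) unfolding chord_letter_def cval_cob_vertex a_def b_def by (auto split: if_splits)
      have abl: "a \<in> set l" "b \<in> set l" using l'(1) len by (auto simp: a_def b_def)
      have c: "\<bar>?c v - ?c v'\<bar> \<le> \<epsilon> / 2" if "v \<in> set l" "v' \<in> set l" for v v'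
        using \<delta>(2)[OF tame_subset[OF t], of v v' ?D "[]" i] that D i by simp
      have "\<bar>?c a\<bar> \<le> \<epsilon> / 2" using sign_bit_neq[OF ab] c[OF abl] by linarith
      then have "\<bar>?c w\<bar> \<le> \<epsilon>" using c[OF w abl(1)] by linarith
      then show "\<bar>chord_val bas k (fst w) i (leaf bs ?D (snd w))\<bar> \<le> \<epsilon>" using bs by simp
    qed
  qed
next
  case (Suc m)
  have e: "\<epsilon> / 2 > 0" using Suc.prems by simp
  obtain B1 where B1: "\<And>q d. norm q \<le> B \<Longrightarrow> d \<in> sup_circle \<Longrightarrow> norm (sub_shape m q d) \<le> B1"
    using sub_shape_bounded[of B m] by blast
  obtain \<delta>1 M1 where d1: "\<delta>1 > 0" "\<And>M l. M \<ge> M1 \<Longrightarrow> M > 0 \<Longrightarrow> tame r B1 \<delta>1 (set l) \<Longrightarrow> cval (cluster bas k r M m) l \<noteq> 0 \<Longrightarrow>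
     \<exists>D. range D \<subseteq> sup_circle \<and> near_zero bas k r (\<epsilon> / 2) m D (set l)"
    using Suc.IH[OF e, of B1] by blast
  obtain \<delta>2 where d2: "\<delta>2 > 0" "\<And>w w' D bs i. tame r B1 \<delta>2 {w, w'} \<Longrightarrow> range D \<subseteq> sup_circle \<Longrightarrow> length bs = m \<Longrightarrow> i < r \<Longrightarrow>
    \<bar>chord_val bas k (fst w) i (leaf bs D (snd w)) - chord_val bas k (fst w') i (leaf bs D (snd w'))\<bar> \<le> \<epsilon> / 2"
    using chord_val_uniform[OF e, of B1 m] by blast
  define \<delta>3 where "\<delta>3 = min \<delta>1 \<delta>2"
  have d3: "\<delta>3 > 0" using d1(1) d2(1) by (simp add: \<delta>3_def)
  obtain \<delta>4 where d4: "\<delta>4 > 0" "\<And>q q' d d'. norm q \<le> B \<Longrightarrow> norm q' \<le> B \<Longrightarrow> d \<in> sup_circle \<Longrightarrow> d' \<in> sup_circle \<Longrightarrow>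
    dist q q' \<le> \<delta>4 \<Longrightarrow> dist d d' \<le> \<delta>4 \<Longrightarrow> dist (sub_shape m q d) (sub_shape m q' d') \<le> \<delta>3"
    using sub_shape_uniform[OF d3, of B m] by blast
  \<comment> \<open>Each coordinate of \<open>half_turn\<close> changes with speed at most 4, so a
    step of length 1/M moves the direction by at most 8/M.\<close>
  define M0 where "M0 = max M1 (nat \<lceil>8 / \<delta>4\<rceil>)"
  show ?case
  proof (rule exI[of _ "min \<delta>3 \<delta>4"], intro conjI exI[of _ M0] allI impI)
    show "0 < min \<delta>3 \<delta>4" using d3 d4(1) by simp
    fix M and l :: "(point \<times> shape) list"
    assume M: "M \<ge> M0" "M > 0" and t: "tame r B (min \<delta>3 \<delta>4) (set l)" and nz: "cval (cluster bas k r M (Suc m)) l \<noteq> 0"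
    have M1: "M \<ge> M1" using M by (simp add: M0_def)
    have "8 / \<delta>4 \<le> real M" using M by (simp add: M0_def)
    then have M8: "8 / real M \<le> \<delta>4" using M(2) d4(1) by (simp add: field_simps)
    let ?f = "\<lambda>x :: (point \<times> shape) \<times> real. (fst (fst x), sub_shape m (snd (fst x)) (half_turn (snd x)))"
    let ?g = "\<lambda>x :: (point \<times> shape) \<times> real. (fst (fst x), sub_shape m (snd (fst x)) (- half_turn (snd x)))"
    \<comment> \<open>Vertices together with their parameters: the parameter is 0 for the
      \<open>cup1\<close> term and one of two neighbouring subdivision points for the
      integral.\<close>
    define good where "good X \<longleftrightarrow> (\<forall>x\<in>X. fst x \<in> set l \<and> 0 \<le> snd x \<and> snd x \<le> 1 \<and> (\<forall>x'\<in>X. dist (half_turn (snd x)) (half_turn (snd x')) \<le> \<delta>4))" for X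
    have "\<exists>X l1 l2. good X \<and> l1 \<noteq> [] \<and> l2 \<noteq> [] \<and> set l1 \<subseteq> X \<and> set l2 \<subseteq> X \<and>
       cval (cluster bas k r M m) (map ?f l1) \<noteq> 0 \<and> cval (cluster bas k r M m) (map ?g l2) \<noteq> 0"
    proof (cases "cval (path_int M (pull ?f (cluster bas k r M m) * pull ?g (cluster bas k r M m))) l = 0")
      case True
      then have "cval (cup1 (pull (\<lambda>w. ?f (w, 0)) (cluster bas k r M m)) (pull (\<lambda>w. ?g (w, 0)) (cluster bas k r M m))) l \<noteq> 0"
        using nz by (simp add: double_def cval_add)
      from cval_cup1_nonzero[OF this] obtain l1 l2 where "l1 \<noteq> []" "l2 \<noteq> []" "set l1 \<subseteq> set l" "set l2 \<subseteq> set l"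
        "cval (cluster bas k r M m) (map ?f (map (\<lambda>w. (w, 0)) l1)) \<noteq> 0" "cval (cluster bas k r M m) (map ?g (map (\<lambda>w. (w, 0)) l2)) \<noteq> 0"
        by (auto simp: cval_pull comp_def)
      moreover have "good ((\<lambda>w. (w, 0)) ` set l)" using d4(1) by (auto simp: good_def)
      ultimately show ?thesis
        by (intro exI[of _ "(\<lambda>w. (w, 0)) ` set l"] exI[of _ "map (\<lambda>w. (w, 0)) l1"] exI[of _ "map (\<lambda>w. (w, 0)) l2"]) auto
    next
      case False
      from sum_nonzero_bit[OF this[unfolded path_int_def cval_sum]] obtain n where n: "n < M"
        and "cval (prism (\<lambda>w. (w, real n / real M)) (\<lambda>w. (w, real (Suc n) / real M))
            (pull ?f (cluster bas k r M m) * pull ?g (cluster bas k r M m))) l \<noteq> 0" by blast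
      from cval_prism_nonzero[OF this(2)] obtain l' where
        l': "set l' \<subseteq> (\<lambda>w. (w, real n / real M)) ` set l \<union> (\<lambda>w. (w, real (Suc n) / real M)) ` set l"
        "cval (pull ?f (cluster bas k r M m) * pull ?g (cluster bas k r M m)) l' \<noteq> 0" by blast
      from cval_mult_nonzero[OF l'(2)] obtain l1 l2 where "l1 \<noteq> []" "l2 \<noteq> []" "set l1 \<subseteq> set l'" "set l2 \<subseteq> set l'"
        "cval (cluster bas k r M m) (map ?f l1) \<noteq> 0" "cval (cluster bas k r M m) (map ?g l2) \<noteq> 0"
        by (auto simp: cval_pull)
      moreover have "good (set l')"
        unfolding good_def
      proof (intro ballI conjI)
        fix x assume x: "x \<in> set l'"
        show "fst x \<in> set l" "0 \<le> snd x" "snd x \<le> 1" using x l'(1) n M(2) by (auto simp: field_simps)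
        fix x' assume x': "x' \<in> set l'"
        have "snd y = real n / real M \<or> snd y = real n / real M + 1 / real M" if "y \<in> set l'" for y
        proof -
          have "y \<in> (\<lambda>w. (w, real n / real M)) ` set l \<union> (\<lambda>w. (w, real (Suc n) / real M)) ` set l"
            using that l'(1) by blast
          then show ?thesis by (auto simp: add_divide_distrib)
        qed
        from this[OF x] this[OF x'] have "\<bar>snd x - snd x'\<bar> \<le> 1 / real M" by auto
        then have s: "\<bar>4 * snd x - 4 * snd x'\<bar> \<le> 4 / real M" by linarith
        have "dist (half_turn (snd x)) (half_turn (snd x')) \<le> \<bar>min 1 (3 - 4 * snd x) - min 1 (3 - 4 * snd x')\<bar> + \<bar>min 1 (4 * snd x - 1) - min 1 (4 * snd x' - 1)\<bar>"
          unfolding half_turn_def by (rule order_trans[OF dist_Pair_le]) (simp add: dist_real_def)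
        also have "\<dots> \<le> 4 / real M + 4 / real M" using s by (intro add_mono) (auto simp: min_def)
        also have "\<dots> = 8 / real M" by (simp add: add_divide_distrib[symmetric])
        finally show "dist (half_turn (snd x)) (half_turn (snd x')) \<le> \<delta>4" using M8 by simp
      qed
      ultimately show ?thesis by blast
    qed
    then obtain X l1 l2 where X: "good X" and l1: "l1 \<noteq> []" "set l1 \<subseteq> X" "cval (cluster bas k r M m) (map ?f l1) \<noteq> 0"
      and l2: "l2 \<noteq> []" "set l2 \<subseteq> X" "cval (cluster bas k r M m) (map ?g l2) \<noteq> 0" by blast
    have tame_sub: "tame r B1 \<delta>3 Y"
      if "\<And>y. y \<in> Y \<Longrightarrow> \<exists>w d. w \<in> set l \<and> d \<in> C \<and> y = (fst w, sub_shape m (snd w) d)"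
        "C \<subseteq> sup_circle" "\<And>c c'. c \<in> C \<Longrightarrow> c' \<in> C \<Longrightarrow> dist c c' \<le> \<delta>4" for Y C
      unfolding tame_def
    proof (intro conjI ballI)
      fix y assume y: "y \<in> Y"
      from that(1)[OF y] obtain w d where w: "w \<in> set l" "d \<in> C" "y = (fst w, sub_shape m (snd w) d)" by blast
      then show "norm (snd y) \<le> B1" "\<forall>i<r. \<forall>j. \<bar>fst (fst y) i j\<bar> \<le> 1"
        using t that(2) by (auto simp: tame_def intro!: B1)
      fix y' assume y': "y' \<in> Y"
      from that(1)[OF y'] obtain w' d' where w': "w' \<in> set l" "d' \<in> C" "y' = (fst w', sub_shape m (snd w') d')" by blast
      have "dist (sub_shape m (snd w) d) (sub_shape m (snd w') d') \<le> \<delta>3"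
        by (rule d4(2)) (use t w w' that in \<open>auto simp: tame_def\<close>)
      then show "dist (snd y) (snd y') \<le> \<delta>3" by (simp add: w w')
      show "\<forall>i<r. \<forall>j. \<bar>fst (fst y) i j - fst (fst y') i j\<bar> \<le> \<delta>3" using t w w' by (auto simp: tame_def)
    qed
    have circ: "half_turn ` snd ` X \<subseteq> sup_circle" "uminus ` half_turn ` snd ` X \<subseteq> sup_circle"
      using X by (auto simp: good_def intro!: half_turn_circle sup_circle_uminus)
    have distX: "dist c c' \<le> \<delta>4" if "c \<in> half_turn ` snd ` X" "c' \<in> half_turn ` snd ` X" for c c'
      using X that by (auto simp: good_def)
    have distX': "dist c c' \<le> \<delta>4" if "c \<in> uminus ` half_turn ` snd ` X" "c' \<in> uminus ` half_turn ` snd ` X" for c c'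
    proof -
      from that obtain e e' where "c = - e" "c' = - e'" "e \<in> half_turn ` snd ` X" "e' \<in> half_turn ` snd ` X" by blast
      then show ?thesis using distX by (simp only: dist_minus)
    qed
    \<comment> \<open>One vertex fixes the direction at the root; the parameters of all the others
      give nearly the same direction.\<close>
    define d where "d = half_turn (snd (hd l1))"
    have dX: "d \<in> half_turn ` snd ` X" "- d \<in> uminus ` half_turn ` snd ` X"
    proof -
      have "hd l1 \<in> X" using l1 hd_in_set by blast
      then show "d \<in> half_turn ` snd ` X" unfolding d_def by blast
      then show "- d \<in> uminus ` half_turn ` snd ` X" by blast
    qed
    have wX: "fst x \<in> set l" if "x \<in> X" for x using X that by (auto simp: good_def)
    have t1: "tame r B1 \<delta>3 (set (map ?f l1))"
    proof (rule tame_sub[OF _ circ(1) distX])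
      fix y assume "y \<in> set (map ?f l1)"
      then obtain x where x: "x \<in> set l1" "y = ?f x" unfolding set_map by blast
      then have "x \<in> X" using l1(2) by blast
      then show "\<exists>w d. w \<in> set l \<and> d \<in> half_turn ` snd ` X \<and> y = (fst w, sub_shape m (snd w) d)"
        using x(2) wX by (intro exI[of _ "fst x"] exI[of _ "half_turn (snd x)"]) auto
    qed
    have t2: "tame r B1 \<delta>3 (set (map ?g l2))"
    proof (rule tame_sub[OF _ circ(2) distX'])
      fix y assume "y \<in> set (map ?g l2)"
      then obtain x where x: "x \<in> set l2" "y = ?g x" unfolding set_map by blast
      then have "x \<in> X" using l2(2) by blast
      then show "\<exists>w d. w \<in> set l \<and> d \<in> uminus ` half_turn ` snd ` X \<and> y = (fst w, sub_shape m (snd w) d)"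
        using x(2) wX by (intro exI[of _ "fst x"] exI[of _ "- half_turn (snd x)"]) auto
    qed
    obtain D1 where D1: "range D1 \<subseteq> sup_circle" "near_zero bas k r (\<epsilon> / 2) m D1 (set (map ?f l1))"
      using d1(2)[OF M1 M(2) tame_mono[OF t1] l1(3)] by (auto simp: \<delta>3_def)
    obtain D2 where D2: "range D2 \<subseteq> sup_circle" "near_zero bas k r (\<epsilon> / 2) m D2 (set (map ?g l2))"
      using d1(2)[OF M1 M(2) tame_mono[OF t2] l2(3)] by (auto simp: \<delta>3_def)
    define D where "D p = (case p of [] \<Rightarrow> d | b # p' \<Rightarrow> if b then D1 p' else D2 p')" for p
    have D: "range D \<subseteq> sup_circle"
    proof (rule image_subsetI)
      fix p
      have "d \<in> sup_circle" using dX(1) circ(1) by blast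
      moreover have "D1 p' \<in> sup_circle" "D2 p' \<in> sup_circle" for p' using D1(1) D2(1) by blast+
      ultimately show "D p \<in> sup_circle" by (simp add: D_def split: list.splits)
    qed
    have final: "\<bar>chord_val bas k (fst w) i (leaf bs D' (sub_shape m (snd w) c))\<bar> \<le> \<epsilon>"
      if "w \<in> set l" "w' \<in> set l" "length bs = m" "i < r" "range D' \<subseteq> sup_circle" "C \<subseteq> sup_circle"
        "\<And>c c'. c \<in> C \<Longrightarrow> c' \<in> C \<Longrightarrow> dist c c' \<le> \<delta>4" "c \<in> C" "c' \<in> C"
        "\<bar>chord_val bas k (fst w') i (leaf bs D' (sub_shape m (snd w') c'))\<bar> \<le> \<epsilon> / 2" for w w' bs i D' C c c'
    proof -
      have "tame r B1 \<delta>3 {(fst w, sub_shape m (snd w) c), (fst w', sub_shape m (snd w') c')}"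
        by (rule tame_sub[OF _ that(6,7)]) (use that(1,2,8,9) in blast)
      then have "tame r B1 \<delta>2 {(fst w, sub_shape m (snd w) c), (fst w', sub_shape m (snd w') c')}"
        by (rule tame_mono) (simp add: \<delta>3_def)
      from d2(2)[OF this that(5,3,4)] that(10) show ?thesis unfolding fst_conv snd_conv by linarith
    qed
    show "\<exists>D. range D \<subseteq> sup_circle \<and> near_zero bas k r \<epsilon> (Suc m) D (set l)"
    proof (intro exI[of _ D] conjI D)
      show "near_zero bas k r \<epsilon> (Suc m) D (set l)"
        unfolding near_zero_def
      proof (intro ballI allI impI)
        fix w :: "point \<times> shape" and bs :: "bool list" and i
        assume w: "w \<in> set l" and bs: "length bs = Suc m" and i: "i < r"
        obtain b bs' where b: "bs = b # bs'" "length bs' = m" using bs by (cases bs) auto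
        show "\<bar>chord_val bas k (fst w) i (leaf bs D (snd w))\<bar> \<le> \<epsilon>"
        proof (cases b)
          case True
          have h: "hd l1 \<in> X" "hd l1 \<in> set l1" using l1 hd_in_set by auto
          have "\<bar>chord_val bas k (fst (fst (hd l1))) i (leaf bs' D1 (sub_shape m (snd (fst (hd l1))) d))\<bar> \<le> \<epsilon> / 2"
            using D1(2) h(2) b(2) i by (force simp: near_zero_def d_def)
          from final[OF w wX[OF h(1)] b(2) i D1(1) circ(1) distX dX(1) dX(1) this]
          show ?thesis by (simp add: b True D_def)
        next
          case False
          have h: "hd l2 \<in> X" "hd l2 \<in> set l2" using l2 hd_in_set by auto
          have "\<bar>chord_val bas k (fst (fst (hd l2))) i (leaf bs' D2 (sub_shape m (snd (fst (hd l2))) (- half_turn (snd (hd l2)))))\<bar> \<le> \<epsilon> / 2"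
            using D2(2) h(2) b(2) i by (force simp: near_zero_def)
          from final[OF w wX[OF h(1)] b(2) i D2(1) circ(2) distX' dX(2) _ this] h(1)
          show ?thesis by (simp add: b False D_def)
        qed
      qed
    qed
  qed
qed

end

section \<open>Existence of solutions\<close>

lemma common_convergent_subsequence:
  fixes X :: "nat \<Rightarrow> 'i \<Rightarrow> 'b::heine_borel"
  assumes "finite I" "\<And>i. i \<in> I \<Longrightarrow> bounded (range (\<lambda>n. X n i))"
  shows "\<exists>\<phi> l. strict_mono \<phi> \<and> (\<forall>i\<in>I. (\<lambda>n. X (\<phi> n) i) \<longlonglongrightarrow> l i)"
  using assms
proof (induction I rule: finite_induct)
  case empty
  show ?case by (intro exI[of _ id]) (auto simp: strict_mono_def)
next
  case (insert a I)
  then obtain \<phi> l where \<phi>: "strict_mono \<phi>" "\<And>i. i \<in> I \<Longrightarrow> (\<lambda>n. X (\<phi> n) i) \<longlonglongrightarrow> l i" by blast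
  have "bounded (range (\<lambda>n. X (\<phi> n) a))"
    by (rule bounded_subset[OF insert.prems[of a]]) auto
  from bounded_imp_convergent_subsequence[OF this] obtain c \<psi> where
    \<psi>: "strict_mono \<psi>" "((\<lambda>n. X (\<phi> n) a) \<circ> \<psi>) \<longlonglongrightarrow> c" by blast
  have "(\<lambda>n. X ((\<phi> \<circ> \<psi>) n) i) \<longlonglongrightarrow> (l(a := c)) i" if "i \<in> insert a I" for i
  proof (cases "i = a")
    case True
    then show ?thesis using \<psi>(2) by (simp add: comp_def)
  next
    case False
    then show ?thesis using LIMSEQ_subseq_LIMSEQ[OF \<phi>(2) \<psi>(1), of i] that by (simp add: comp_def)
  qed
  moreover have "strict_mono (\<phi> \<circ> \<psi>)" using \<phi>(1) \<psi>(1) by (rule strict_mono_o)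
  ultimately show ?case by blast
qed

lemma leaf_tendsto:
  assumes "\<And>p. length p < length bs \<Longrightarrow> (\<lambda>n. D n p) \<longlonglongrightarrow> D' p" "q \<longlonglongrightarrow> q'"
  shows "(\<lambda>n. leaf bs (D n) (q n)) \<longlonglongrightarrow> leaf bs D' q'"
  using assms
proof (induction bs arbitrary: D D' q q')
  case Nil
  then show ?case by (auto intro!: tendsto_intros)
next
  case (Cons b bs)
  have D: "(\<lambda>n. if b then D n [] else - D n []) \<longlonglongrightarrow> (if b then D' [] else - D' [])"
    using Cons.prems(1)[of "[]"] by (cases b) (auto intro: tendsto_minus)
  have q: "(\<lambda>n. sub_shape m (q n) (d n)) \<longlonglongrightarrow> sub_shape m q' d'" if "d \<longlonglongrightarrow> d'" for m d d'
    unfolding sub_shape_def using Cons.prems(2) that by (intro tendsto_intros)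
  show ?case unfolding leaf.simps
    by (rule Cons.IH[OF _ q[OF D]]) (use Cons.prems(1) in simp)
qed

text \<open>Expansion of a product of sums of words. Later factors come first in the list, in
  accordance with \<open>word\<close>.\<close>

primrec word_prod :: "'i list list list \<Rightarrow> 'i list list" where
  "word_prod [] = [[]]"
| "word_prod (ws # Ws) = concat (map (\<lambda>w. map (\<lambda>v. v @ w) (word_prod Ws)) ws)"

lemma words_word_prod: "words u (word_prod Ws) = prod_list (map (words u) Ws)"
proof (induction Ws)
  case (Cons ws Ws)
  have "words u (map (\<lambda>v. v @ w) vs) = word u w * words u vs" for w vs
    by (induction vs) (simp_all add: words_def word_append algebra_simps)
  then have "words u (concat (map (\<lambda>w. map (\<lambda>v. v @ w) vs) ws)) = words u ws * words u vs" for vs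
    by (induction ws) (simp_all add: words_def algebra_simps)
  then show ?case using Cons by simp
qed (simp add: words_def)

lemma cval_prod_list_nonzero:
  "cval (prod_list as) l \<noteq> 0 \<Longrightarrow> a \<in> set as \<Longrightarrow> \<exists>l'. set l' \<subseteq> set l \<and> cval a l' \<noteq> 0"
proof (induction as arbitrary: l)
  case (Cons b as)
  from cval_mult_nonzero[of b "prod_list as" l] Cons.prems(1) obtain l1 l2 where
    l: "set l1 \<subseteq> set l" "set l2 \<subseteq> set l" "cval b l1 \<noteq> 0" "cval (prod_list as) l2 \<noteq> 0" by auto
  show ?case
  proof (cases "a = b")
    case True then show ?thesis using l by blast
  next
    case False
    then obtain l' where "set l' \<subseteq> set l2" "cval a l' \<noteq> 0" using Cons.IH[OF l(4)] Cons.prems(2) by auto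
    then show ?thesis using l(2) by blast
  qed
qed simp

lemma cohomologous_prod_list:
  assumes "\<And>x. x \<in> set xs \<Longrightarrow> cohomologous T (f x) (g x)" "\<And>x. x \<in> set xs \<Longrightarrow> cocycle T (f x)"
    "\<And>x. x \<in> set xs \<Longrightarrow> cocycle T (g x)"
  shows "cohomologous T (prod_list (map f xs)) (prod_list (map g xs)) \<and> cocycle T (prod_list (map g xs))"
  using assms by (induction xs) (auto intro!: cohomologous_mult cocycle_mult)

definition row_inner :: "nat \<Rightarrow> point \<Rightarrow> nat \<Rightarrow> nat \<Rightarrow> real" where
  "row_inner N p i l = (\<Sum>j<N. fst p i j * fst p l j)"

text \<open>The inner product changes sign under the flips of exactly these two rows, so the
  tie-break has to be the sum of both signs.\<close>

definition orth :: "nat \<Rightarrow> nat \<times> nat \<Rightarrow> point cochain" where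
  "orth N il = cob (vertex (\<lambda>p. sign_bit (row_inner N p (fst il) (snd il)) (snd p (fst il) + snd p (snd il))))"

definition pairs :: "nat \<Rightarrow> (nat \<times> nat) list" where
  "pairs r = concat (map (\<lambda>l. map (\<lambda>i. (i, l)) [0..<l]) [0..<r])"

lemma set_pairs: "set (pairs r) = {(i, l). i < l \<and> l < r}"
  by (auto simp: pairs_def)

lemma row_inner_flip:
  "i \<noteq> l \<Longrightarrow> row_inner N (flip x p) i l = (if x = i \<or> x = l then - row_inner N p i l else row_inner N p i l)"
  by (auto simp: row_inner_def flip_def sum_negf)

lemma orth_class:
  assumes "i \<noteq> l"
  shows "cocycle flip (orth N (i, l))" "cohomologous flip (orth N (i, l)) (words sign_letter [[i], [l]])"
proof -
  let ?v = "vertex (\<lambda>p. sign_bit (row_inner N p i l) (snd p i + snd p l))"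
  let ?t = "vertex (\<lambda>p :: point. snd p i + snd p l)"
  have t: "pull (flip x) ?t = ?t + (if x = i \<or> x = l then 1 else 0)" for x
    using assms by (auto simp: vertex_add pull_add pull_flip_sign ac_simps)
  have v: "pull (flip x) ?v = ?v + (if x = i \<or> x = l then 1 else 0)" for x
  proof (cases "x = i \<or> x = l")
    case True
    have "snd (flip x p) i + snd (flip x p) l = snd p i + snd p l + 1" for p
      using True assms by (auto simp: flip_def ac_simps)
    then have "sign_bit (row_inner N (flip x p) i l) (snd (flip x p) i + snd (flip x p) l) =
        sign_bit (row_inner N p i l) (snd p i + snd p l) + 1" for p
      using True sign_bit_uminus[of "row_inner N p i l" "snd p i + snd p l"] by (simp add: row_inner_flip[OF assms])
    then show ?thesis using True by (simp add: pull_vertex vertex_add vertex_1)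
  next
    case False
    then have "(\<lambda>p. sign_bit (row_inner N (flip x p) i l) (snd (flip x p) i + snd (flip x p) l)) =
        (\<lambda>p. sign_bit (row_inner N p i l) (snd p i + snd p l))"
      by (auto simp: row_inner_flip[OF assms]) (auto simp: flip_def)
    then show ?thesis using False by (simp add: pull_vertex)
  qed
  show "cocycle flip (orth N (i, l))"
    unfolding cocycle_def invariant_def orth_def fst_conv snd_conv pull_cob v by (simp add: cob_add cob_cob)
  have "invariant flip (?v + ?t)"
    unfolding invariant_def pull_add t v by (auto simp: ac_simps)
  moreover have "orth N (i, l) + words sign_letter [[i], [l]] = cob (?v + ?t)"
    by (simp add: orth_def words_def sign_letter_def cob_add vertex_add)
  ultimately show "cohomologous flip (orth N (i, l)) (words sign_letter [[i], [l]])"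
    unfolding cohomologous_def by blast
qed

lemma set_sq_word: "v \<in> set (sq_word w) \<Longrightarrow> set v \<subseteq> set w"
proof (induction w arbitrary: v)
  case (Cons i w)
  then consider "v = i # w @ w" | u where "u \<in> set (sq_word w)" "v = i # i # u" by auto
  then show ?case
  proof cases
    case 2
    then show ?thesis using Cons.IH[of u] by auto
  qed auto
qed simp

lemma set_cluster_words: "w \<in> set (cluster_words r m) \<Longrightarrow> set w \<subseteq> {..<r}"
proof (induction m arbitrary: w)
  case (Suc m)
  then show ?case using set_sq_word by fastforce
qed auto

lemma set_word_prod:
  "w \<in> set (word_prod Ws) \<Longrightarrow> (\<And>ws v. ws \<in> set Ws \<Longrightarrow> v \<in> set ws \<Longrightarrow> set v \<subseteq> A) \<Longrightarrow> set w \<subseteq> A"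
proof (induction Ws arbitrary: w)
  case (Cons ws Ws)
  from Cons.prems(1) obtain v u where "v \<in> set ws" "u \<in> set (word_prod Ws)" "w = u @ v" by auto
  then show ?case using Cons.IH[of u] Cons.prems(2) by auto
qed simp

lemma fund_words:
  assumes "M > 0" "(\<Sum>i<r. k i) = m" "\<And>w. w \<in> set ws \<Longrightarrow> set w \<subseteq> {..<r}"
  shows "fund r M m k (words sign_letter ws) = (\<Sum>w\<leftarrow>ws. of_bool (\<forall>i<r. count_list w i = k i))"
  using assms(3) by (induction ws) (simp_all add: words_Nil words_Cons fund_add fund_word[OF assms(1,2)])

section \<open>The obstruction and its zeros\<close>

definition system_words :: "nat \<Rightarrow> nat list \<Rightarrow> nat list list list" where
  "system_words r ms = map (cluster_words r) ms @ map (\<lambda>il. [[fst il], [snd il]]) (pairs r)"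

context
  fixes bas :: "nat \<Rightarrow> real \<Rightarrow> real" and k :: "nat \<Rightarrow> nat" and r N :: nat and ms :: "nat list" and Q :: "nat \<Rightarrow> shape"
  assumes bas: "\<And>j. continuous_on UNIV (bas j)"
    and k: "\<And>i. i < r \<Longrightarrow> k i < N"
    and parity: "(\<Sum>w\<leftarrow>word_prod (system_words r ms). of_bool (\<forall>i<r. count_list w i = k i)) = (1 :: bit)"
begin

text \<open>Different factors of the obstruction see different parts of one simplex; this carries
  their conclusions to all of its vertices, and so to a common one.\<close>

lemma cluster_support_superset:
  assumes "\<epsilon> > 0"
  shows "\<exists>\<delta>>0. \<exists>M0. \<forall>M\<ge>M0. M > 0 \<longrightarrow> (\<forall>l X. tame r B \<delta> X \<longrightarrow> set l \<subseteq> X \<longrightarrow> cval (cluster bas k r M m) l \<noteq> 0 \<longrightarrow>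
     (\<exists>D. range D \<subseteq> sup_circle \<and> near_zero bas k r \<epsilon> m D X))"
proof -
  have e: "\<epsilon> / 2 > 0" using assms by simp
  obtain \<delta>1 M0 where 1: "\<delta>1 > 0" "\<And>M l. M \<ge> M0 \<Longrightarrow> M > 0 \<Longrightarrow> tame r B \<delta>1 (set l) \<Longrightarrow> cval (cluster bas k r M m) l \<noteq> 0 \<Longrightarrow>
     \<exists>D. range D \<subseteq> sup_circle \<and> near_zero bas k r (\<epsilon> / 2) m D (set l)"
    using cluster_support[where bas=bas and r=r and B=B and m=m and k=k, OF bas e] by blast
  obtain \<delta>2 where 2: "\<delta>2 > 0" "\<And>w w' D bs i. tame r B \<delta>2 {w, w'} \<Longrightarrow> range D \<subseteq> sup_circle \<Longrightarrow> length bs = m \<Longrightarrow> i < r \<Longrightarrow>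
    \<bar>chord_val bas k (fst w) i (leaf bs D (snd w)) - chord_val bas k (fst w') i (leaf bs D (snd w'))\<bar> \<le> \<epsilon> / 2"
    using chord_val_uniform[where bas=bas and r=r and B=B and m=m and k=k, OF bas e] by blast
  show ?thesis
  proof (intro exI[of _ "min \<delta>1 \<delta>2"] conjI exI[of _ M0] allI impI)
    show "0 < min \<delta>1 \<delta>2" using 1(1) 2(1) by simp
    fix M l X assume M: "M \<ge> M0" "M > 0" and t: "tame r B (min \<delta>1 \<delta>2) X" and l: "set l \<subseteq> X" and nz: "cval (cluster bas k r M m) l \<noteq> 0"
    have "tame r B \<delta>1 (set l)" by (rule tame_mono[OF tame_subset[OF t l]]) simp
    from 1(2)[OF M this nz] obtain D where D: "range D \<subseteq> sup_circle" "near_zero bas k r (\<epsilon> / 2) m D (set l)" by blast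
    have "l \<noteq> []" using nz by auto
    then have h: "hd l \<in> set l" by simp
    have "near_zero bas k r \<epsilon> m D X"
      unfolding near_zero_def
    proof (intro ballI allI impI)
      fix w :: "point \<times> shape" and bs :: "bool list" and i assume w: "w \<in> X" and bs: "length bs = m" and i: "i < r"
      have "tame r B \<delta>2 {w, hd l}" by (rule tame_mono[OF tame_subset[OF t]]) (use w h l in auto)
      from 2(2)[OF this D(1) bs i]
      have "\<bar>chord_val bas k (fst w) i (leaf bs D (snd w)) - chord_val bas k (fst (hd l)) i (leaf bs D (snd (hd l)))\<bar> \<le> \<epsilon> / 2" .
      moreover have "\<bar>chord_val bas k (fst (hd l)) i (leaf bs D (snd (hd l)))\<bar> \<le> \<epsilon> / 2"
        using D(2) h bs i by (auto simp: near_zero_def)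
      ultimately show "\<bar>chord_val bas k (fst w) i (leaf bs D (snd w))\<bar> \<le> \<epsilon>" by linarith
    qed
    then show "\<exists>D. range D \<subseteq> sup_circle \<and> near_zero bas k r \<epsilon> m D X" using D(1) by blast
  qed
qed

definition theta :: "nat \<Rightarrow> point cochain" where
  "theta M = prod_list (map (\<lambda>c. pull (\<lambda>p. (p, Q c)) (cluster bas k r M (ms ! c))) [0..<length ms] @ map (orth N) (pairs r))"

text \<open>The evaluation depends only on the class, so every condition may be replaced by its
  words in the signs; the assumed parity is then the value.\<close>

lemma fund_theta:
  assumes M: "M > 0"
  shows "fund r M (\<Sum>i<r. k i) k (theta M) = 1"
proof -
  let ?f = "\<lambda>x. case x of Inl il \<Rightarrow> orth N il | Inr c \<Rightarrow> pull (\<lambda>p. (p, Q c)) (cluster bas k r M (ms ! c))"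
  let ?g = "\<lambda>x. case x of Inl il \<Rightarrow> words sign_letter [[fst il], [snd il]] | Inr c \<Rightarrow> words sign_letter (cluster_words r (ms ! c))"
  let ?xs = "map Inr [0..<length ms] @ map Inl (pairs r)"
  have c: "cohomologous flip (pull (\<lambda>p. (p, Q c)) (cluster bas k r M m)) (words sign_letter (cluster_words r m))"
    "cocycle flip (pull (\<lambda>p. (p, Q c)) (cluster bas k r M m))" for c m
  proof -
    have "cohomologous flip (pull (\<lambda>p. (p, Q c)) (cluster bas k r M m))
       (pull (\<lambda>p. (p, Q c)) (pull fst (words sign_letter (cluster_words r m))))"
      by (rule cohomologous_pull[OF cluster_class(2)[OF M]]) (simp add: flip_fst_def)
    then show "cohomologous flip (pull (\<lambda>p. (p, Q c)) (cluster bas k r M m)) (words sign_letter (cluster_words r m))"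
      by (simp add: pull_pull comp_def pull_id)
    show "cocycle flip (pull (\<lambda>p. (p, Q c)) (cluster bas k r M m))"
      by (rule cocycle_pull[OF cluster_class(1)[OF M]]) (simp add: flip_fst_def)
  qed
  have "cohomologous flip (prod_list (map ?f ?xs)) (prod_list (map ?g ?xs))"
    by (rule cohomologous_prod_list[THEN conjunct1])
      (auto simp: set_pairs c cocycle_words_sign split: sum.splits intro: orth_class)
  moreover have "prod_list (map ?f ?xs) = theta M" by (simp add: theta_def comp_def)
  moreover have "prod_list (map ?g ?xs) = words sign_letter (word_prod (system_words r ms))"
  proof -
    have "map (\<lambda>c. words sign_letter (cluster_words r (ms ! c))) [0..<length ms] = map (\<lambda>m. words sign_letter (cluster_words r m)) ms"
      by (rule nth_equalityI) auto
    then show ?thesis unfolding words_word_prod by (simp add: system_words_def comp_def)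
  qed
  ultimately have "fund r M (\<Sum>i<r. k i) k (theta M) = fund r M (\<Sum>i<r. k i) k (words sign_letter (word_prod (system_words r ms)))"
    using fund_cohomologous[OF M] by metis
  also have "\<dots> = 1" unfolding parity[symmetric]
  proof (rule fund_words[OF M refl])
    fix w assume "w \<in> set (word_prod (system_words r ms))"
    then show "set w \<subseteq> {..<r}"
      by (rule set_word_prod) (auto simp: system_words_def set_pairs dest!: set_cluster_words)
  qed
  finally show ?thesis .
qed

text \<open>Any vertex of a small simplex with nonzero obstruction solves all conditions
  approximately; the head is taken.\<close>

lemma approximate_solution:
  assumes "\<epsilon> > 0"
  shows "\<exists>p Ds. hemi r k (fst p) \<and> (\<forall>i l. i < l \<longrightarrow> l < r \<longrightarrow> \<bar>row_inner N p i l\<bar> \<le> \<epsilon>) \<and>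
    (\<forall>c<length ms. range (Ds c) \<subseteq> sup_circle \<and> near_zero bas k r \<epsilon> (ms ! c) (Ds c) {(p, Q c)})"
proof -
  define B where "B = (\<Sum>c<length ms. norm (Q c))"
  have B: "norm (Q c) \<le> B" if "c < length ms" for c
    unfolding B_def using that by (intro member_le_sum) auto
  have "\<forall>c. \<exists>\<delta> M0. \<delta> > 0 \<and> (\<forall>M\<ge>M0. M > 0 \<longrightarrow> (\<forall>l X. tame r B \<delta> X \<longrightarrow> set l \<subseteq> X \<longrightarrow> cval (cluster bas k r M (ms ! c)) l \<noteq> 0 \<longrightarrow>
     (\<exists>D. range D \<subseteq> sup_circle \<and> near_zero bas k r \<epsilon> (ms ! c) D X)))"
    using cluster_support_superset[OF assms] by meson
  then obtain \<delta> M0 where \<delta>: "\<And>c. \<delta> c > 0" "\<And>c M l X. M \<ge> M0 c \<Longrightarrow> M > 0 \<Longrightarrow> tame r B (\<delta> c) X \<Longrightarrow> set l \<subseteq> X \<Longrightarrow>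
      cval (cluster bas k r M (ms ! c)) l \<noteq> 0 \<Longrightarrow> \<exists>D. range D \<subseteq> sup_circle \<and> near_zero bas k r \<epsilon> (ms ! c) D X"
    by metis
  \<comment> \<open>An inner product of rows varies by at most \<open>2 * N * \<epsilon>'\<close> on
    the simplex, and this bound is used twice; the summand 1 keeps the denominator positive for
    \<open>N = 0\<close>.\<close>
  define \<epsilon>' where "\<epsilon>' = Min (insert (\<epsilon> / (4 * real N + 1)) (\<delta> ` {..<length ms}))"
  have e': "\<epsilon>' > 0" "\<epsilon>' \<le> \<epsilon> / (4 * real N + 1)" "\<And>c. c < length ms \<Longrightarrow> \<epsilon>' \<le> \<delta> c"
    using assms \<delta>(1) by (auto simp: \<epsilon>'_def Min_gr_iff)
  define m where "m = (\<Sum>i<r. k i)"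
  define M where "M = Suc (max (\<Sum>c<length ms. M0 c) (nat \<lceil>2 * real m / \<epsilon>'\<rceil>))"
  have M: "M > 0" by (simp add: M_def)
  have MM0: "M0 c \<le> M" if "c < length ms" for c
  proof -
    have "M0 c \<le> (\<Sum>c<length ms. M0 c)" using that by (intro member_le_sum) auto
    then show ?thesis by (simp add: M_def)
  qed
  have "2 * real m / \<epsilon>' \<le> real M" by (simp add: M_def) linarith
  then have small: "2 * real m / real M \<le> \<epsilon>'" using M e'(1) by (simp add: field_simps)
  have "fund r M m k (theta M) \<noteq> 0" using fund_theta[OF M] by (simp add: m_def)
  from fund_nonzero[OF M _ this] obtain l where l: "cval (theta M) l \<noteq> 0" "\<And>p. p \<in> set l \<Longrightarrow> hemi r k (fst p)"
    "close r (2 * real m / real M) l" by (auto simp: m_def)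
  have cl: "\<bar>fst p i j - fst p' i j\<bar> \<le> \<epsilon>'" if "p \<in> set l" "p' \<in> set l" "i < r" for p p' i j
    using l(3) that small unfolding close_def by (meson order_trans)
  have "l \<noteq> []" using l(1) by auto
  then have h: "hd l \<in> set l" by simp
  have inner: "\<bar>row_inner N (hd l) i i'\<bar> \<le> \<epsilon>" if ii: "i < i'" "i' < r" for i i'
  proof -
    obtain l' where l': "set l' \<subseteq> set l" "cval (orth N (i, i')) l' \<noteq> 0"
      using cval_prod_list_nonzero[OF l(1)[unfolded theta_def], of "orth N (i, i')"] ii by (auto simp: set_pairs)
    define a b where "a = l' ! 0" and "b = l' ! 1"
    have len: "length l' = 2" and ab: "sign_bit (row_inner N a i i') (snd a i + snd a i') + sign_bit (row_inner N b i i') (snd b i + snd b i') \<noteq> 0"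
      using l'(2) unfolding orth_def cval_cob_vertex a_def b_def by (auto split: if_splits)
    have abl: "a \<in> set l" "b \<in> set l" using l'(1) len by (auto simp: a_def b_def)
    have d: "\<bar>row_inner N p i i' - row_inner N p' i i'\<bar> \<le> real N * (2 * \<epsilon>')" if "p \<in> set l" "p' \<in> set l" for p p'
    proof -
      have "\<bar>fst p i j * fst p i' j - fst p' i j * fst p' i' j\<bar> \<le> 2 * \<epsilon>'" for j
      proof -
        have "fst p i j * fst p i' j - fst p' i j * fst p' i' j = (fst p i j - fst p' i j) * fst p i' j + fst p' i j * (fst p i' j - fst p' i' j)"
          by (simp add: algebra_simps)
        also have "\<bar>\<dots>\<bar> \<le> \<bar>fst p i j - fst p' i j\<bar> * \<bar>fst p i' j\<bar> + \<bar>fst p' i j\<bar> * \<bar>fst p i' j - fst p' i' j\<bar>"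
          by (rule order_trans[OF abs_triangle_ineq]) (simp add: abs_mult)
        also have "\<dots> \<le> \<epsilon>' * 1 + 1 * \<epsilon>'"
          using that ii e'(1) by (intro add_mono mult_mono cl hemi_bound[OF l(2)]) auto
        finally show ?thesis by simp
      qed
      then have "\<bar>\<Sum>j<N. fst p i j * fst p i' j - fst p' i j * fst p' i' j\<bar> \<le> (\<Sum>j<N. 2 * \<epsilon>')"
        by (intro order_trans[OF sum_abs] sum_mono) simp
      then show ?thesis by (simp add: row_inner_def sum_subtractf)
    qed
    have "\<bar>row_inner N a i i'\<bar> \<le> real N * (2 * \<epsilon>')" using sign_bit_neq[OF ab] d[OF abl] by linarith
    then have "\<bar>row_inner N (hd l) i i'\<bar> \<le> 2 * (real N * (2 * \<epsilon>'))" using d[OF h abl(1)] by linarith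
    then have "\<bar>row_inner N (hd l) i i'\<bar> \<le> (4 * real N) * \<epsilon>'" by simp
    also have "\<dots> \<le> (4 * real N + 1) * \<epsilon>'" using e'(1) by (intro mult_right_mono) auto
    also have "\<dots> \<le> \<epsilon>" using e'(2) by (simp add: field_simps)
    finally show ?thesis .
  qed
  have "\<exists>D. range D \<subseteq> sup_circle \<and> near_zero bas k r \<epsilon> (ms ! c) D {(hd l, Q c)}" if c: "c < length ms" for c
  proof -
    have "pull (\<lambda>p. (p, Q c)) (cluster bas k r M (ms ! c)) \<in> set (map (\<lambda>c. pull (\<lambda>p. (p, Q c)) (cluster bas k r M (ms ! c))) [0..<length ms] @ map (orth N) (pairs r))"
      using c by auto
    from cval_prod_list_nonzero[OF l(1)[unfolded theta_def] this] obtain l' where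
      l': "set l' \<subseteq> set l" "cval (cluster bas k r M (ms ! c)) (map (\<lambda>p. (p, Q c)) l') \<noteq> 0" by (auto simp: cval_pull)
    have "tame r B (\<delta> c) ((\<lambda>p. (p, Q c)) ` set l)"
    proof -
      have "\<bar>fst p i j - fst p' i j\<bar> \<le> \<delta> c" if "p \<in> set l" "p' \<in> set l" "i < r" for p p' i j
        using cl[OF that, of j] e'(3)[OF c] by linarith
      then show ?thesis using B[OF c] \<delta>(1)[of c] hemi_bound[OF l(2)]
        unfolding tame_def ball_simps(9) by (auto simp: less_imp_le)
    qed
    from \<delta>(2)[OF MM0[OF c] M this _ l'(2)] l'(1) obtain D where
      "range D \<subseteq> sup_circle" "near_zero bas k r \<epsilon> (ms ! c) D ((\<lambda>p. (p, Q c)) ` set l)" by auto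
    then show ?thesis using h by (intro exI[of _ D]) (auto simp: near_zero_def)
  qed
  then obtain Ds where "\<forall>c<length ms. range (Ds c) \<subseteq> sup_circle \<and> near_zero bas k r \<epsilon> (ms ! c) (Ds c) {(hd l, Q c)}" by metis
  then show ?thesis using l(2)[OF h] inner by blast
qed

end

text \<open>Only finitely many coefficients and directions matter, and all of them are bounded, so
  approximate solutions have a convergent subsequence; its limit is exact by continuity.\<close>

lemma exact_solution:
  fixes bas :: "nat \<Rightarrow> real \<Rightarrow> real" and k :: "nat \<Rightarrow> nat" and r N :: nat and ms :: "nat list" and Q :: "nat \<Rightarrow> shape"
  assumes bas: "\<And>j. continuous_on UNIV (bas j)"
    and k: "\<And>i. i < r \<Longrightarrow> k i < N"
    and parity: "(\<Sum>w\<leftarrow>word_prod (system_words r ms). of_bool (\<forall>i<r. count_list w i = k i)) = (1 :: bit)"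
  shows "\<exists>y Ds. (\<forall>i<r. (\<Sum>j\<le>k i. \<bar>y i j\<bar>) = 1 \<and> (\<forall>j>k i. y i j = 0)) \<and>
     (\<forall>i l. i < l \<longrightarrow> l < r \<longrightarrow> (\<Sum>j<N. y i j * y l j) = 0) \<and>
     (\<forall>c<length ms. range (Ds c) \<subseteq> sup_circle \<and> (\<forall>bs. length bs = ms ! c \<longrightarrow> (\<forall>i<r.
        (\<Sum>j\<le>k i. y i j * bas j (fst (leaf bs (Ds c) (Q c)))) = (\<Sum>j\<le>k i. y i j * bas j (snd (leaf bs (Ds c) (Q c)))))))"
proof -
  have "\<forall>n. \<exists>p Ds. hemi r k (fst p) \<and> (\<forall>i l. i < l \<longrightarrow> l < r \<longrightarrow> \<bar>row_inner N p i l\<bar> \<le> 1 / real (Suc n)) \<and>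
    (\<forall>c<length ms. range (Ds c) \<subseteq> sup_circle \<and> near_zero bas k r (1 / real (Suc n)) (ms ! c) (Ds c) {(p, Q c)})"
    by (intro allI approximate_solution[OF bas k parity]) auto
  then obtain P DD where P: "\<And>n. hemi r k (fst (P n))" "\<And>n i l. i < l \<Longrightarrow> l < r \<Longrightarrow> \<bar>row_inner N (P n) i l\<bar> \<le> 1 / real (Suc n)"
    "\<And>n c. c < length ms \<Longrightarrow> range (DD n c) \<subseteq> sup_circle"
    "\<And>n c. c < length ms \<Longrightarrow> near_zero bas k r (1 / real (Suc n)) (ms ! c) (DD n c) {(P n, Q c)}" by metis
  define L where "L = (\<Sum>c<length ms. ms ! c)"
  have L: "ms ! c \<le> L" if "c < length ms" for c unfolding L_def using that by (intro member_le_sum) auto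
  define I :: "(nat \<times> nat + nat \<times> bool list) set" where
    "I = Inl ` ({..<r} \<times> {..<N}) \<union> Inr ` ({..<length ms} \<times> {bs. length bs \<le> L})"
  \<comment> \<open>Coefficients are paired with 0, so that they and the directions form a single
    family of points of the plane.\<close>
  define X where "X n v = (case v of Inl ij \<Rightarrow> (fst (P n) (fst ij) (snd ij), 0) | Inr cp \<Rightarrow> DD n (fst cp) (snd cp))" for n v
  have "finite {bs :: bool list. length bs \<le> L}" using finite_lists_length_le[of "UNIV :: bool set" L] by simp
  then have "finite I" unfolding I_def by simp
  moreover have "bounded (range (\<lambda>n. X n v))" if "v \<in> I" for v
  proof (cases v)
    case (Inl ij)
    have "norm (X n v) \<le> 1" for n
      using hemi_bound[OF P(1)] that by (auto simp: X_def Inl I_def)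
    then show ?thesis unfolding bounded_iff by blast
  next
    case (Inr cp)
    have "fst cp < length ms" using that by (auto simp: Inr I_def)
    from P(3)[OF this] have "X n v \<in> sup_circle" for n unfolding X_def Inr sum.case by blast
    then show ?thesis by (intro bounded_subset[OF compact_imp_bounded[OF compact_sup_circle]]) blast
  qed
  ultimately obtain \<phi> l where \<phi>: "strict_mono \<phi>" and lim: "\<And>v. v \<in> I \<Longrightarrow> (\<lambda>n. X (\<phi> n) v) \<longlonglongrightarrow> l v"
    using common_convergent_subsequence[of I X] by blast
  define y where "y i j = (if i < r \<and> j < N then fst (l (Inl (i, j))) else 0)" for i j
  \<comment> \<open>The default (1, 0) only has to lie on the square.\<close>
  define Ds where "Ds c p = (if c < length ms \<and> length p \<le> L then l (Inr (c, p)) else (1, 0))" for c p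
  have y: "(\<lambda>n. fst (P (\<phi> n)) i j) \<longlonglongrightarrow> y i j" if "i < r" for i j
  proof (cases "j < N")
    case True
    then have "Inl (i, j) \<in> I" using that by (auto simp: I_def)
    from tendsto_fst[OF lim[OF this]] show ?thesis using True that by (simp add: X_def y_def)
  next
    case False
    then have "fst (P n) i j = 0" for n using P(1)[of n] that k[OF that] by (auto simp: hemi_def)
    then show ?thesis using False by (simp add: y_def)
  qed
  have eps: "(\<lambda>n. 1 / real (Suc (\<phi> n))) \<longlonglongrightarrow> 0"
    using LIMSEQ_subseq_LIMSEQ[OF LIMSEQ_inverse_real_of_nat \<phi>] by (simp add: comp_def inverse_eq_divide)
  have zero: "a = 0" if "(\<lambda>n. f (\<phi> n)) \<longlonglongrightarrow> a" "\<And>n. \<bar>f n\<bar> \<le> 1 / real (Suc n)" for f and a :: real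
  proof -
    have "(\<lambda>n. f (\<phi> n)) \<longlonglongrightarrow> 0"
      by (rule Lim_null_comparison[OF _ eps]) (use that(2) in simp)
    then show ?thesis using that(1) LIMSEQ_unique by blast
  qed
  show ?thesis
  proof (intro exI[of _ y] exI[of _ Ds] conjI allI impI)
    fix i assume i: "i < r"
    have "(\<lambda>n. \<Sum>j\<le>k i. \<bar>fst (P (\<phi> n)) i j\<bar>) \<longlonglongrightarrow> (\<Sum>j\<le>k i. \<bar>y i j\<bar>)"
      by (intro tendsto_intros y i)
    moreover have "(\<Sum>j\<le>k i. \<bar>fst (P n) i j\<bar>) = 1" for n using P(1)[of n] i by (simp add: hemi_def)
    ultimately show "(\<Sum>j\<le>k i. \<bar>y i j\<bar>) = 1" by (simp add: LIMSEQ_const_iff)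
    fix j assume "k i < j"
    then have "fst (P n) i j = 0" for n using P(1)[of n] i by (simp add: hemi_def)
    then show "y i j = 0" using y[OF i, of j] by (simp add: LIMSEQ_const_iff)
  next
    fix i i' assume i: "i < i'" "i' < r"
    have "(\<lambda>n. row_inner N (P (\<phi> n)) i i') \<longlonglongrightarrow> (\<Sum>j<N. y i j * y i' j)"
      unfolding row_inner_def using i by (intro tendsto_intros y) auto
    from zero[OF this P(2)[OF i]] show "(\<Sum>j<N. y i j * y i' j) = 0" .
  next
    fix c assume c: "c < length ms"
    have D: "(\<lambda>n. DD (\<phi> n) c p) \<longlonglongrightarrow> Ds c p" if "length p \<le> L" for p
    proof -
      have "Inr (c, p) \<in> I" using c that by (auto simp: I_def)
      from lim[OF this] show ?thesis using c that by (simp add: X_def Ds_def)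
    qed
    show "range (Ds c) \<subseteq> sup_circle"
    proof (rule image_subsetI)
      fix p
      show "Ds c p \<in> sup_circle"
      proof (cases "length p \<le> L")
        case True
        show ?thesis
          by (rule closed_sequentially[OF compact_imp_closed[OF compact_sup_circle] _ D[OF True]]) (use P(3)[OF c] in blast)
      next
        case False
        then show ?thesis by (simp add: Ds_def sup_circle_def)
      qed
    qed
    fix bs :: "bool list" and i assume bs: "length bs = ms ! c" and i: "i < r"
    have z: "(\<lambda>n. leaf bs (DD (\<phi> n) c) (Q c)) \<longlonglongrightarrow> leaf bs (Ds c) (Q c)"
      by (rule leaf_tendsto[OF D]) (use L[OF c] bs in auto)
    have b: "(\<lambda>n. bas j (t n)) \<longlonglongrightarrow> bas j t'" if "t \<longlonglongrightarrow> t'" for j t t'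
      using bas[of j] that by (simp add: continuous_on_eq_continuous_at isCont_tendsto_compose)
    let ?z = "leaf bs (Ds c) (Q c)"
    have "(\<lambda>n. chord_val bas k (P (\<phi> n)) i (leaf bs (DD (\<phi> n) c) (Q c))) \<longlonglongrightarrow>
       (\<Sum>j\<le>k i. y i j * bas j (fst ?z)) - (\<Sum>j\<le>k i. y i j * bas j (snd ?z))"
      unfolding chord_val_def ev_def by (intro tendsto_intros y b i z)
    moreover have "\<bar>chord_val bas k (P n) i (leaf bs (DD n c) (Q c))\<bar> \<le> 1 / real (Suc n)" for n
      using P(4)[OF c, of n] bs i by (auto simp: near_zero_def)
    ultimately have "(\<Sum>j\<le>k i. y i j * bas j (fst ?z)) - (\<Sum>j\<le>k i. y i j * bas j (snd ?z)) = 0"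
      by (rule zero[where f = "\<lambda>n. chord_val bas k (P n) i (leaf bs (DD n c) (Q c))"])
    then show "(\<Sum>j\<le>k i. y i j * bas j (fst ?z)) = (\<Sum>j\<le>k i. y i j * bas j (snd ?z))" by simp
  qed
qed

section \<open>Clusters are forests\<close>

definition fst_mated :: "('a \<times> 'b) set \<Rightarrow> 'a \<times> 'b \<Rightarrow> bool" where
  "fst_mated S p \<longleftrightarrow> (\<exists>q\<in>S. q \<noteq> p \<and> fst q = fst p)"

definition snd_mated :: "('a \<times> 'b) set \<Rightarrow> 'a \<times> 'b \<Rightarrow> bool" where
  "snd_mated S p \<longleftrightarrow> (\<exists>q\<in>S. q \<noteq> p \<and> snd q = snd p)"

text \<open>Chords are the edges of a bipartite graph; a set of chords without a subset of minimal
  degree 2 is a forest.\<close>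

definition forest :: "('a \<times> 'b) set \<Rightarrow> bool" where
  "forest C \<longleftrightarrow> (\<forall>S\<subseteq>C. (\<forall>p\<in>S. fst_mated S p \<and> snd_mated S p) \<longrightarrow> S = {})"

text \<open>A robust cluster can be joined to a forest of extent at most \<open>\<delta>\<close>, whose chords cannot share
  second ends with both of the exceptional chords.\<close>

definition robust :: "real \<Rightarrow> (real \<times> real) set \<Rightarrow> bool" where
  "robust \<delta> C \<longleftrightarrow> (\<forall>S\<subseteq>C. S \<noteq> {} \<longrightarrow> (\<forall>p\<in>S. fst_mated S p) \<longrightarrow>
     (\<exists>p\<in>S. \<exists>q\<in>S. \<not> snd_mated S p \<and> \<not> snd_mated S q \<and> \<bar>snd p - snd q\<bar> > \<delta>))"

lemma forest_robust: "robust \<delta> C \<Longrightarrow> forest C"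
  unfolding forest_def robust_def by blast

lemma forest_swap: "forest (prod.swap ` C) \<Longrightarrow> forest C"
  unfolding forest_def
proof (intro allI impI)
  fix S assume h: "\<forall>S\<subseteq>prod.swap ` C. (\<forall>p\<in>S. fst_mated S p \<and> snd_mated S p) \<longrightarrow> S = {}"
    and S: "S \<subseteq> C" "\<forall>p\<in>S. fst_mated S p \<and> snd_mated S p"
  have "fst_mated (prod.swap ` S) p \<and> snd_mated (prod.swap ` S) p" if p: "p \<in> prod.swap ` S" for p
  proof -
    from p obtain p' where p': "p' \<in> S" "p = prod.swap p'" by blast
    with S(2) obtain q q' where "q \<in> S" "q \<noteq> p'" "fst q = fst p'" "q' \<in> S" "q' \<noteq> p'" "snd q' = snd p'"
      unfolding fst_mated_def snd_mated_def by blast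
    then have "prod.swap q \<in> prod.swap ` S" "prod.swap q \<noteq> p" "snd (prod.swap q) = snd p"
       "prod.swap q' \<in> prod.swap ` S" "prod.swap q' \<noteq> p" "fst (prod.swap q') = fst p"
      using p' by (auto simp: prod_eq_iff)
    then show ?thesis unfolding fst_mated_def snd_mated_def by blast
  qed
  moreover have "prod.swap ` S \<subseteq> prod.swap ` C" using S(1) by blast
  ultimately have "prod.swap ` S = {}" using h by blast
  then show "S = {}" by simp
qed

lemma fst_mated_Int:
  assumes "S \<subseteq> A \<union> B" "fst ` A \<inter> fst ` B = {}" "p \<in> S \<inter> A" "fst_mated S p"
  shows "fst_mated (S \<inter> A) p"
proof -
  obtain q where q: "q \<in> S" "q \<noteq> p" "fst q = fst p" using assms(4) unfolding fst_mated_def by blast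
  have "q \<notin> B"
  proof
    assume "q \<in> B"
    then have "fst p \<in> fst ` B" using q(3) by (metis imageI)
    then show False using assms(2,3) by blast
  qed
  then have "q \<in> S \<inter> A" using q(1) assms(1) by blast
  then show ?thesis using q unfolding fst_mated_def by blast
qed

lemma snd_mated_Int:
  assumes "S \<subseteq> A \<union> B" "snd ` A \<inter> snd ` B = {}" "p \<in> S \<inter> A" "snd_mated S p"
  shows "snd_mated (S \<inter> A) p"
proof -
  obtain q where q: "q \<in> S" "q \<noteq> p" "snd q = snd p" using assms(4) unfolding snd_mated_def by blast
  have "q \<notin> B"
  proof
    assume "q \<in> B"
    then have "snd p \<in> snd ` B" using q(3) by (metis imageI)
    then show False using assms(2,3) by blast
  qed
  then have "q \<in> S \<inter> A" using q(1) assms(1) by blast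
  then show ?thesis using q unfolding snd_mated_def by blast
qed

lemma forest_union_disjoint:
  assumes "forest A" "forest B" "fst ` A \<inter> fst ` B = {}" "snd ` A \<inter> snd ` B = {}"
  shows "forest (A \<union> B)"
  unfolding forest_def
proof (intro allI impI)
  fix S assume S: "S \<subseteq> A \<union> B" "\<forall>p\<in>S. fst_mated S p \<and> snd_mated S p"
  have S': "S \<subseteq> B \<union> A" using S(1) by blast
  have d: "fst ` B \<inter> fst ` A = {}" "snd ` B \<inter> snd ` A = {}" using assms(3,4) by blast+
  have "\<forall>p\<in>S \<inter> A. fst_mated (S \<inter> A) p \<and> snd_mated (S \<inter> A) p"
    using S(2) fst_mated_Int[OF S(1) assms(3)] snd_mated_Int[OF S(1) assms(4)] by blast
  then have "S \<inter> A = {}" using assms(1) unfolding forest_def by (meson Int_lower2)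
  moreover have "\<forall>p\<in>S \<inter> B. fst_mated (S \<inter> B) p \<and> snd_mated (S \<inter> B) p"
    using S(2) fst_mated_Int[OF S' d(1)] snd_mated_Int[OF S' d(2)] by blast
  then have "S \<inter> B = {}" using assms(2) unfolding forest_def by (meson Int_lower2)
  ultimately show "S = {}" using S(1) by blast
qed

text \<open>In a subset of minimal degree 2 the chords of \<open>B\<close> have their mates at first
  ends within \<open>B\<close>. Robustness gives two of them with distant second ends that are not
  shared within \<open>B\<close>; both would have to be second ends in \<open>A\<close>, which is
  too small for that.\<close>

lemma forest_union_robust:
  assumes "forest A" "robust \<delta> B" "fst ` A \<inter> fst ` B = {}"
    and small: "\<And>p q. p \<in> A \<Longrightarrow> q \<in> A \<Longrightarrow> \<bar>snd p - snd q\<bar> \<le> \<delta>"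
  shows "forest (A \<union> B)"
  unfolding forest_def
proof (intro allI impI)
  fix S assume S: "S \<subseteq> A \<union> B" "\<forall>p\<in>S. fst_mated S p \<and> snd_mated S p"
  have S': "S \<subseteq> B \<union> A" using S(1) by blast
  have d: "fst ` B \<inter> fst ` A = {}" using assms(3) by blast
  have "S \<inter> B = {}"
  proof (rule ccontr)
    assume ne: "S \<inter> B \<noteq> {}"
    have "\<forall>p\<in>S \<inter> B. fst_mated (S \<inter> B) p"
      using S(2) fst_mated_Int[OF S' d] by blast
    then obtain p q where pq: "p \<in> S \<inter> B" "q \<in> S \<inter> B" "\<not> snd_mated (S \<inter> B) p" "\<not> snd_mated (S \<inter> B) q" "\<bar>snd p - snd q\<bar> > \<delta>"
      using assms(2) ne unfolding robust_def by (meson Int_lower2)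
    have A: "\<exists>p'\<in>A. snd p' = snd p" if p: "p \<in> S \<inter> B" "\<not> snd_mated (S \<inter> B) p" for p
    proof -
      obtain p' where p': "p' \<in> S" "p' \<noteq> p" "snd p' = snd p" using p S(2) unfolding snd_mated_def by blast
      then have "p' \<notin> B" using p(2) unfolding snd_mated_def by blast
      then show ?thesis using p' S(1) by blast
    qed
    obtain p' where "p' \<in> A" "snd p' = snd p" using A[OF pq(1,3)] by blast
    moreover obtain q' where "q' \<in> A" "snd q' = snd q" using A[OF pq(2,4)] by blast
    ultimately show False using small[of p' q'] pq(5) by simp
  qed
  then have "S \<subseteq> A" using S(1) by blast
  then show "S = {}" using assms(1) S(2) unfolding forest_def by blast
qed

lemma subset_four_Bex: "S \<subseteq> {a, b, c, d} \<Longrightarrow>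
    (\<exists>q\<in>S. P q) \<longleftrightarrow> (a \<in> S \<and> P a) \<or> (b \<in> S \<and> P b) \<or> (c \<in> S \<and> P c) \<or> (d \<in> S \<and> P d)"
  by blast

lemma subset_four_Ball: "S \<subseteq> {a, b, c, d} \<Longrightarrow>
    (\<forall>q\<in>S. P q) \<longleftrightarrow> (a \<in> S \<longrightarrow> P a) \<and> (b \<in> S \<longrightarrow> P b) \<and> (c \<in> S \<longrightarrow> P c) \<and> (d \<in> S \<longrightarrow> P d)"
  by blast

text \<open>Two antipodal pairs of half-sizes \<open>e\<close> and \<open>f\<close>. If both
  coordinates separate the pairs, mates belong to the same pair. If only one does, the factor 4
  prevents the full spreads \<open>2 * e\<close> and \<open>2 * f\<close> from matching in the
  other, and two distant free second ends remain.\<close>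

lemma robust_four:
  fixes x y x' y' u v w z e f \<delta> :: real
  assumes uv: "\<bar>u\<bar> \<le> e" "\<bar>v\<bar> \<le> e" "\<bar>u\<bar> = e \<or> \<bar>v\<bar> = e"
    and wz: "\<bar>w\<bar> \<le> f" "\<bar>z\<bar> \<le> f" "\<bar>w\<bar> = f \<or> \<bar>z\<bar> = f"
    and ef: "\<delta> > 0" "e \<ge> \<delta>" "f \<ge> \<delta>"
    and sep: "(\<bar>x - x'\<bar> > e + f + \<delta> \<and> \<bar>y - y'\<bar> > e + f + \<delta>)
      \<or> (\<bar>x - x'\<bar> > e + f + \<delta> \<and> (e \<ge> 4 * f \<or> f \<ge> 4 * e))
      \<or> (\<bar>y - y'\<bar> > e + f + \<delta> \<and> (e \<ge> 4 * f \<or> f \<ge> 4 * e))"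
  shows "robust \<delta> {(x + u, y + v), (x - u, y - v), (x' + w, y' + z), (x' - w, y' - z)}"
  unfolding robust_def
proof (intro allI impI)
  fix S assume S: "S \<subseteq> {(x + u, y + v), (x - u, y - v), (x' + w, y' + z), (x' - w, y' - z)}"
    and ne: "S \<noteq> {}" and m: "\<forall>p\<in>S. fst_mated S p"
  let ?a = "(x + u, y + v)" and ?b = "(x - u, y - v)" and ?c = "(x' + w, y' + z)" and ?d = "(x' - w, y' - z)"
  have ne': "?a \<in> S \<or> ?b \<in> S \<or> ?c \<in> S \<or> ?d \<in> S" using S ne by blast
  note s = subset_four_Bex[OF S] subset_four_Ball[OF S]
  \<comment> \<open>With membership encoded by four propositions, the claim becomes linear
    arithmetic with case distinctions.\<close>
  define A B C D where "A \<longleftrightarrow> ?a \<in> S" and "B \<longleftrightarrow> ?b \<in> S" and "C \<longleftrightarrow> ?c \<in> S" and "D \<longleftrightarrow> ?d \<in> S"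
  note fold = A_def[symmetric] B_def[symmetric] C_def[symmetric] D_def[symmetric]
  show "\<exists>p\<in>S. \<exists>q\<in>S. \<not> snd_mated S p \<and> \<not> snd_mated S q \<and> \<bar>snd p - snd q\<bar> > \<delta>"
    using m ne' uv wz ef sep
    unfolding fst_mated_def snd_mated_def s prod_eq_iff fst_conv snd_conv fold
    by (smt (verit))
qed

section \<open>Geometry of the clusters\<close>

definition cluster_set :: "nat \<Rightarrow> (bool list \<Rightarrow> real \<times> real) \<Rightarrow> shape \<Rightarrow> (real \<times> real) set" where
  "cluster_set m D q = (\<lambda>bs. leaf bs D q) ` {bs. length bs = m}"

lemma cluster_set_0: "cluster_set 0 D q = {(fst q, fst (snd q))}"
  by (simp add: cluster_set_def)

lemma cluster_set_Suc: "cluster_set (Suc m) D q =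
    cluster_set m (\<lambda>p. D (True # p)) (sub_shape m q (D [])) \<union> cluster_set m (\<lambda>p. D (False # p)) (sub_shape m q (- D []))"
proof -
  have "{bs. length bs = Suc m} = (#) True ` {bs. length bs = m} \<union> (#) False ` {bs. length bs = m}"
  proof (intro equalityI subsetI)
    fix bs :: "bool list" assume "bs \<in> {bs. length bs = Suc m}"
    then obtain b bs' where "bs = b # bs'" "length bs' = m" by (cases bs) auto
    then show "bs \<in> (#) True ` {bs. length bs = m} \<union> (#) False ` {bs. length bs = m}" by (cases b) auto
  qed auto
  then have "cluster_set (Suc m) D q = (\<lambda>bs. leaf bs D q) ` ((#) True ` {bs. length bs = m}) \<union> (\<lambda>bs. leaf bs D q) ` ((#) False ` {bs. length bs = m})"
    unfolding cluster_set_def by (simp add: image_Un)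
  then show ?thesis unfolding cluster_set_def image_image by (simp cong: image_cong_simp)
qed

text \<open>The construction is symmetric in the two coordinates; this reduces nearly vertical
  directions to nearly horizontal ones.\<close>

lemma leaf_swap: "leaf bs (\<lambda>p. prod.swap (D p)) (fst (snd q), fst q, snd (snd q)) = prod.swap (leaf bs D q)"
proof (induction bs arbitrary: D q)
  case (Cons b bs)
  have "sub_shape m (fst (snd q), fst q, snd (snd q)) (if b then prod.swap (D []) else - prod.swap (D []))
     = (let q' = sub_shape m q (if b then D [] else - D []) in (fst (snd q'), fst q', snd (snd q')))" for m
    by (simp add: sub_shape_def add.commute Let_def)
  then show ?case using Cons.IH by (simp add: Let_def)
qed simp

lemma cluster_set_swap: "prod.swap ` cluster_set m D q = cluster_set m (\<lambda>p. prod.swap (D p)) (fst (snd q), fst q, snd (snd q))"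
  by (simp add: cluster_set_def image_image leaf_swap)

lemma sup_circle_swap: "range D \<subseteq> sup_circle \<Longrightarrow> range (\<lambda>p. prod.swap (D p)) \<subseteq> sup_circle"
  by (force simp: sup_circle_def max.commute)

text \<open>The factor 2 is the bound on the relative scale of a half in
  \<open>sub_shape_scale\<close>.\<close>

primrec extent :: "nat \<Rightarrow> real" where
  "extent 0 = 0"
| "extent (Suc m) = radius m + 2 * extent m"

lemma extent_nonneg: "extent m \<ge> 0"
  by (induction m) (auto simp: radius_def)

lemma sub_shape_scale:
  assumes "snd (snd q) > 0" "d \<in> sup_circle"
  shows "snd (snd (sub_shape m q d)) > 0" "snd (snd (sub_shape m q d)) \<le> 2 * snd (snd q)"
proof -
  have d: "\<bar>fst d\<bar> \<le> 1" "\<bar>snd d\<bar> \<le> 1" using assms(2) by (auto simp: sup_circle_def)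
  have "max (min_scale m) (fst d + snd d) > 0" by (auto simp: min_scale_def less_max_iff_disj)
  then show "snd (snd (sub_shape m q d)) > 0" using assms(1) by (simp add: sub_shape_def)
  have "max (min_scale m) (fst d + snd d) \<le> 2" using d by (auto simp: min_scale_def)
  then show "snd (snd (sub_shape m q d)) \<le> 2 * snd (snd q)"
    using assms(1) by (simp add: sub_shape_def mult.commute)
qed

lemma abs_mult_le: "c \<ge> 0 \<Longrightarrow> \<bar>t\<bar> \<le> 1 \<Longrightarrow> \<bar>c * t\<bar> \<le> c * (1 :: real)"
  by (simp add: abs_mult mult_left_le)

lemma leaf_extent:
  assumes "range D \<subseteq> sup_circle" "snd (snd q) > 0"
  shows "\<bar>fst (leaf bs D q) - fst q\<bar> \<le> extent (length bs) * snd (snd q) \<and> \<bar>snd (leaf bs D q) - fst (snd q)\<bar> \<le> extent (length bs) * snd (snd q)"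
  using assms
proof (induction bs arbitrary: D q)
  case (Cons b bs)
  define d where "d = (if b then D [] else - D [])"
  have d: "d \<in> sup_circle" using Cons.prems(1) by (auto simp: d_def intro: sup_circle_uminus)
  then have d1: "\<bar>fst d\<bar> \<le> 1" "\<bar>snd d\<bar> \<le> 1" by (auto simp: sup_circle_def)
  let ?q = "sub_shape (length bs) q d" and ?m = "length bs" and ?l = "snd (snd q)"
  have D: "range (\<lambda>p. D (b # p)) \<subseteq> sup_circle" using Cons.prems(1) by auto
  note sc = sub_shape_scale[OF Cons.prems(2) d, of ?m]
  note IH = Cons.IH[OF D sc(1)]
  have r: "radius ?m \<ge> 0" by (simp add: radius_def)
  have e: "extent ?m * snd (snd ?q) \<le> extent ?m * (2 * ?l)" using sc(2) extent_nonneg by (rule mult_left_mono)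
  have R: "\<bar>radius ?m * ?l * fst d\<bar> \<le> radius ?m * ?l * 1" "\<bar>radius ?m * ?l * snd d\<bar> \<le> radius ?m * ?l * 1"
    using d1 r Cons.prems(2) by (intro abs_mult_le; simp)+
  have Q: "fst ?q = fst q + radius ?m * ?l * fst d" "fst (snd ?q) = fst (snd q) + radius ?m * ?l * snd d"
    by (simp_all add: sub_shape_def)
  have L: "leaf (b # bs) D q = leaf bs (\<lambda>p. D (b # p)) ?q" by (simp add: d_def)
  have X: "extent (length (b # bs)) * ?l = radius ?m * ?l * 1 + extent ?m * (2 * ?l)" by (simp add: algebra_simps)
  show ?case unfolding L X
    using R Q IH[THEN conjunct1] IH[THEN conjunct2] e by (intro conjI; linarith)
qed simp

lemma cluster_set_extent:
  assumes "range D \<subseteq> sup_circle" "snd (snd q) > 0" "p \<in> cluster_set m D q"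
  shows "\<bar>fst p - fst q\<bar> \<le> extent m * snd (snd q)" "\<bar>snd p - fst (snd q)\<bar> \<le> extent m * snd (snd q)"
  using assms leaf_extent[OF assms(1,2)] by (auto simp: cluster_set_def)

lemma halves_disjoint:
  assumes D: "range D \<subseteq> sup_circle" "range D' \<subseteq> sup_circle" and q: "snd (snd q) > 0" and d: "d \<in> sup_circle"
    and m: "m \<le> 2"
  shows "\<bar>fst d\<bar> > 1 / 4 \<Longrightarrow> fst ` cluster_set m D (sub_shape m q d) \<inter> fst ` cluster_set m D' (sub_shape m q (- d)) = {}"
    "\<bar>snd d\<bar> > 1 / 4 \<Longrightarrow> snd ` cluster_set m D (sub_shape m q d) \<inter> snd ` cluster_set m D' (sub_shape m q (- d)) = {}"
proof -
  let ?l = "snd (snd q)" and ?A = "cluster_set m D (sub_shape m q d)" and ?B = "cluster_set m D' (sub_shape m q (- d))"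
  note sA = sub_shape_scale[OF q d, of m] and sB = sub_shape_scale[OF q sup_circle_uminus[OF d], of m]
  have e: "extent m * snd (snd (sub_shape m q d)) \<le> extent m * (2 * ?l)" "extent m * snd (snd (sub_shape m q (- d))) \<le> extent m * (2 * ?l)"
    using sA(2) sB(2) extent_nonneg by (auto intro!: mult_left_mono)
  have "m = 0 \<or> m = 1 \<or> m = 2" using m by auto
  then have r: "radius m / 2 > 4 * extent m" by (auto simp: radius_def numeral_2_eq_2)
  have far: "\<bar>radius m * ?l * t - - (radius m * ?l * t)\<bar> > extent m * (2 * ?l) + extent m * (2 * ?l)" if "\<bar>t\<bar> > 1 / 4" for t
  proof -
    have rl: "radius m * ?l > 0" using q by (simp add: radius_def)
    have "extent m * (2 * ?l) + extent m * (2 * ?l) = (4 * extent m) * ?l" by simp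
    also have "\<dots> < (radius m / 2) * ?l" using r q by (rule mult_strict_right_mono)
    also have "\<dots> = 2 * (radius m * ?l * (1 / 4))" by simp
    also have "\<dots> \<le> 2 * (radius m * ?l * \<bar>t\<bar>)" using rl that by (intro mult_left_mono) auto
    also have "radius m * ?l * \<bar>t\<bar> = \<bar>radius m * ?l * t\<bar>"
      by (simp only: abs_mult[of "radius m * ?l"] abs_of_pos[OF rl])
    finally show ?thesis by linarith
  qed
  have A: "\<bar>fst p - (fst q + radius m * ?l * fst d)\<bar> \<le> extent m * (2 * ?l)" "\<bar>snd p - (fst (snd q) + radius m * ?l * snd d)\<bar> \<le> extent m * (2 * ?l)" if "p \<in> ?A" for p
    using cluster_set_extent[OF D(1) sA(1) that] e(1) by (auto simp: sub_shape_def)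
  have B: "\<bar>fst p - (fst q - radius m * ?l * fst d)\<bar> \<le> extent m * (2 * ?l)" "\<bar>snd p - (fst (snd q) - radius m * ?l * snd d)\<bar> \<le> extent m * (2 * ?l)" if "p \<in> ?B" for p
    using cluster_set_extent[OF D(2) sB(1) that] e(2) by (auto simp: sub_shape_def)
  show "fst ` ?A \<inter> fst ` ?B = {}" if "\<bar>fst d\<bar> > 1 / 4"
  proof -
    have "fst p \<noteq> fst p'" if "p \<in> ?A" "p' \<in> ?B" for p p'
      using A(1)[OF that(1)] B(1)[OF that(2)] far[OF \<open>\<bar>fst d\<bar> > 1 / 4\<close>] by linarith
    then show ?thesis by blast
  qed
  show "snd ` ?A \<inter> snd ` ?B = {}" if "\<bar>snd d\<bar> > 1 / 4"
  proof -
    have "snd p \<noteq> snd p'" if "p \<in> ?A" "p' \<in> ?B" for p p'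
      using A(2)[OF that(1)] B(2)[OF that(2)] far[OF \<open>\<bar>snd d\<bar> > 1 / 4\<close>] by linarith
    then show ?thesis by blast
  qed
qed

lemma cluster_set_disjoint:
  assumes "range D \<subseteq> sup_circle" "range D' \<subseteq> sup_circle" "snd (snd q) > 0" "d \<in> sup_circle" "m \<le> 2"
  shows "cluster_set m D (sub_shape m q d) \<inter> cluster_set m D' (sub_shape m q (- d)) = {}"
proof -
  have "\<bar>fst d\<bar> > 1 / 4 \<or> \<bar>snd d\<bar> > 1 / 4" using assms(4) by (auto simp: sup_circle_def max_def split: if_splits)
  then show ?thesis using halves_disjoint[OF assms] by blast
qed

lemma inj_leaf:
  assumes "range D \<subseteq> sup_circle" "snd (snd q) > 0" "m \<le> 3"
  shows "inj_on (\<lambda>bs. leaf bs D q) {bs. length bs = m}"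
  using assms
proof (induction m arbitrary: D q)
  case (Suc m)
  have D: "range (\<lambda>p. D (b # p)) \<subseteq> sup_circle" for b using Suc.prems(1) by auto
  have d: "D [] \<in> sup_circle" using Suc.prems(1) by blast
  have m: "m \<le> 3" "m \<le> 2" using Suc.prems(3) by auto
  have i1: "inj_on (\<lambda>bs. leaf bs (\<lambda>p. D (True # p)) (sub_shape m q (D []))) {bs. length bs = m}"
    by (rule Suc.IH[OF D sub_shape_scale(1)[OF Suc.prems(2) d] m(1)])
  have i2: "inj_on (\<lambda>bs. leaf bs (\<lambda>p. D (False # p)) (sub_shape m q (- D []))) {bs. length bs = m}"
    by (rule Suc.IH[OF D sub_shape_scale(1)[OF Suc.prems(2) sup_circle_uminus[OF d]] m(1)])
  note dis = cluster_set_disjoint[OF D[of True] D[of False] Suc.prems(2) d m(2)]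
  show ?case
  proof (rule inj_onI)
    fix bs cs assume "bs \<in> {bs. length bs = Suc m}" "cs \<in> {bs. length bs = Suc m}" and eq: "leaf bs D q = leaf cs D q"
    then obtain b bs' c cs' where bs: "bs = b # bs'" "length bs' = m" "cs = c # cs'" "length cs' = m"
      by (cases bs; cases cs) auto
    have "leaf xs (\<lambda>p. D (True # p)) (sub_shape m q (D [])) \<noteq> leaf ys (\<lambda>p. D (False # p)) (sub_shape m q (- D []))"
      if "length xs = m" "length ys = m" for xs ys
      using dis that unfolding cluster_set_def by blast
    note ne = this[OF bs(2,4)] this[OF bs(4,2)]
    show "bs = cs"
      using eq ne inj_onD[OF i1, of bs' cs'] inj_onD[OF i2, of bs' cs'] unfolding bs(1,3)
      by (cases b; cases c) (simp_all add: bs(2,4) eq_commute)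
  qed
qed (auto simp: inj_on_def)

text \<open>The pairs have half-sizes \<open>l * E\<close> and \<open>l * F\<close>. A coordinate of
  \<open>d\<close> above 1/4 in absolute value separates them, as 20/4 > 2 + 2 + 1/10. If the other
  coordinate is at most 1/4, one of \<open>E\<close>, \<open>F\<close> is at least 3/4 and the other
  equals 1/10, which gives the factor 4.\<close>

lemma robust_cluster_2:
  assumes D: "range D \<subseteq> sup_circle" and q: "snd (snd q) > 0"
  shows "robust (snd (snd q) / 10) (cluster_set 2 D q)"
proof -
  define l where "l = snd (snd q)"
  define d where "d = D []"
  define E F where "E = max (1 / 10) (fst d + snd d)" and "F = max (1 / 10) (- fst d - snd d)"
  define a b where "a = D [True]" and "b = D [False]"
  have circ: "d \<in> sup_circle" "a \<in> sup_circle" "b \<in> sup_circle" using D by (auto simp: d_def a_def b_def)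
  have dd: "\<bar>fst d\<bar> \<le> 1" "\<bar>snd d\<bar> \<le> 1" "\<bar>fst d\<bar> = 1 \<or> \<bar>snd d\<bar> = 1" using circ(1) by (auto simp: sup_circle_def max_def split: if_splits)
  have EF: "E \<ge> 1 / 10" "F \<ge> 1 / 10" "E \<le> 2" "F \<le> 2" using dd by (auto simp: E_def F_def)
  have l: "l > 0" using q by (simp add: l_def)
  have prod: "\<bar>c * fst e\<bar> \<le> c" "\<bar>c * snd e\<bar> \<le> c" "\<bar>c * fst e\<bar> = c \<or> \<bar>c * snd e\<bar> = c" if "c > 0" "e \<in> sup_circle" for c e
  proof -
    have "\<bar>fst e\<bar> \<le> 1" "\<bar>snd e\<bar> \<le> 1" "\<bar>fst e\<bar> = 1 \<or> \<bar>snd e\<bar> = 1" using that(2) by (auto simp: sup_circle_def max_def split: if_splits)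
    then show "\<bar>c * fst e\<bar> \<le> c" "\<bar>c * snd e\<bar> \<le> c" "\<bar>c * fst e\<bar> = c \<or> \<bar>c * snd e\<bar> = c"
      using that(1) by (auto simp: abs_mult mult_left_le)
  qed
  have set: "cluster_set 2 D q = {(fst q + 10 * l * fst d + l * E * fst a, fst (snd q) + 10 * l * snd d + l * E * snd a),
     (fst q + 10 * l * fst d - l * E * fst a, fst (snd q) + 10 * l * snd d - l * E * snd a),
     (fst q - 10 * l * fst d + l * F * fst b, fst (snd q) - 10 * l * snd d + l * F * snd b),
     (fst q - 10 * l * fst d - l * F * fst b, fst (snd q) - 10 * l * snd d - l * F * snd b)}"
    by (auto simp: numeral_2_eq_2 cluster_set_Suc cluster_set_0 sub_shape_def radius_def min_scale_def l_def d_def E_def F_def a_def b_def)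
  have big: "l * (E + F + 1 / 10) < l * \<bar>20 * t\<bar>" if "\<bar>t\<bar> > 1 / 4" for t
    using that EF l by (intro mult_strict_left_mono) auto
  have big': "l * E + l * F + l / 10 < \<bar>c + 10 * l * t - (c - 10 * l * t)\<bar>" if "\<bar>t\<bar> > 1 / 4" for t c
    using big[OF that] l by (simp add: algebra_simps abs_mult)
  have ratio: "l * E \<ge> 4 * (l * F) \<or> l * F \<ge> 4 * (l * E)" if "\<bar>fst d\<bar> \<le> 1 / 4 \<or> \<bar>snd d\<bar> \<le> 1 / 4"
  proof -
    have "E \<ge> 4 * F \<or> F \<ge> 4 * E" using that dd unfolding E_def F_def by linarith
    then show ?thesis using l mult_left_mono[of "4 * F" E l] mult_left_mono[of "4 * E" F l] by auto
  qed
  show ?thesis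
    unfolding set l_def[symmetric]
  proof (rule robust_four[where e = "l * E" and f = "l * F"])
    show "\<bar>l * E * fst a\<bar> \<le> l * E" "\<bar>l * E * snd a\<bar> \<le> l * E" "\<bar>l * E * fst a\<bar> = l * E \<or> \<bar>l * E * snd a\<bar> = l * E"
      using prod[of "l * E" a] EF l circ(2) by auto
    show "\<bar>l * F * fst b\<bar> \<le> l * F" "\<bar>l * F * snd b\<bar> \<le> l * F" "\<bar>l * F * fst b\<bar> = l * F \<or> \<bar>l * F * snd b\<bar> = l * F"
      using prod[of "l * F" b] EF l circ(3) by auto
    show "0 < l / 10" using l by simp
    show "l / 10 \<le> l * E" "l / 10 \<le> l * F"
      using mult_left_mono[OF EF(1), of l] mult_left_mono[OF EF(2), of l] l by auto
    let ?sep = "\<lambda>c t. l * E + l * F + l / 10 < \<bar>c + 10 * l * t - (c - 10 * l * t)\<bar>"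
    have "(?sep (fst q) (fst d) \<and> ?sep (fst (snd q)) (snd d)) \<or>
      (?sep (fst q) (fst d) \<and> (4 * (l * F) \<le> l * E \<or> 4 * (l * E) \<le> l * F)) \<or>
      (?sep (fst (snd q)) (snd d) \<and> (4 * (l * F) \<le> l * E \<or> 4 * (l * E) \<le> l * F))"
    proof (cases "\<bar>fst d\<bar> \<le> 1 / 4 \<or> \<bar>snd d\<bar> \<le> 1 / 4")
      case True
      then have "\<bar>fst d\<bar> > 1 / 4 \<or> \<bar>snd d\<bar> > 1 / 4" using dd by linarith
      then show ?thesis using big' ratio[OF True] by blast
    next
      case False
      then have "\<bar>fst d\<bar> > 1 / 4" "\<bar>snd d\<bar> > 1 / 4" by linarith+
      then show ?thesis using big' by blast
    qed
    then show "(\<bar>fst q + 10 * l * fst d - (fst q - 10 * l * fst d)\<bar> > l * E + l * F + l / 10 \<and>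
       \<bar>fst (snd q) + 10 * l * snd d - (fst (snd q) - 10 * l * snd d)\<bar> > l * E + l * F + l / 10)
      \<or> (\<bar>fst q + 10 * l * fst d - (fst q - 10 * l * fst d)\<bar> > l * E + l * F + l / 10 \<and> (l * E \<ge> 4 * (l * F) \<or> l * F \<ge> 4 * (l * E)))
      \<or> (\<bar>fst (snd q) + 10 * l * snd d - (fst (snd q) - 10 * l * snd d)\<bar> > l * E + l * F + l / 10 \<and> (l * E \<ge> 4 * (l * F) \<or> l * F \<ge> 4 * (l * E)))" .
  qed
qed

text \<open>A nearly horizontal direction separates the first ends of the halves. The half of scale
  \<open>l / 1000\<close> has second ends within \<open>24 * l / 1000\<close> of each other, which
  is below the robustness of the other half, at least \<open>3 * l / 40\<close>.\<close>

lemma forest_cluster_3_aux: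
  assumes D: "range D \<subseteq> sup_circle" and q: "snd (snd q) > 0" and d: "\<bar>snd (D [])\<bar> \<le> 1 / 4"
  shows "forest (cluster_set 3 D q)"
proof -
  define l where "l = snd (snd q)"
  have circ: "D [] \<in> sup_circle" using D by blast
  then have dd: "\<bar>fst (D [])\<bar> = 1" using d by (auto simp: sup_circle_def max_def split: if_splits)
  have l: "l > 0" using q by (simp add: l_def)
  have D': "range (\<lambda>p. D (b # p)) \<subseteq> sup_circle" for b using D by auto
  have main: "forest (A \<union> B)"
    if A: "A = cluster_set 2 DA qA" "range DA \<subseteq> sup_circle" "snd (snd qA) = l * (1 / 1000)"
      and B: "B = cluster_set 2 DB qB" "range DB \<subseteq> sup_circle" "snd (snd qB) \<ge> l * (3 / 4)"
      and dis: "fst ` A \<inter> fst ` B = {}" for A B DA DB qA qB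
  proof (rule forest_union_robust[OF _ _ dis])
    have lA: "snd (snd qA) > 0" using A(3) l by simp
    have lB: "snd (snd qB) > 0" using B(3) l by linarith
    show "forest A" unfolding A(1) by (rule forest_robust[OF robust_cluster_2[OF A(2) lA]])
    show "robust (snd (snd qB) / 10) B" unfolding B(1) by (rule robust_cluster_2[OF B(2) lB])
    have e: "extent 2 = 12" by (simp add: numeral_2_eq_2 radius_def)
    fix p p' assume "p \<in> A" "p' \<in> A"
    then show "\<bar>snd p - snd p'\<bar> \<le> snd (snd qB) / 10"
      using cluster_set_extent(2)[OF A(2) lA, of p 2] cluster_set_extent(2)[OF A(2) lA, of p' 2] A(3) B(3) l
      unfolding A(1) e by linarith
  qed
  let ?A = "cluster_set 2 (\<lambda>p. D (True # p)) (sub_shape 2 q (D []))" and ?B = "cluster_set 2 (\<lambda>p. D (False # p)) (sub_shape 2 q (- D []))"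
  have set: "cluster_set 3 D q = ?A \<union> ?B" using cluster_set_Suc[of 2 D q] by simp
  have dis: "fst ` ?A \<inter> fst ` ?B = {}"
    by (rule halves_disjoint(1)[OF D' D' q circ]) (use dd in auto)
  show ?thesis
  proof (cases "fst (D []) = 1")
    case True
    have "snd (snd (sub_shape 2 q (- D []))) = l * (1 / 1000)" using True d l by (simp add: sub_shape_def min_scale_def l_def)
    moreover have "snd (snd (sub_shape 2 q (D []))) \<ge> l * (3 / 4)" using True d l by (auto simp: sub_shape_def min_scale_def l_def)
    moreover have "fst ` ?B \<inter> fst ` ?A = {}" using dis by blast
    ultimately have "forest (?B \<union> ?A)" by (intro main[OF refl D' _ refl D'])
    then show ?thesis unfolding set by (simp add: Un_commute)
  next
    case False
    then have f: "fst (D []) = - 1" using dd by linarith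
    have "snd (snd (sub_shape 2 q (D []))) = l * (1 / 1000)" using f d l by (simp add: sub_shape_def min_scale_def l_def)
    moreover have "snd (snd (sub_shape 2 q (- D []))) \<ge> l * (3 / 4)" using f d l by (auto simp: sub_shape_def min_scale_def l_def)
    ultimately have "forest (?A \<union> ?B)" using dis by (intro main[OF refl D' _ refl D'])
    then show ?thesis unfolding set .
  qed
qed

text \<open>Either the direction is close to an axis, or both of its coordinates exceed 1/4 and the
  halves share no ends at all.\<close>

lemma forest_cluster_3:
  assumes D: "range D \<subseteq> sup_circle" and q: "snd (snd q) > 0"
  shows "forest (cluster_set 3 D q)"
proof -
  have circ: "D [] \<in> sup_circle" using D by blast
  have D': "range (\<lambda>p. D (b # p)) \<subseteq> sup_circle" for b using D by auto
  consider "\<bar>snd (D [])\<bar> \<le> 1 / 4" | "\<bar>fst (D [])\<bar> \<le> 1 / 4" | "\<bar>fst (D [])\<bar> > 1 / 4" "\<bar>snd (D [])\<bar> > 1 / 4" by linarith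
  then show ?thesis
  proof cases
    case 1
    then show ?thesis by (rule forest_cluster_3_aux[OF D q])
  next
    case 2
    have "forest (prod.swap ` cluster_set 3 D q)"
      unfolding cluster_set_swap by (rule forest_cluster_3_aux[OF sup_circle_swap[OF D]]) (use q 2 in auto)
    then show ?thesis by (rule forest_swap)
  next
    case 3
    have "cluster_set (Suc 2) D q = cluster_set 2 (\<lambda>p. D (True # p)) (sub_shape 2 q (D [])) \<union> cluster_set 2 (\<lambda>p. D (False # p)) (sub_shape 2 q (- D []))"
      by (rule cluster_set_Suc)
    moreover have "forest \<dots>"
      by (intro forest_union_disjoint forest_robust[OF robust_cluster_2] halves_disjoint D' q circ 3 sub_shape_scale(1) sup_circle_uminus) auto
    ultimately show ?thesis by simp
  qed
qed

lemma forest_pair: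
  assumes "a \<noteq> b" shows "forest {a, b}"
  unfolding forest_def
proof (intro allI impI, rule ccontr)
  fix S assume S: "S \<subseteq> {a, b}" "\<forall>p\<in>S. fst_mated S p \<and> snd_mated S p" "S \<noteq> {}"
  then obtain p where p: "p \<in> S" by blast
  with S(2) obtain q q' where q: "q \<in> S" "q \<noteq> p" "fst q = fst p" "q' \<in> S" "q' \<noteq> p" "snd q' = snd p"
    unfolding fst_mated_def snd_mated_def by blast
  then have "q = q'" using S(1) p by blast
  then show False using q by (simp add: prod_eq_iff)
qed

lemma forest_cluster:
  assumes D: "range D \<subseteq> sup_circle" and q: "snd (snd q) > 0" and m: "m \<le> 3"
  shows "forest (cluster_set m D q)"
proof -
  consider "m = 0" | "m = 1" | "m = 2" | "m = 3" using m by linarith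
  then show ?thesis
  proof cases
    case 1
    then show ?thesis by (auto simp: cluster_set_0 forest_def fst_mated_def subset_singleton_iff)
  next
    case 2
    have circ: "D [] \<in> sup_circle" using D by blast
    have "cluster_set 1 D q = {(fst q + snd (snd q) * fst (D []), fst (snd q) + snd (snd q) * snd (D [])),
      (fst q - snd (snd q) * fst (D []), fst (snd q) - snd (snd q) * snd (D []))}" (is "_ = {?a, ?b}")
      using cluster_set_Suc[of 0 D q] by (simp add: cluster_set_0 sub_shape_def radius_def) blast
    moreover have "?a \<noteq> ?b"
      using circ q by (auto simp: sup_circle_def)
    then have "forest {?a, ?b}" by (rule forest_pair)
    ultimately show ?thesis using 2 by simp
  next
    case 3
    then show ?thesis using forest_robust[OF robust_cluster_2[OF D q]] by simp
  next
    case 4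
    then show ?thesis using forest_cluster_3[OF D q] by simp
  qed
qed

section \<open>The parity of the obstruction\<close>

lemma sum_list_map_concat: "(\<Sum>x\<leftarrow>concat xss. f x) = (\<Sum>xs\<leftarrow>xss. \<Sum>x\<leftarrow>xs. f x)"
  by (induction xss) simp_all

lemma sum_list_word_prod:
  "(\<Sum>w\<leftarrow>word_prod (ws # Ws). f w) = (\<Sum>w\<leftarrow>ws. \<Sum>v\<leftarrow>word_prod Ws. f (v @ w))"
  by (simp add: sum_list_map_concat comp_def)

lemma sum_list_sq_word:
  fixes f :: "(nat \<Rightarrow> nat) \<Rightarrow> bit"
  shows "(\<Sum>v\<leftarrow>sq_word w. f (count_list v)) = (\<Sum>i\<leftarrow>w. f (\<lambda>l. 2 * count_list w l - of_bool (l = i)))"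
proof (induction w arbitrary: f)
  case (Cons a w)
  have 1: "count_list (a # w @ w) = (\<lambda>l. 2 * count_list (a # w) l - of_bool (l = a))"
    by (auto simp: fun_eq_iff)
  have "(\<Sum>v\<leftarrow>sq_word w. f (count_list (a # a # v))) = (\<Sum>v\<leftarrow>sq_word w. f (\<lambda>l. count_list v l + 2 * of_bool (l = a)))"
    by (intro arg_cong[of _ _ sum_list] map_cong refl arg_cong[of _ _ f]) (auto simp: fun_eq_iff)
  also have "\<dots> = (\<Sum>i\<leftarrow>w. f (\<lambda>l. (2 * count_list w l - of_bool (l = i)) + 2 * of_bool (l = a)))"
    by (rule Cons.IH)
  also have "\<dots> = (\<Sum>i\<leftarrow>w. f (\<lambda>l. 2 * count_list (a # w) l - of_bool (l = i)))"
  proof (intro arg_cong[of _ _ sum_list] map_cong refl arg_cong[of _ _ f] ext)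
    fix i l assume "i \<in> set w"
    then have "count_list w i \<noteq> 0" by (simp add: count_list_0_iff)
    then show "2 * count_list w l - of_bool (l = i) + 2 * of_bool (l = a) = 2 * count_list (a # w) l - of_bool (l = i)"
      by auto
  qed
  finally have 2: "(\<Sum>v\<leftarrow>sq_word w. f (count_list (a # a # v))) = \<dots>" .
  have "(\<Sum>v\<leftarrow>sq_word (a # w). f (count_list v)) = f (count_list (a # w @ w)) + (\<Sum>v\<leftarrow>sq_word w. f (count_list (a # a # v)))"
    by (simp add: comp_def del: count_list.simps)
  then show ?case unfolding 1 2 by simp
qed simp

lemma sum_list_count:
  fixes g :: "nat \<Rightarrow> bit"
  shows "set w \<subseteq> {..<r} \<Longrightarrow> (\<Sum>i\<leftarrow>w. g i) = (\<Sum>i<r. of_nat (count_list w i) * g i)"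
proof (induction w)
  case (Cons a w)
  have "(\<Sum>i<r. of_nat (count_list (a # w) i) * g i) = (\<Sum>i<r. of_nat (count_list w i) * g i + (if a = i then g i else 0))"
    by (rule sum.cong) (auto simp: algebra_simps)
  also have "\<dots> = (\<Sum>i<r. of_nat (count_list w i) * g i) + g a"
    using Cons.prems by (simp add: sum.distrib)
  finally show ?case using Cons by (simp add: add.commute)
qed simp

lemma count_list_upt: "count_list [0..<r] l = of_bool (l < r)"
  by (induction r) auto

text \<open>The first squaring leaves one letter simple. Afterwards all other letters have even
  multiplicity, so modulo 2 only that same letter can stay simple in later squarings.\<close>

lemma sum_list_cluster_words:
  fixes f :: "(nat \<Rightarrow> nat) \<Rightarrow> bit"
  assumes "m > 0"
  shows "(\<Sum>w\<leftarrow>cluster_words r m. f (count_list w)) =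
    (\<Sum>i<r. f (\<lambda>l. if l < r then if l = i then 1 else 2 ^ m else 0))"
  using assms
proof (induction m arbitrary: f)
  case (Suc m)
  have step: "(\<Sum>w\<leftarrow>cluster_words r (Suc m). f (count_list w)) = (\<Sum>w\<leftarrow>cluster_words r m.
     \<Sum>i<r. of_nat (count_list w i) * f (\<lambda>l. 2 * count_list w l - of_bool (l = i)))"
  proof -
    have "(\<Sum>w\<leftarrow>cluster_words r (Suc m). f (count_list w)) = (\<Sum>w\<leftarrow>cluster_words r m. \<Sum>v\<leftarrow>sq_word w. f (count_list v))"
      by (simp add: sum_list_map_concat comp_def)
    also have "\<dots> = (\<Sum>w\<leftarrow>cluster_words r m. \<Sum>i<r. of_nat (count_list w i) * f (\<lambda>l. 2 * count_list w l - of_bool (l = i)))"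
      by (intro arg_cong[of _ _ sum_list] map_cong refl)
        (simp only: sum_list_sq_word sum_list_count[OF set_cluster_words])
    finally show ?thesis .
  qed
  show ?case
  proof (cases "m = 0")
    case True
    then show ?thesis unfolding step
      by (auto simp: count_list_upt intro!: sum.cong arg_cong[of _ _ f])
  next
    case False
    let ?e = "\<lambda>j l. if l < r then if l = j then 1 else 2 ^ m else (0 :: nat)"
    let ?g = "\<lambda>c. \<Sum>i<r. of_nat (c i) * f (\<lambda>l. 2 * c l - of_bool (l = i))"
    have "(\<Sum>w\<leftarrow>cluster_words r (Suc m). f (count_list w)) = (\<Sum>j<r. ?g (?e j))"
      unfolding step using Suc.IH[of ?g] False by simp
    also have "\<dots> = (\<Sum>j<r. f (\<lambda>l. if l < r then if l = j then 1 else 2 ^ Suc m else 0))"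
    proof (rule sum.cong[OF refl])
      fix j assume j: "j \<in> {..<r}"
      have z: "of_nat (2 ^ m) = (0 :: bit)" using False by simp
      have "?g (?e j) = (\<Sum>i<r. if i = j then f (\<lambda>l. 2 * ?e j l - of_bool (l = j)) else 0)"
        using False by (intro sum.cong) (auto simp: z)
      also have "\<dots> = f (\<lambda>l. 2 * ?e j l - of_bool (l = j))" using j by simp
      also have "(\<lambda>l. 2 * ?e j l - of_bool (l = j)) = (\<lambda>l. if l < r then if l = j then 1 else 2 ^ Suc m else 0)"
        using j by auto
      finally show "?g (?e j) = f (\<lambda>l. if l < r then if l = j then 1 else 2 ^ Suc m else 0)" .
    qed
    finally show ?thesis .
  qed
qed simp

text \<open>The coefficient of \<open>u^v\<close> in the product of \<open>u_i + u_l\<close> over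
  the edges: every edge chooses one of its ends. Exponents are integers because division by a common
  power may make them negative.\<close>

primrec tournament :: "nat \<Rightarrow> (nat \<times> nat) list \<Rightarrow> (nat \<Rightarrow> int) \<Rightarrow> bit" where
  "tournament r [] v = of_bool (\<forall>i<r. v i = 0)"
| "tournament r (e # es) v = tournament r es (v(fst e := v (fst e) - 1)) + tournament r es (v(snd e := v (snd e) - 1))"

text \<open>The parity of the coefficient of \<open>u\<^sup>v\<close> in the product of the Vandermonde polynomial of \<open>u\<close> and
  the power sums of the inverse variables.\<close>

primrec bead_sum :: "nat \<Rightarrow> nat list \<Rightarrow> (nat \<Rightarrow> int) \<Rightarrow> bit" where
  "bead_sum r [] v = tournament r (pairs r) v"
| "bead_sum r (p # ps) v = (\<Sum>i<r. bead_sum r ps (v(i := v i + int p)))"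

text \<open>A proper cluster contributes the product of all \<open>u_l^(2^m)\<close> times the sum
  of the \<open>u_i^(1 - 2^m)\<close>; single chords enter only through the common power.\<close>

definition parts :: "nat list \<Rightarrow> nat list" where
  "parts ms = map (\<lambda>m. 2 ^ m - 1) (filter (\<lambda>m. 0 < m) ms)"

lemma pairs_less: "e \<in> set (pairs r) \<Longrightarrow> fst e < r \<and> snd e < r"
  by (auto simp: set_pairs)

lemma pairs_Suc: "pairs (Suc r) = pairs r @ map (\<lambda>i. (i, r)) [0..<r]"
  by (simp add: pairs_def)

lemma tournament_cong: "(\<And>i. i < r \<Longrightarrow> v i = v' i) \<Longrightarrow> (\<And>e. e \<in> set es \<Longrightarrow> fst e < r \<and> snd e < r) \<Longrightarrow> tournament r es v = tournament r es v'"
proof (induction es arbitrary: v v')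
  case (Cons e es)
  have "tournament r es (v(i := v i - 1)) = tournament r es (v'(i := v' i - 1))" if "i < r" for i
    by (rule Cons.IH) (use Cons.prems that in auto)
  then show ?case using Cons.prems(2)[of e] by simp
qed auto

lemma bead_sum_cong: "(\<And>i. i < r \<Longrightarrow> v i = v' i) \<Longrightarrow> bead_sum r ps v = bead_sum r ps v'"
proof (induction ps arbitrary: v v')
  case Nil
  then show ?case by (auto intro!: tournament_cong simp: set_pairs)
next
  case (Cons p ps)
  show ?case unfolding bead_sum.simps
    by (intro sum.cong refl Cons.IH) (use Cons.prems in auto)
qed

lemma sum_list_pairs:
  assumes "\<And>e. e \<in> set es \<Longrightarrow> fst e < r \<and> snd e < r"
  shows "(\<Sum>w\<leftarrow>word_prod (map (\<lambda>e. [[fst e], [snd e]]) es). of_bool (\<forall>i<r. int (count_list w i) = v i)) = tournament r es v"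
  using assms
proof (induction es arbitrary: v)
  case Nil
  then show ?case by (auto simp: eq_commute[of 0])
next
  case (Cons e es)
  have "(\<forall>i<r. int (count_list (u @ [x]) i) = v i) \<longleftrightarrow> (\<forall>i<r. int (count_list u i) = (v(x := v x - 1)) i)" for u x
    by (auto simp: algebra_simps)
  then show ?case
    using Cons unfolding list.map sum_list_word_prod by (simp del: count_list_append fun_upd_apply)
qed

text \<open>A proper cluster takes 2^m from every exponent and gives 2^m - 1 back to one of
  them.\<close>

lemma system_words_parity:
  "(\<Sum>w\<leftarrow>word_prod (system_words r ms). of_bool (\<forall>i<r. int (count_list w i) = v i)) =
    bead_sum r (parts ms) (\<lambda>i. v i - (\<Sum>m\<leftarrow>ms. 2 ^ m))"
proof (induction ms arbitrary: v)
  case Nil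
  show ?case using sum_list_pairs[where es = "pairs r" and r = r and v = v, OF pairs_less] by (simp add: system_words_def parts_def)
next
  case (Cons m ms)
  have sw: "system_words r (m # ms) = cluster_words r m # system_words r ms" by (simp add: system_words_def)
  let ?W = "word_prod (system_words r ms)"
  have "(\<Sum>w\<leftarrow>word_prod (system_words r (m # ms)). of_bool (\<forall>i<r. int (count_list w i) = v i)) =
     (\<Sum>w\<leftarrow>cluster_words r m. \<Sum>u\<leftarrow>?W. of_bool (\<forall>i<r. int (count_list u i) = v i - int (count_list w i)))"
    unfolding sw sum_list_word_prod by (simp add: algebra_simps)
  also have "\<dots> = (\<Sum>w\<leftarrow>cluster_words r m. bead_sum r (parts ms) (\<lambda>i. (v i - int (count_list w i)) - (\<Sum>m\<leftarrow>ms. 2 ^ m)))"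
    by (simp only: Cons.IH)
  also have "\<dots> = bead_sum r (parts (m # ms)) (\<lambda>i. v i - (\<Sum>m\<leftarrow>m # ms. 2 ^ m))"
  proof (cases "m = 0")
    case True
    then show ?thesis
      by (auto simp: parts_def count_list_upt algebra_simps intro!: bead_sum_cong)
  next
    case False
    have "(\<Sum>w\<leftarrow>cluster_words r m. bead_sum r (parts ms) (\<lambda>i. (v i - int (count_list w i)) - (\<Sum>m\<leftarrow>ms. 2 ^ m))) =
      (\<Sum>i<r. bead_sum r (parts ms) (\<lambda>l. (v l - int (if l < r then if l = i then 1 else 2 ^ m else 0)) - (\<Sum>m\<leftarrow>ms. 2 ^ m)))"
      using sum_list_cluster_words[of m "\<lambda>c. bead_sum r (parts ms) (\<lambda>i. (v i - int (c i)) - (\<Sum>m\<leftarrow>ms. 2 ^ m))" r] False by simp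
    also have "\<dots> = bead_sum r (parts (m # ms)) (\<lambda>i. v i - (\<Sum>m\<leftarrow>m # ms. 2 ^ m))"
      using False by (auto simp: parts_def of_nat_diff intro!: sum.cong bead_sum_cong)
    finally show ?thesis .
  qed
  finally show ?case .
qed

section \<open>Coefficients of the Vandermonde polynomial modulo 2\<close>

lemma tournament_swap: "tournament r (a # e # es) v = tournament r (e # a # es) v"
proof -
  have c: "v(i := v i - 1, j := (v(i := v i - 1)) j - 1) = v(j := v j - 1, i := (v(j := v j - 1)) i - 1)" for i j
    by (rule ext) simp
  let ?t = "\<lambda>i j. tournament r es (v(i := v i - 1, j := (v(i := v i - 1)) j - 1))"
  have s: "?t i j = ?t j i" for i j by (rule arg_cong[of _ _ "tournament r es"]) (rule c)
  have "tournament r (a # e # es) v = (?t (fst a) (fst e) + ?t (fst a) (snd e)) + (?t (snd a) (fst e) + ?t (snd a) (snd e))"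
    by (simp only: tournament.simps)
  also have "\<dots> = (?t (fst e) (fst a) + ?t (snd e) (fst a)) + (?t (fst e) (snd a) + ?t (snd e) (snd a))"
    by (simp only: s[of "fst a"] s[of "snd a"])
  also have "\<dots> = (?t (fst e) (fst a) + ?t (fst e) (snd a)) + (?t (snd e) (fst a) + ?t (snd e) (snd a))"
    by (simp only: ac_simps)
  finally show ?thesis by (simp only: tournament.simps)
qed

lemma tournament_rotate: "tournament r (es @ e # es') v = tournament r (e # es @ es') v"
proof (induction es arbitrary: v)
  case (Cons a es)
  have "tournament r ((a # es) @ e # es') v = tournament r (a # e # es @ es') v"
    by (simp only: append_Cons tournament.simps(2)[of r a] Cons.IH)
  then show ?case by (simp only: tournament_swap append_Cons)
qed simp

lemma tournament_edges:
  assumes "mset (map (\<lambda>e. {fst e, snd e}) es) = mset (map (\<lambda>e. {fst e, snd e}) es')"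
  shows "tournament r es v = tournament r es' v"
  using assms
proof (induction es arbitrary: es' v)
  case (Cons e es)
  have "{fst e, snd e} \<in> set (map (\<lambda>e. {fst e, snd e}) es')"
    using mset_eq_setD[OF Cons.prems] by auto
  then obtain e' where e': "e' \<in> set es'" "{fst e', snd e'} = {fst e, snd e}" by auto
  then obtain xs ys where es': "es' = xs @ e' # ys" by (meson split_list)
  have "mset (map (\<lambda>e. {fst e, snd e}) es) = mset (map (\<lambda>e. {fst e, snd e}) (xs @ ys))"
    using Cons.prems e'(2) unfolding es' by simp
  note IH = Cons.IH[OF this]
  have "fst e' = fst e \<and> snd e' = snd e \<or> fst e' = snd e \<and> snd e' = fst e"
    using e'(2) by (auto simp: doubleton_eq_iff)
  then show ?case
    unfolding es' tournament_rotate
    by (elim disjE conjE) (simp_all only: tournament.simps IH ac_simps)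
qed simp

lemma tournament_map:
  assumes "bij_betw \<pi> {..<r} {..<r}" "\<And>e. e \<in> set es \<Longrightarrow> fst e < r \<and> snd e < r"
  shows "tournament r (map (map_prod \<pi> \<pi>) es) v = tournament r es (v \<circ> \<pi>)"
  using assms(2)
proof (induction es arbitrary: v)
  case Nil
  have im: "\<pi> ` {..<r} = {..<r}" using assms(1) by (simp add: bij_betw_def)
  have "(\<forall>i<r. v i = 0) \<longleftrightarrow> (\<forall>i\<in>\<pi> ` {..<r}. v i = 0)" unfolding im by auto
  also have "\<dots> \<longleftrightarrow> (\<forall>i<r. v (\<pi> i) = 0)" by blast
  finally show ?case by simp
next
  case (Cons e es)
  have h: "tournament r es (v(\<pi> i := v (\<pi> i) - 1) \<circ> \<pi>) = tournament r es ((v \<circ> \<pi>)(i := (v \<circ> \<pi>) i - 1))" if "i < r" for i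
  proof (rule tournament_cong)
    fix j assume "j < r"
    then show "(v(\<pi> i := v (\<pi> i) - 1) \<circ> \<pi>) j = ((v \<circ> \<pi>)(i := (v \<circ> \<pi>) i - 1)) j"
      using that bij_betw_imp_inj_on[OF assms(1)] by (auto simp: inj_on_def)
  qed (use Cons.prems in auto)
  have IH: "tournament r (map (map_prod \<pi> \<pi>) es) u = tournament r es (u \<circ> \<pi>)" for u
    by (rule Cons.IH) (use Cons.prems in auto)
  have e: "fst e < r" "snd e < r" using Cons.prems[of e] by auto
  show ?case by (simp only: list.map tournament.simps fst_map_prod snd_map_prod IH h[OF e(1)] h[OF e(2)])
qed

lemma distinct_pairs: "distinct (map (\<lambda>e. {fst e, snd e}) (pairs r))"
proof -
  have "distinct (pairs r)"
  proof (induction r)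
    case 0
    show ?case by (simp add: pairs_def)
  next
    case (Suc r)
    then show ?case by (auto simp: pairs_Suc distinct_map inj_on_def set_pairs)
  qed
  moreover have "inj_on (\<lambda>e. {fst e, snd e}) (set (pairs r))"
    by (auto simp: inj_on_def set_pairs doubleton_eq_iff)
  ultimately show ?thesis by (simp add: distinct_map)
qed

lemma edges_pairs: "(\<lambda>e. {fst e, snd e}) ` set (pairs r) = {{i, l} | i l. i < r \<and> l < r \<and> i \<noteq> l}"
proof (intro equalityI subsetI)
  fix X assume "X \<in> {{i, l} | i l. i < r \<and> l < r \<and> i \<noteq> l}"
  then obtain i l where "X = {i, l}" "i < r" "l < r" "i \<noteq> l" by blast
  then show "X \<in> (\<lambda>e. {fst e, snd e}) ` set (pairs r)"
    unfolding set_pairs by (intro image_eqI[of _ _ "(min i l, max i l)"]) (auto simp: min_def max_def)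
next
  fix X assume "X \<in> (\<lambda>e. {fst e, snd e}) ` set (pairs r)"
  then obtain e where "X = {fst e, snd e}" "fst e < snd e" "snd e < r" by (auto simp: set_pairs)
  then have "X = {fst e, snd e} \<and> fst e < r \<and> snd e < r \<and> fst e \<noteq> snd e" by simp
  then show "X \<in> {{i, l} | i l. i < r \<and> l < r \<and> i \<noteq> l}" by blast
qed

lemma tournament_pairs_permute:
  assumes "bij_betw \<pi> {..<r} {..<r}"
  shows "tournament r (pairs r) (v \<circ> \<pi>) = tournament r (pairs r) v"
proof -
  have inj: "inj_on \<pi> {..<r}" and im: "\<pi> ` {..<r} = {..<r}" using assms by (auto simp: bij_betw_def)
  have e: "map (\<lambda>e. {fst e, snd e}) (map (map_prod \<pi> \<pi>) (pairs r)) = map ((`) \<pi>) (map (\<lambda>e. {fst e, snd e}) (pairs r))"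
    by simp
  have "inj_on ((`) \<pi>) ((\<lambda>e. {fst e, snd e}) ` set (pairs r))"
    by (rule inj_on_subset[OF inj_on_image_Pow[OF inj]]) (auto simp: set_pairs)
  then have d: "distinct (map (\<lambda>e. {fst e, snd e}) (map (map_prod \<pi> \<pi>) (pairs r)))"
    unfolding e using distinct_pairs[of r] by (subst distinct_map) (simp only: set_map simp_thms)
  have "set (map (\<lambda>e. {fst e, snd e}) (map (map_prod \<pi> \<pi>) (pairs r))) = (`) \<pi> ` {{i, l} | i l. i < r \<and> l < r \<and> i \<noteq> l}"
    unfolding e set_map edges_pairs ..
  also have "\<dots> = {{i, l} | i l. i < r \<and> l < r \<and> i \<noteq> l}"
  proof (intro equalityI subsetI)
    fix X assume "X \<in> (`) \<pi> ` {{i, l} | i l. i < r \<and> l < r \<and> i \<noteq> l}"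
    then obtain i l where "X = {\<pi> i, \<pi> l}" "i < r" "l < r" "i \<noteq> l" by auto
    moreover have "\<pi> i < r" "\<pi> l < r" using im \<open>i < r\<close> \<open>l < r\<close> by auto
    moreover have "\<pi> i \<noteq> \<pi> l" using inj \<open>i < r\<close> \<open>l < r\<close> \<open>i \<noteq> l\<close> by (auto simp: inj_on_def)
    ultimately show "X \<in> {{i, l} | i l. i < r \<and> l < r \<and> i \<noteq> l}" by blast
  next
    fix X assume "X \<in> {{i, l} | i l. i < r \<and> l < r \<and> i \<noteq> l}"
    then obtain i l where X: "X = {i, l}" "i < r" "l < r" "i \<noteq> l" by blast
    have "i \<in> \<pi> ` {..<r}" "l \<in> \<pi> ` {..<r}" using X im by auto
    then obtain i' l' where "i = \<pi> i'" "l = \<pi> l'" "i' < r" "l' < r" by auto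
    then show "X \<in> (`) \<pi> ` {{i, l} | i l. i < r \<and> l < r \<and> i \<noteq> l}" using X by (intro image_eqI[of _ _ "{i', l'}"]) auto
  qed
  also have "\<dots> = set (map (\<lambda>e. {fst e, snd e}) (pairs r))" unfolding set_map edges_pairs ..
  finally have "mset (map (\<lambda>e. {fst e, snd e}) (map (map_prod \<pi> \<pi>) (pairs r))) = mset (map (\<lambda>e. {fst e, snd e}) (pairs r))"
    using set_eq_iff_mset_eq_distinct[OF d distinct_pairs] by blast
  from tournament_edges[OF this, of r v] show ?thesis
    using tournament_map[OF assms, of "pairs r" v] by (auto simp: set_pairs)
qed

lemma tournament_edge_set:
  assumes "distinct (map (\<lambda>e. {fst e, snd e}) es)" "distinct (map (\<lambda>e. {fst e, snd e}) es')"
    "(\<lambda>e. {fst e, snd e}) ` set es = (\<lambda>e. {fst e, snd e}) ` set es'"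
  shows "tournament r es v = tournament r es' v"
  using set_eq_iff_mset_eq_distinct[OF assms(1,2)] assms(3) by (intro tournament_edges) simp

text \<open>Symmetry alone does not force a zero in characteristic 2. The edge \<open>{i, j}\<close>
  is split off; the rest is symmetric under the exchange of \<open>i\<close> and \<open>j\<close>,
  so the two choices for this edge contribute equally.\<close>

lemma tournament_pairs_equal:
  assumes ij: "i < r" "j < r" "i \<noteq> j" and v: "v i = v j"
  shows "tournament r (pairs r) v = 0"
proof -
  define rest where "rest = filter (\<lambda>e. {fst e, snd e} \<noteq> {i, j}) (pairs r)"
  let ?E = "\<lambda>e :: nat \<times> nat. {fst e, snd e}"
  have set: "?E ` set rest = {{a, b} | a b. a < r \<and> b < r \<and> a \<noteq> b} - {{i, j}}"
  proof -
    have "?E ` set rest = ?E ` set (pairs r) - {{i, j}}" by (auto simp: rest_def)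
    then show ?thesis unfolding edges_pairs .
  qed
  have d: "distinct (map ?E rest)" unfolding rest_def using distinct_pairs by (rule distinct_map_filter)
  have ij': "{i, j} \<in> ?E ` set (pairs r)" unfolding edges_pairs using ij by blast
  have "tournament r (pairs r) v = tournament r ((i, j) # rest) v"
  proof (rule tournament_edge_set[OF distinct_pairs])
    show "distinct (map ?E ((i, j) # rest))" using d set by auto
    have eq: "?E ` set ((i, j) # rest) = insert {i, j} (?E ` set (pairs r) - {{i, j}})" by (auto simp: rest_def)
    show "?E ` set (pairs r) = ?E ` set ((i, j) # rest)" by (simp only: eq insert_Diff[OF ij'])
  qed
  moreover have "tournament r rest (v(j := v j - 1)) = tournament r rest (v(i := v i - 1))"
  proof -
    define \<pi> where "\<pi> = id(i := j, j := i)"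
    have inv: "\<pi> (\<pi> x) = x" for x by (simp add: \<pi>_def)
    have lt: "x < r \<Longrightarrow> \<pi> x < r" for x using ij by (simp add: \<pi>_def)
    have bij: "bij_betw \<pi> {..<r} {..<r}"
      by (rule bij_betw_byWitness[where f' = \<pi>]) (auto simp: inv lt)
    have e: "map ?E (map (map_prod \<pi> \<pi>) rest) = map ((`) \<pi>) (map ?E rest)" by simp
    have injp: "inj ((`) \<pi>)" by (rule inj_on_inverseI[where g = "(`) \<pi>"]) (auto simp: image_image inv)
    have d': "distinct (map ?E (map (map_prod \<pi> \<pi>) rest))"
      unfolding e using d by (subst distinct_map) (simp add: inj_on_subset[OF injp])
    have sub: "(`) \<pi> ` ?E ` set rest \<subseteq> ?E ` set rest"
    proof (rule image_subsetI)
      fix X assume "X \<in> ?E ` set rest"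
      then obtain a b where X: "X = {a, b}" "a < r" "b < r" "a \<noteq> b" "{a, b} \<noteq> {i, j}" unfolding set by blast
      have "{\<pi> a, \<pi> b} \<noteq> {i, j}"
      proof
        assume "{\<pi> a, \<pi> b} = {i, j}"
        then have "\<pi> ` {\<pi> a, \<pi> b} = \<pi> ` {i, j}" by simp
        then have "{a, b} = {i, j}" using ij(3) by (simp add: inv) (auto simp: \<pi>_def)
        then show False using X(5) by simp
      qed
      moreover have "\<pi> a \<noteq> \<pi> b" using X(4) inv by metis
      ultimately have "{\<pi> a, \<pi> b} \<in> ?E ` set rest" unfolding set using lt X(2,3) by blast
      then show "\<pi> ` X \<in> ?E ` set rest" by (simp add: X(1))
    qed
    have "?E ` set (map (map_prod \<pi> \<pi>) rest) = (`) \<pi> ` ?E ` set rest"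
      by (simp add: image_image)
    also have "\<dots> = ?E ` set rest"
    proof (rule card_subset_eq[OF _ sub])
      show "card ((`) \<pi> ` ?E ` set rest) = card (?E ` set rest)"
        by (rule card_image) (rule inj_on_subset[OF injp], simp)
    qed simp
    finally have s: "?E ` set (map (map_prod \<pi> \<pi>) rest) = ?E ` set rest" .
    have lr: "fst e < r \<and> snd e < r" if "e \<in> set rest" for e using that pairs_less by (auto simp: rest_def)
    have "tournament r rest (v(i := v i - 1)) = tournament r (map (map_prod \<pi> \<pi>) rest) (v(i := v i - 1))"
      by (rule tournament_edge_set[OF d d' s[symmetric]])
    also have "\<dots> = tournament r rest (v(i := v i - 1) \<circ> \<pi>)" by (rule tournament_map[OF bij lr])
    also have "v(i := v i - 1) \<circ> \<pi> = v(j := v j - 1)" using v ij(3) by (auto simp: \<pi>_def fun_eq_iff)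
    finally show ?thesis by (rule sym)
  qed
  ultimately show ?thesis by (simp only: tournament.simps fst_conv snd_conv bit_add_self)
qed

lemma tournament_bound:
  assumes "tournament r es v \<noteq> 0" "i < r" "\<And>e. e \<in> set es \<Longrightarrow> fst e \<noteq> snd e"
  shows "0 \<le> v i \<and> v i \<le> int (length (filter (\<lambda>e. fst e = i \<or> snd e = i) es))"
  using assms(1,3)
proof (induction es arbitrary: v)
  case (Cons e es)
  have "tournament r es (v(fst e := v (fst e) - 1)) \<noteq> 0 \<or> tournament r es (v(snd e := v (snd e) - 1)) \<noteq> 0"
    using Cons.prems(1) by (metis add.right_neutral tournament.simps(2))
  then show ?case
  proof
    assume "tournament r es (v(fst e := v (fst e) - 1)) \<noteq> 0"
    from Cons.IH[OF this] Cons.prems(2) have "0 \<le> (v(fst e := v (fst e) - 1)) i \<and> (v(fst e := v (fst e) - 1)) i \<le> int (length (filter (\<lambda>e. fst e = i \<or> snd e = i) es))" by simp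
    then show ?thesis by (auto split: if_splits)
  next
    assume "tournament r es (v(snd e := v (snd e) - 1)) \<noteq> 0"
    from Cons.IH[OF this] Cons.prems(2) have "0 \<le> (v(snd e := v (snd e) - 1)) i \<and> (v(snd e := v (snd e) - 1)) i \<le> int (length (filter (\<lambda>e. fst e = i \<or> snd e = i) es))" by simp
    then show ?thesis by (auto split: if_splits)
  qed
qed (use assms(2) in \<open>auto split: if_splits\<close>)

lemma length_filter_pairs:
  "i < r \<Longrightarrow> length (filter (\<lambda>e. fst e = i \<or> snd e = i) (pairs r)) = r - 1"
proof (induction r)
  case (Suc r)
  show ?case
  proof (cases "i = r")
    case True
    have "filter (\<lambda>e. fst e = i \<or> snd e = i) (pairs r) = []"
      using True pairs_less by (auto simp: filter_empty_conv dest: pairs_less)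
    then show ?thesis using True by (simp add: pairs_Suc filter_map comp_def)
  next
    case False
    have "length (filter (\<lambda>x. x = i \<or> r = i) [0..<r]) = 1"
    proof -
      have "length (filter (\<lambda>x. x = i) [0..<r]) = of_bool (i < r)" by (induction r) auto
      moreover have "(\<lambda>x. x = i \<or> r = i) = (\<lambda>x. x = i)" using False by auto
      ultimately show ?thesis using False Suc.prems by simp
    qed
    then show ?thesis using False Suc by (simp add: pairs_Suc filter_map comp_def)
  qed
qed simp

lemma pairs_proper: "e \<in> set (pairs r) \<Longrightarrow> fst e \<noteq> snd e"
  by (auto simp: set_pairs)

lemma tournament_pairs_bound: "tournament r (pairs r) v \<noteq> 0 \<Longrightarrow> i < r \<Longrightarrow> 0 \<le> v i \<and> v i < int r"
proof -
  assume nz: "tournament r (pairs r) v \<noteq> 0" and i: "i < r"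
  from tournament_bound[OF nz i pairs_proper] show "0 \<le> v i \<and> v i < int r"
    unfolding length_filter_pairs[OF i] using i by auto
qed

text \<open>The exponent of \<open>r\<close> equals the number of edges at \<open>r\<close>, so all
  of them have to choose \<open>r\<close>.\<close>

lemma tournament_star:
  assumes "r < R"
  shows "q \<le> r \<Longrightarrow> v r = int q \<Longrightarrow>
    tournament R (map (\<lambda>i. (i, r)) [0..<q] @ pairs r) v = tournament R (pairs r) (v(r := 0))"
proof (induction q arbitrary: v)
  case 0
  then show ?case by (simp add: fun_upd_idem)
next
  case (Suc q)
  let ?es = "map (\<lambda>i. (i, r)) [0..<q] @ pairs r"
  have "tournament R (map (\<lambda>i. (i, r)) [0..<Suc q] @ pairs r) v = tournament R ((q, r) # ?es) v"
    using tournament_rotate[of R "map (\<lambda>i. (i, r)) [0..<q]" "(q, r)" "pairs r" v] by simp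
  also have "\<dots> = tournament R ?es (v(q := v q - 1)) + tournament R ?es (v(r := int q))"
    using Suc.prems by simp
  also have "tournament R ?es (v(q := v q - 1)) = 0"
  proof (rule ccontr)
    assume nz: "tournament R ?es (v(q := v q - 1)) \<noteq> 0"
    have "fst e \<noteq> snd e" if "e \<in> set ?es" for e using that Suc.prems(1) pairs_proper by auto
    from tournament_bound[OF nz assms this]
    have "(v(q := v q - 1)) r \<le> int (length (filter (\<lambda>e. fst e = r \<or> snd e = r) ?es))" by blast
    moreover have "filter (\<lambda>e. fst e = r \<or> snd e = r) (pairs r) = []"
      by (auto simp: filter_empty_conv dest: pairs_less)
    then have "length (filter (\<lambda>e. fst e = r \<or> snd e = r) ?es) \<le> q"
      using length_filter_le[of "\<lambda>e. fst e = r \<or> snd e = r" "map (\<lambda>i. (i, r)) [0..<q]"] by simp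
    ultimately show False using Suc.prems by simp
  qed
  also have "tournament R ?es (v(r := int q)) = tournament R (pairs r) (v(r := 0))"
    using Suc.IH[of "v(r := int q)"] Suc.prems(1) by (simp only: fun_upd_same fun_upd_upd Suc_leD simp_thms)
  finally show ?case by (simp only: add_0_left)
qed

lemma tournament_identity: "r \<le> R \<Longrightarrow> tournament R (pairs r) (\<lambda>i. if i < r then int i else 0) = 1"
proof (induction r)
  case 0
  show ?case by (simp add: pairs_def)
next
  case (Suc r)
  have "tournament R (pairs (Suc r)) (\<lambda>i. if i < Suc r then int i else 0) =
     tournament R (map (\<lambda>i. (i, r)) [0..<r] @ pairs r) (\<lambda>i. if i < Suc r then int i else 0)"
    by (rule tournament_edges) (simp add: pairs_Suc)
  also have "\<dots> = tournament R (pairs r) ((\<lambda>i. if i < Suc r then int i else 0)(r := 0))"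
    by (rule tournament_star) (use Suc.prems in auto)
  also have "(\<lambda>i. if i < Suc r then int i else 0)(r := 0) = (\<lambda>i. if i < r then int i else 0)" by auto
  finally show ?case using Suc by simp
qed

text \<open>By symmetry the exponents may be taken to be 0, ..., r - 1 in this order, and then
  \<open>tournament_star\<close> removes the largest vertex again and again.\<close>

lemma tournament_permutation:
  assumes "inj_on v {..<r}" "\<And>i. i < r \<Longrightarrow> 0 \<le> v i \<and> v i < int r"
  shows "tournament r (pairs r) v = 1"
proof -
  define \<pi> where "\<pi> i = nat (v i)" for i
  have inj: "inj_on \<pi> {..<r}"
  proof (rule inj_onI)
    fix x y assume xy: "x \<in> {..<r}" "y \<in> {..<r}" "\<pi> x = \<pi> y"
    then have "v x = v y" using assms(2)[of x] assms(2)[of y] by (auto simp: \<pi>_def nat_eq_iff2)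
    then show "x = y" using assms(1) xy by (auto dest: inj_onD)
  qed
  have lt: "\<pi> i < r \<and> int (\<pi> i) = v i" if "i < r" for i using assms(2)[OF that] by (auto simp: \<pi>_def nat_less_iff)
  then have "\<pi> ` {..<r} \<subseteq> {..<r}" by auto
  then have "bij_betw \<pi> {..<r} {..<r}"
    using inj by (simp add: bij_betw_def endo_inj_surj)
  from tournament_pairs_permute[OF this, of "\<lambda>i. if i < r then int i else 0"]
  have "tournament r (pairs r) ((\<lambda>i. if i < r then int i else 0) \<circ> \<pi>) = 1" by (simp add: tournament_identity)
  moreover have "tournament r (pairs r) ((\<lambda>i. if i < r then int i else 0) \<circ> \<pi>) = tournament r (pairs r) v"
    by (rule tournament_cong[OF _ pairs_less]) (use lt in auto)
  ultimately show ?thesis by simp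
qed

section \<open>Products with power sums of the inverse variables\<close>

lemma bead_sum_bound: "i < r \<Longrightarrow> int r \<le> v i \<Longrightarrow> bead_sum r ps v = 0"
proof (induction ps arbitrary: v)
  case Nil
  then show ?case using tournament_pairs_bound[of r v i] by (cases "tournament r (pairs r) v") auto
next
  case (Cons p ps)
  have "bead_sum r ps (v(j := v j + int p)) = 0" for j
    by (rule Cons.IH) (use Cons.prems in auto)
  then show ?case by simp
qed

lemma bead_sum_permute:
  assumes "bij_betw \<pi> {..<r} {..<r}"
  shows "bead_sum r ps (v \<circ> \<pi>) = bead_sum r ps v"
proof (induction ps arbitrary: v)
  case Nil
  show ?case unfolding bead_sum.simps by (rule tournament_pairs_permute[OF assms])
next
  case (Cons p ps)
  have "bead_sum r ps ((v \<circ> \<pi>)(i := (v \<circ> \<pi>) i + int p)) = bead_sum r ps (v(\<pi> i := v (\<pi> i) + int p))" if "i < r" for i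
  proof -
    have "bead_sum r ps ((v \<circ> \<pi>)(i := (v \<circ> \<pi>) i + int p)) = bead_sum r ps (v(\<pi> i := v (\<pi> i) + int p) \<circ> \<pi>)"
      using that bij_betw_imp_inj_on[OF assms] by (intro bead_sum_cong) (auto simp: inj_on_def)
    then show ?thesis by (simp only: Cons.IH)
  qed
  then have "bead_sum r (p # ps) (v \<circ> \<pi>) = (\<Sum>i<r. bead_sum r ps (v(\<pi> i := v (\<pi> i) + int p)))"
    unfolding bead_sum.simps by (intro sum.cong refl) blast
  also have "\<dots> = (\<Sum>i<r. bead_sum r ps (v(i := v i + int p)))"
    by (rule sum.reindex_bij_betw[OF assms])
  finally show ?case unfolding bead_sum.simps .
qed

text \<open>Moves of \<open>i\<close> and of \<open>j\<close> contribute equally by symmetry, and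
  after any other move the two exponents still agree.\<close>

lemma bead_sum_equal: "i < r \<Longrightarrow> j < r \<Longrightarrow> i \<noteq> j \<Longrightarrow> v i = v j \<Longrightarrow> bead_sum r ps v = 0"
proof (induction ps arbitrary: v)
  case Nil
  then show ?case using tournament_pairs_equal by simp
next
  case (Cons p ps)
  define \<pi> where "\<pi> = id(i := j, j := i)"
  have "bij_betw \<pi> {..<r} {..<r}"
    using Cons.prems by (intro bij_betw_byWitness[where f' = \<pi>]) (auto simp: \<pi>_def)
  from bead_sum_permute[OF this, of ps "v(i := v i + int p)"]
  have "bead_sum r ps (v(i := v i + int p) \<circ> \<pi>) = bead_sum r ps (v(i := v i + int p))" .
  also have "v(i := v i + int p) \<circ> \<pi> = v(j := v j + int p)" using Cons.prems by (auto simp: \<pi>_def fun_eq_iff)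
  finally have e: "bead_sum r ps (v(j := v j + int p)) = bead_sum r ps (v(i := v i + int p))" .
  have z: "bead_sum r ps (v(l := v l + int p)) = 0" if "l \<noteq> i" "l \<noteq> j" for l
    by (rule Cons.IH) (use Cons.prems that in auto)
  have "bead_sum r (p # ps) v = (\<Sum>l\<in>{i, j}. bead_sum r ps (v(l := v l + int p)))"
    unfolding bead_sum.simps by (rule sum.mono_neutral_right) (use Cons.prems z in auto)
  also have "\<dots> = bead_sum r ps (v(i := v i + int p)) + bead_sum r ps (v(j := v j + int p))"
    using Cons.prems(3) by simp
  also have "\<dots> = 0" unfolding e by (rule bit_add_self)
  finally show ?case .
qed

lemma bead_sum_double: "bead_sum r (p # p # ps) v = bead_sum r (2 * p # ps) v"
proof -
  define F where "F i j = bead_sum r ps (v(i := v i + int p, j := (v(i := v i + int p)) j + int p))" for i j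
  define G where "G i j = (if i = j then 0 else F i j)" for i j
  have sym: "G i j = G j i" for i j
  proof -
    have "v(i := v i + int p, j := (v(i := v i + int p)) j + int p) = v(j := v j + int p, i := (v(j := v j + int p)) i + int p)"
      by (rule ext) simp
    then show ?thesis unfolding G_def F_def by metis
  qed
  have "bead_sum r (p # p # ps) v = (\<Sum>i<r. \<Sum>j<r. F i j)" by (simp only: bead_sum.simps F_def)
  also have "\<dots> = (\<Sum>i<r. \<Sum>j<r. G i j + (if i = j then F i i else 0))"
    by (intro sum.cong refl) (auto simp: G_def)
  also have "\<dots> = (\<Sum>i<r. \<Sum>j<r. G i j) + (\<Sum>i<r. F i i)" by (simp add: sum.distrib)
  also have "(\<Sum>i<r. \<Sum>j<r. G i j) = 0"
    by (rule symmetric_sum_bit) (auto simp: G_def[of i i for i] sym)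
  also have "(\<Sum>i<r. F i i) = bead_sum r (2 * p # ps) v"
  proof -
    have "v(i := v i + int p, i := (v(i := v i + int p)) i + int p) = v(i := v i + int (2 * p))" for i
      by (rule ext) simp
    then show ?thesis by (simp only: F_def bead_sum.simps)
  qed
  finally show ?thesis by simp
qed

lemma bead_sum_append_cong: "bead_sum r ys = bead_sum r zs \<Longrightarrow> bead_sum r (xs @ ys) = bead_sum r (xs @ zs)"
  by (induction xs) (auto simp: fun_eq_iff)

lemma bead_sum_replicate: "bead_sum r (replicate (2 * k) p @ ps) = bead_sum r (replicate k (2 * p) @ ps)"
proof (induction k)
  case (Suc k)
  have "bead_sum r (replicate (2 * Suc k) p @ ps) = bead_sum r (p # p # replicate (2 * k) p @ ps)" by simp
  also have "\<dots> = bead_sum r (2 * p # replicate (2 * k) p @ ps)" by (rule ext) (rule bead_sum_double)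
  also have "\<dots> = bead_sum r (replicate (Suc k) (2 * p) @ ps)"
    using bead_sum_append_cong[OF Suc.IH, of "[2 * p]"] by simp
  finally show ?case .
qed simp

text \<open>By repeated squaring, \<open>c\<close> equal power sums become one power sum for each
  binary digit 1 of \<open>c\<close>; this keeps the final evaluations short.\<close>

fun binary_parts :: "nat \<Rightarrow> nat \<Rightarrow> nat list" where
  "binary_parts c p = (if c = 0 then [] else (if odd c then [p] else []) @ binary_parts (c div 2) (2 * p))"

declare binary_parts.simps [simp del]

lemma bead_sum_binary: "bead_sum r (replicate c p @ ps) = bead_sum r (binary_parts c p @ ps)"
proof (induction c p rule: binary_parts.induct)
  case (1 c p)
  show ?case
  proof (cases "c = 0")
    case True
    then show ?thesis by (simp add: binary_parts.simps)
  next
    case False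
    have IH: "bead_sum r (replicate (2 * (c div 2)) p @ ps) = bead_sum r (binary_parts (c div 2) (2 * p) @ ps)"
      using 1[OF False] by (simp add: bead_sum_replicate)
    show ?thesis
    proof (cases "odd c")
      case True
      then have "replicate c p = p # replicate (2 * (c div 2)) p" by (metis odd_two_times_div_two_succ replicate_Suc Suc_eq_plus1)
      then show ?thesis using True False bead_sum_append_cong[OF IH, of "[p]"] by (subst binary_parts.simps) simp
    next
      case even: False
      then show ?thesis using False IH by (subst binary_parts.simps) simp
    qed
  qed
qed

text \<open>Alternating modulo 2, the coefficient vanishes as soon as two exponents agree or one exceeds the
  degree \<open>r - 1\<close> of the Vandermonde polynomial in each variable, so only moves of beads to free places below \<open>r\<close> are counted.\<close>

primrec bead_parity :: "int \<Rightarrow> nat list \<Rightarrow> int list \<Rightarrow> bool" where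
  "bead_parity r [] v = list_all (\<lambda>x. 0 \<le> x) v"
| "bead_parity r (p # ps) v = odd (length (filter (\<lambda>i. let x = v ! i + int p in
     x < r \<and> x \<notin> set v \<and> bead_parity r ps (v[i := x])) [0..<length v]))"

lemma bead_sum_parity:
  assumes "length v = r" "distinct v" "\<And>x. x \<in> set v \<Longrightarrow> x < int r" "\<And>p. p \<in> set ps \<Longrightarrow> p > 0"
  shows "bead_sum r ps (\<lambda>i. v ! i) = of_bool (bead_parity (int r) ps v)"
  using assms
proof (induction ps arbitrary: v)
  case Nil
  show ?case
  proof (cases "\<forall>x\<in>set v. 0 \<le> x")
    case True
    have "tournament r (pairs r) (\<lambda>i. v ! i) = 1"
      by (rule tournament_permutation) (use Nil True in \<open>auto simp: inj_on_nth\<close>)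
    then show ?thesis using True by (simp add: list_all_iff)
  next
    case False
    then obtain i where "i < r" "v ! i < 0" using Nil(1) by (metis in_set_conv_nth not_le)
    then have "tournament r (pairs r) (\<lambda>i. v ! i) = 0" using tournament_pairs_bound[of r "\<lambda>i. v ! i" i]
      by (cases "tournament r (pairs r) (\<lambda>i. v ! i)") auto
    then show ?thesis using False by (simp add: list_all_iff)
  qed
next
  case (Cons p ps)
  let ?x = "\<lambda>i. v ! i + int p"
  let ?P = "\<lambda>i. let x = v ! i + int p in x < int r \<and> x \<notin> set v \<and> bead_parity (int r) ps (v[i := x])"
  have "bead_sum r ps ((\<lambda>i. v ! i)(i := ?x i)) = of_bool (?P i)" if i: "i < r" for i
  proof -
    have e: "bead_sum r ps ((\<lambda>i. v ! i)(i := ?x i)) = bead_sum r ps (\<lambda>j. v[i := ?x i] ! j)"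
      by (rule bead_sum_cong) (use i Cons.prems(1) in \<open>auto simp: nth_list_update\<close>)
    show ?thesis
    proof (cases "?x i < int r")
      case False
      then have "bead_sum r ps ((\<lambda>i. v ! i)(i := ?x i)) = 0" using bead_sum_bound[of i r "(\<lambda>i. v ! i)(i := ?x i)"] i by simp
      then show ?thesis using False by simp
    next
      case lt: True
      show ?thesis
      proof (cases "?x i \<in> set v")
        case False
        have "bead_sum r ps (\<lambda>j. v[i := ?x i] ! j) = of_bool (bead_parity (int r) ps (v[i := ?x i]))"
        proof (rule Cons.IH)
          show "distinct (v[i := ?x i])" using Cons.prems(2) False by (intro distinct_list_update) auto
          show "x < int r" if "x \<in> set (v[i := ?x i])" for x
            using that set_update_subset_insert[of v i "?x i"] Cons.prems(3) lt by auto
        qed (use Cons.prems in auto)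
        then show ?thesis using e lt False by (simp add: Let_def)
      next
        case True
        have "bead_sum r ps ((\<lambda>i. v ! i)(i := ?x i)) = 0"
        proof -
          obtain j where j: "j < r" "v ! j = ?x i" using True Cons.prems(1) by (metis in_set_conv_nth)
          then have "j \<noteq> i" using Cons.prems(4)[of p] by auto
          then show ?thesis using bead_sum_equal[OF i j(1), of "(\<lambda>i. v ! i)(i := ?x i)"] j(2) by simp
        qed
        then show ?thesis using True by simp
      qed
    qed
  qed
  then have "bead_sum r (p # ps) (\<lambda>i. v ! i) = (\<Sum>i<r. of_bool (?P i))" by simp
  also have "\<dots> = of_nat (card {i. i < r \<and> ?P i})"
  proof -
    have "(\<Sum>i<r. of_bool (?P i)) = (\<Sum>i\<in>{i. i < r \<and> ?P i}. 1 :: bit)"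
      by (rule sum.mono_neutral_cong_right) auto
    then show ?thesis by simp
  qed
  also have "card {i. i < r \<and> ?P i} = length (filter ?P [0..<length v])"
  proof -
    have "length (filter ?P [0..<length v]) = card (set (filter ?P [0..<length v]))"
      by (rule distinct_card[symmetric]) simp
    also have "set (filter ?P [0..<length v]) = {i. i < r \<and> ?P i}" using Cons.prems(1) by auto
    finally show ?thesis by (rule sym)
  qed
  also have "of_nat (length (filter ?P [0..<length v])) = (of_bool (odd (length (filter ?P [0..<length v]))) :: bit)"
    by (cases "even (length (filter ?P [0..<length v]))") (auto elim!: evenE oddE)
  finally show ?case by simp
qed

section \<open>Independent conditions\<close>

text \<open>A nonempty forest has a chord with a free end. The chord is removed, and then the value
  at the free end is adjusted; no other difference changes, since first ends are never second
  ends.\<close>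

lemma forest_prescribed_differences:
  fixes S :: "(real \<times> real) set"
  assumes "finite S" "forest S" "fst ` S \<inter> snd ` S = {}"
  shows "\<exists>g :: real \<Rightarrow> real. \<forall>p\<in>S. g (fst p) - g (snd p) = c p"
  using assms
proof (induction "card S" arbitrary: S)
  case (Suc n)
  then have "S \<noteq> {}" by auto
  then obtain p where p: "p \<in> S" "\<not> (fst_mated S p \<and> snd_mated S p)"
    using Suc.prems(2) unfolding forest_def by blast
  have "forest (S - {p})" using Suc.prems(2) unfolding forest_def by blast
  moreover have "n = card (S - {p})" using Suc.hyps(2) p(1) Suc.prems(1) by simp
  moreover have "fst ` (S - {p}) \<inter> snd ` (S - {p}) = {}" using Suc.prems(3) by blast
  ultimately obtain g where g: "\<And>q. q \<in> S - {p} \<Longrightarrow> g (fst q) - g (snd q) = c q"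
    using Suc.hyps(1)[of "S - {p}"] Suc.prems(1) by blast
  have dis: "fst a \<noteq> snd b" if "a \<in> S" "b \<in> S" for a b using Suc.prems(3) that by blast
  show ?case
  proof (cases "fst_mated S p")
    case False
    then have "fst q \<noteq> fst p" if "q \<in> S" "q \<noteq> p" for q using that unfolding fst_mated_def by blast
    then have "(g(fst p := c p + g (snd p))) (fst q) - (g(fst p := c p + g (snd p))) (snd q) = c q" if "q \<in> S" for q
      using g[of q] dis[OF p(1) p(1)] dis[OF p(1) that] that by (cases "q = p") auto
    then show ?thesis by blast
  next
    case True
    then have "\<not> snd_mated S p" using p(2) by blast
    then have "snd q \<noteq> snd p" if "q \<in> S" "q \<noteq> p" for q using that unfolding snd_mated_def by blast
    then have "(g(snd p := g (fst p) - c p)) (fst q) - (g(snd p := g (fst p) - c p)) (snd q) = c q" if "q \<in> S" for q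
      using g[of q] dis[OF p(1) p(1)] dis[OF that p(1)] that by (cases "q = p") auto
    then show ?thesis by blast
  qed
qed auto

lemma continuous_interpolation:
  fixes g :: "real \<Rightarrow> real"
  assumes "finite X"
  shows "\<exists>f. continuous_on UNIV f \<and> (\<forall>x\<in>X. f x = g x)"
  using assms
proof (induction X rule: finite_induct)
  case empty
  show ?case by (intro exI[of _ "\<lambda>x. 0"]) simp
next
  case (insert a X)
  then obtain f where f: "continuous_on UNIV f" "\<And>x. x \<in> X \<Longrightarrow> f x = g x" by blast
  let ?P = "\<lambda>t. \<Prod>x\<in>X. t - x"
  have nz: "?P a \<noteq> 0" using insert by auto
  show ?case
  proof (intro exI[of _ "\<lambda>t. f t + (g a - f a) / ?P a * ?P t"] conjI ballI)
    show "continuous_on UNIV (\<lambda>t. f t + (g a - f a) / ?P a * ?P t)" by (intro continuous_intros f)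
    fix x assume "x \<in> insert a X"
    then consider "x = a" | "x \<in> X" by blast
    then show "f x + (g a - f a) / ?P a * ?P x = g x"
    proof cases
      case 1
      then show ?thesis using nz by simp
    next
      case 2
      then have "?P x = 0" using insert(1) by (intro prod_zero) auto
      then show ?thesis using f(2)[OF 2] by simp
    qed
  qed
qed

section \<open>Linear algebra in the space of continuous functions\<close>

lemma apply_cont_add: "apply_cont (f + g) x = apply_cont f x + apply_cont g x"
  by (simp add: plus_cont_fun.rep_eq)

lemma apply_cont_scaleR: "apply_cont (c *\<^sub>R f) x = c * apply_cont f x"
  by (simp add: scaleR_cont_fun.rep_eq)

lemma apply_cont_diff: "apply_cont (f - g) x = apply_cont f x - apply_cont g x"
  by (simp add: minus_cont_fun.rep_eq)

lemma apply_cont_0: "apply_cont 0 x = 0"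
  by (simp add: zero_cont_fun.rep_eq)

lemma apply_cont_sum: "apply_cont (sum f A) x = (\<Sum>a\<in>A. apply_cont (f a) x)"
  by (induction A rule: infinite_finite_induct) (simp_all add: apply_cont_add apply_cont_0)

lemma continuous_apply_cont: "continuous_on UNIV (apply_cont f)"
  using apply_cont by blast

lemma independent_family:
  fixes f :: "'i \<Rightarrow> 'v::real_vector"
  assumes "finite I" "\<And>c i. (\<Sum>i\<in>I. c i *\<^sub>R f i) = 0 \<Longrightarrow> i \<in> I \<Longrightarrow> c i = 0"
  shows "inj_on f I" "independent (f ` I)"
proof -
  show inj: "inj_on f I"
  proof (rule inj_onI, rule ccontr)
    fix i j assume ij: "i \<in> I" "j \<in> I" "f i = f j" "i \<noteq> j"
    let ?c = "\<lambda>l. if l = i then 1 else if l = j then - 1 else (0 :: real)"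
    have "(\<Sum>l\<in>I. ?c l *\<^sub>R f l) = (\<Sum>l\<in>{i, j}. ?c l *\<^sub>R f l)"
      by (rule sum.mono_neutral_right) (use assms(1) ij in auto)
    also have "\<dots> = 0" using ij by simp
    finally show False using assms(2)[of ?c i] ij(1) by simp
  qed
  show "independent (f ` I)"
  proof (rule independent_if_scalars_zero)
    fix c x assume "(\<Sum>x\<in>f ` I. c x *\<^sub>R x) = 0" "x \<in> f ` I"
    then show "c x = 0" using assms(2)[of "\<lambda>i. c (f i)"] inj by (auto simp: sum.reindex)
  qed (use assms(1) in simp)
qed

text \<open>Functions dual to the differences along the chords span a complement of the solution
  space.\<close>

lemma codim_solutions:
  assumes S: "finite S" "forest S" "fst ` S \<inter> snd ` S = {}"
  shows "subspace_of_codim (card S) {f. \<forall>p\<in>S. apply_cont f (fst p) = apply_cont f (snd p)}" (is "subspace_of_codim _ ?W")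
proof -
  define \<phi> where "\<phi> p f = apply_cont f (fst p) - apply_cont f (snd p)" for p f
  have \<phi>: "\<phi> p (f + g) = \<phi> p f + \<phi> p g" "\<phi> p (f - g) = \<phi> p f - \<phi> p g" "\<phi> p 0 = 0"
    "\<phi> p (\<Sum>q\<in>S. c q *\<^sub>R E q) = (\<Sum>q\<in>S. c q * \<phi> p (E q))" for p f g c and E :: "real \<times> real \<Rightarrow> cont_fun"
    by (simp_all add: \<phi>_def apply_cont_add apply_cont_diff apply_cont_0 apply_cont_sum apply_cont_scaleR
        right_diff_distrib sum_subtractf)
  have "\<exists>e. \<forall>q\<in>S. \<phi> q e = of_bool (q = p)" for p
  proof -
    obtain g :: "real \<Rightarrow> real" where g: "\<And>q. q \<in> S \<Longrightarrow> g (fst q) - g (snd q) = of_bool (q = p)"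
      using forest_prescribed_differences[OF S, of "\<lambda>q. of_bool (q = p)"] by blast
    obtain f where f: "continuous_on UNIV f" "\<And>x. x \<in> fst ` S \<union> snd ` S \<Longrightarrow> f x = g x"
      using continuous_interpolation[of "fst ` S \<union> snd ` S" g] S(1) by blast
    have "apply_cont (Cont_fun f) = f" using f(1) by (simp add: Cont_fun_inverse)
    then show ?thesis using f(2) g by (intro exI[of _ "Cont_fun f"]) (simp add: \<phi>_def)
  qed
  then obtain E where E: "\<And>p q. q \<in> S \<Longrightarrow> \<phi> q (E p) = of_bool (q = p)" by metis
  have coef: "\<phi> p (\<Sum>q\<in>S. c q *\<^sub>R E q) = c p" if "p \<in> S" for p c
  proof -
    have "\<phi> p (\<Sum>q\<in>S. c q *\<^sub>R E q) = (\<Sum>q\<in>S. if p = q then c q else 0)"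
      unfolding \<phi>(4) using that by (intro sum.cong) (auto simp: E)
    then show ?thesis using that S(1) by simp
  qed
  have ind: "inj_on E S" "independent (E ` S)"
    using independent_family[of S E] coef \<phi>(3) S(1) by metis+
  define U where "U = span (E ` S)"
  have U: "u \<in> U \<Longrightarrow> \<exists>c. u = (\<Sum>q\<in>S. c q *\<^sub>R E q)" for u
    unfolding U_def span_finite[OF finite_imageI[OF S(1)]] by (auto simp: sum.reindex[OF ind(1)] intro: exI[of _ "\<lambda>q. _ (E q)"])
  have W: "f \<in> ?W \<longleftrightarrow> (\<forall>p\<in>S. \<phi> p f = 0)" for f by (simp add: \<phi>_def)
  have "subspace ?W"
    by (auto simp: subspace_def apply_cont_add apply_cont_scaleR apply_cont_0)
  moreover have "subspace_of_dim (card S) U"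
  proof -
    have "dim U = card (E ` S)" unfolding U_def by (rule dim_span_eq_card_independent[OF ind(2)])
    also have "\<dots> = card S" by (rule card_image[OF ind(1)])
    finally show ?thesis unfolding subspace_of_dim_def using S(1) by (auto simp: U_def intro!: exI[of _ "E ` S"])
  qed
  moreover have "U \<inter> ?W = {0}"
  proof (intro equalityI subsetI)
    fix u assume u: "u \<in> U \<inter> ?W"
    then obtain c where c: "u = (\<Sum>q\<in>S. c q *\<^sub>R E q)" using U by blast
    have "c q = 0" if "q \<in> S" for q using u W coef[OF that, of c] that c by auto
    then show "u \<in> {0}" using c by simp
  qed (auto simp: U_def span_zero apply_cont_0)
  moreover have "{u + w | u w. u \<in> U \<and> w \<in> ?W} = UNIV"
  proof -
    have "\<exists>u w. f = u + w \<and> u \<in> U \<and> w \<in> ?W" for f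
    proof (intro exI conjI)
      let ?u = "\<Sum>q\<in>S. \<phi> q f *\<^sub>R E q"
      show "f = ?u + (f - ?u)" by simp
      show "?u \<in> U" unfolding U_def by (intro span_sum span_scale span_base) auto
      show "f - ?u \<in> ?W" unfolding W using coef[of _ "\<lambda>q. \<phi> q f"] by (simp add: \<phi>(2))
    qed
    then show ?thesis by blast
  qed
  ultimately show ?thesis unfolding subspace_of_codim_def by blast
qed

lemma independent_conditions_forest:
  assumes S: "finite S" "forest S" "fst ` S \<inter> snd ` S = {}"
  shows "\<exists>a b. independent_conditions (card S) a b \<and>
     solutions (card S) a b = {f. \<forall>p\<in>S. apply_cont f (fst p) = apply_cont f (snd p)}"
proof -
  obtain h where h: "bij_betw h {1..card S} S" using ex_bij_betw_nat_finite_1[OF S(1)] by blast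
  then have im: "h ` {1..card S} = S" and inj: "inj_on h {1..card S}" by (auto simp: bij_betw_def)
  let ?a = "\<lambda>i. fst (h i)" and ?b = "\<lambda>i. snd (h i)"
  have sol: "solutions (card S) ?a ?b = {f. \<forall>p\<in>S. apply_cont f (fst p) = apply_cont f (snd p)}"
  proof -
    have "(\<forall>i\<in>{1..card S}. apply_cont f (?a i) = apply_cont f (?b i)) \<longleftrightarrow>
        (\<forall>p\<in>h ` {1..card S}. apply_cont f (fst p) = apply_cont f (snd p))" for f by blast
    then show ?thesis unfolding solutions_def im by simp
  qed
  have dis: "fst p \<noteq> snd q" if "p \<in> S" "q \<in> S" for p q using S(3) that by blast
  have "independent_conditions (card S) ?a ?b"
    unfolding independent_conditions_def
  proof (intro conjI ballI)
    show "subspace_of_codim (card S) (solutions (card S) ?a ?b)" unfolding sol by (rule codim_solutions[OF S])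
    show "?a i \<noteq> ?b i" if "i \<in> {1..card S}" for i using dis im that by blast
    show "inj_on (\<lambda>i. {?a i, ?b i}) {1..card S}"
    proof (rule inj_onI)
      fix i j assume ij: "i \<in> {1..card S}" "j \<in> {1..card S}" "{?a i, ?b i} = {?a j, ?b j}"
      then have "h i \<in> S" "h j \<in> S" using im by auto
      then have "h i = h j" using ij(3) dis[of "h i" "h j"] dis[of "h j" "h i"] by (auto simp: doubleton_eq_iff prod_eq_iff)
      then show "i = j" using inj ij by (auto dest: inj_onD)
    qed
  qed
  then show ?thesis using sol by blast
qed

text \<open>The finite spanning set is essential, because \<open>dim\<close> is 0 on
  infinite-dimensional spaces.\<close>

lemma dim_ge_card:
  fixes V :: "'v::real_vector set"
  assumes "T \<subseteq> V" "independent T" "V \<subseteq> span B0" "finite B0"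
  shows "card T \<le> dim V"
proof -
  obtain B where B: "T \<subseteq> B" "B \<subseteq> V" "independent B" "V \<subseteq> span B"
    using maximal_independent_subset_extend[OF assms(1,2)] by blast
  have "finite B" using independent_span_bound[OF assms(4) B(3)] B(2) assms(3) by blast
  then have "card T \<le> card B" using B(1) by (rule card_mono)
  also have "card B = dim V" using basis_card_eq_dim[OF B(2,4,3)] .
  finally show ?thesis .
qed

lemma basis_sequence:
  fixes F :: "'v::real_vector set"
  assumes F: "subspace_of_dim N F" and N: "N' \<le> N"
  shows "\<exists>b :: nat \<Rightarrow> 'v. (\<forall>j<N'. b j \<in> F) \<and> (\<forall>c. (\<Sum>j<N'. c j *\<^sub>R b j) = 0 \<longrightarrow> (\<forall>j<N'. c j = 0))"
proof -
  obtain B0 where B0: "finite B0" "F \<subseteq> span B0" and d: "dim F = N" using F unfolding subspace_of_dim_def by blast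
  obtain B where B: "B \<subseteq> F" "independent B" "F \<subseteq> span B" "card B = dim F" using basis_exists[of F] by blast
  have fin: "finite B" using independent_span_bound[OF B0(1) B(2)] B(1) B0(2) by blast
  obtain h where h: "bij_betw h {0..<card B} B" using ex_bij_betw_nat_finite[OF fin] by blast
  have sub: "{..<N'} \<subseteq> {0..<card B}" using N B(4) d by auto
  have inj: "inj_on h {..<N'}" using h sub by (auto simp: bij_betw_def intro: inj_on_subset)
  have im: "h ` {..<N'} \<subseteq> B" using h sub by (auto simp: bij_betw_def)
  have ind: "independent (h ` {..<N'})" using independent_mono[OF B(2) im] .
  show ?thesis
  proof (intro exI[of _ h] conjI allI impI)
    show "h j \<in> F" if "j < N'" for j using im B(1) that by blast
    fix c j assume z: "(\<Sum>j<N'. c j *\<^sub>R h j) = 0" and j: "j < N'"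
    have "(\<Sum>v\<in>h ` {..<N'}. c (the_inv_into {..<N'} h v) *\<^sub>R v) = 0"
      using z by (simp add: sum.reindex[OF inj] the_inv_into_f_f[OF inj])
    then have "c (the_inv_into {..<N'} h (h j)) = 0"
      using independentD[OF ind, of "h ` {..<N'}" "\<lambda>v. c (the_inv_into {..<N'} h v)" "h j"] j by auto
    then show "c j = 0" using j by (simp add: the_inv_into_f_f[OF inj])
  qed
qed

text \<open>A cluster of scale 1 reaches at most \<open>extent 3 = 144\<close> from its centre in
  each coordinate, so with these centres different clusters share no ends and first ends never meet
  second ends.\<close>

lemma cluster_union:
  fixes Ds :: "nat \<Rightarrow> bool list \<Rightarrow> real \<times> real" and ms :: "nat list"
  defines "Q \<equiv> \<lambda>c. (2000 * real c, 2000 * real c + 1000, 1)"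
  assumes D: "\<And>c. c < length ms \<Longrightarrow> range (Ds c) \<subseteq> sup_circle" and ms: "\<And>m. m \<in> set ms \<Longrightarrow> m \<le> 3"
  defines "S \<equiv> \<Union>c<length ms. cluster_set (ms ! c) (Ds c) (Q c)"
  shows "finite S" "forest S" "fst ` S \<inter> snd ` S = {}" "card S = (\<Sum>m\<leftarrow>ms. 2 ^ m)"
proof -
  let ?C = "\<lambda>c. cluster_set (ms ! c) (Ds c) (Q c)"
  have m3: "ms ! c \<le> 3" if "c < length ms" for c using ms that by auto
  have lists: "finite {bs :: bool list. length bs = m}" "card {bs :: bool list. length bs = m} = 2 ^ m" for m
    using card_lists_length_eq[of "UNIV :: bool set" m] finite_lists_length_eq[of "UNIV :: bool set" m] by simp_all
  have fin: "finite (?C c)" for c unfolding cluster_set_def using lists(1) by simp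
  then show "finite S" unfolding S_def by blast
  have q: "snd (snd (Q c)) > 0" for c by (simp add: Q_def)
  have card: "card (?C c) = 2 ^ (ms ! c)" if "c < length ms" for c
    unfolding cluster_set_def using card_image[OF inj_leaf[OF D[OF that] q m3[OF that]]] lists(2) by simp
  have loc: "\<bar>fst p - 2000 * real c\<bar> \<le> 144" "\<bar>snd p - (2000 * real c + 1000)\<bar> \<le> 144" if "c < length ms" "p \<in> ?C c" for c p
  proof -
    have "extent (ms ! c) \<le> 144"
    proof -
      have "ms ! c = 0 \<or> ms ! c = 1 \<or> ms ! c = 2 \<or> ms ! c = 3" using m3[OF that(1)] by auto
      then show ?thesis by (auto simp: numeral_2_eq_2 numeral_3_eq_3 radius_def)
    qed
    then show "\<bar>fst p - 2000 * real c\<bar> \<le> 144" "\<bar>snd p - (2000 * real c + 1000)\<bar> \<le> 144"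
      using cluster_set_extent[OF D[OF that(1)] q that(2)] by (auto simp: Q_def)
  qed
  have apart: "c = c' \<or> real c + 1 \<le> real c' \<or> real c' + 1 \<le> real c" for c c' :: nat by linarith
  have dfst: "fst p \<noteq> fst p'" and dsnd: "snd p \<noteq> snd p'"
    if "c < length ms" "c' < length ms" "p \<in> ?C c" "p' \<in> ?C c'" "c \<noteq> c'" for c c' p p'
    using loc[OF that(1,3)] loc[OF that(2,4)] apart[of c c'] that(5) by linarith+
  have "\<And>p p'. p \<in> S \<Longrightarrow> p' \<in> S \<Longrightarrow> fst p \<noteq> snd p'"
  proof -
    fix p p' assume "p \<in> S" "p' \<in> S"
    then obtain c c' where "c < length ms" "p \<in> ?C c" "c' < length ms" "p' \<in> ?C c'" unfolding S_def by blast
    then show "fst p \<noteq> snd p'" using loc(1)[of c p] loc(2)[of c' p'] apart[of c c'] by linarith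
  qed
  then show "fst ` S \<inter> snd ` S = {}" by blast
  have "forest (\<Union>c<n. ?C c)" if "n \<le> length ms" for n
    using that
  proof (induction n)
    case 0
    then show ?case by (simp add: forest_def)
  next
    case (Suc n)
    have "forest ((\<Union>c<n. ?C c) \<union> ?C n)"
    proof (rule forest_union_disjoint)
      show "forest (\<Union>c<n. ?C c)" using Suc by simp
      show "forest (?C n)" using forest_cluster[OF D q m3] Suc.prems by simp
      have "fst p \<noteq> fst p'" if "p \<in> (\<Union>c<n. ?C c)" "p' \<in> ?C n" for p p'
      proof -
        from that(1) obtain c where "c < n" "p \<in> ?C c" by blast
        then show ?thesis using dfst[of c n p p'] that(2) Suc.prems by simp
      qed
      then show "fst ` (\<Union>c<n. ?C c) \<inter> fst ` ?C n = {}" by blast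
      have "snd p \<noteq> snd p'" if "p \<in> (\<Union>c<n. ?C c)" "p' \<in> ?C n" for p p'
      proof -
        from that(1) obtain c where "c < n" "p \<in> ?C c" by blast
        then show ?thesis using dsnd[of c n p p'] that(2) Suc.prems by simp
      qed
      then show "snd ` (\<Union>c<n. ?C c) \<inter> snd ` ?C n = {}" by blast
    qed
    then show ?case by (simp add: lessThan_Suc Un_commute)
  qed
  then show "forest S" unfolding S_def by simp
  have "?C c \<inter> ?C c' = {}" if "c < length ms" "c' < length ms" "c \<noteq> c'" for c c'
    using dfst[OF that(1,2) _ _ that(3)] by blast
  then have "card S = (\<Sum>c<length ms. card (?C c))"
    unfolding S_def by (intro card_UN_disjoint) (use fin in auto)
  also have "\<dots> = (\<Sum>c<length ms. 2 ^ (ms ! c))" using card by simp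
  also have "\<dots> = (\<Sum>m\<leftarrow>ms. 2 ^ m)" by (simp add: sum_list_sum_nth atLeast0LessThan)
  finally show "card S = (\<Sum>m\<leftarrow>ms. 2 ^ m)" .
qed

text \<open>The functions are combinations of \<open>N'\<close> independent elements of the space
  with the rows of \<open>exact_solution\<close>; orthogonal nonzero rows are independent, and hence
  so are the functions.\<close>

lemma S'_clusters:
  assumes ms: "\<And>m. m \<in> set ms \<Longrightarrow> m \<le> 3" and n: "n = (\<Sum>m\<leftarrow>ms. 2 ^ m)" and N: "N' \<le> N" "r \<le> N'"
    and parity: "(\<Sum>w\<leftarrow>word_prod (system_words r ms). of_bool (\<forall>i<r. count_list w i = N' - r + i)) = (1 :: bit)"
  shows "S' n N r"
  unfolding S'_def
proof (intro allI impI)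
  fix F :: "cont_fun set" assume F: "subspace_of_dim N F"
  obtain b where bF: "\<And>j. j < N' \<Longrightarrow> b j \<in> F" and b0: "\<And>c j. (\<Sum>j<N'. c j *\<^sub>R b j) = 0 \<Longrightarrow> j < N' \<Longrightarrow> c j = 0"
    using basis_sequence[OF F N(1)] by blast
  let ?Q = "\<lambda>c. (2000 * real c, 2000 * real c + 1000, 1)"
  let ?k = "\<lambda>i. N' - r + i"
  have k: "?k i < N'" if "i < r" for i using N that by simp
  have "\<exists>y Ds. (\<forall>i<r. (\<Sum>j\<le>?k i. \<bar>y i j\<bar>) = 1 \<and> (\<forall>j>?k i. y i j = 0)) \<and>
     (\<forall>i l. i < l \<longrightarrow> l < r \<longrightarrow> (\<Sum>j<N'. y i j * y l j) = 0) \<and>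
     (\<forall>c<length ms. range (Ds c) \<subseteq> sup_circle \<and> (\<forall>bs. length bs = ms ! c \<longrightarrow> (\<forall>i<r.
        (\<Sum>j\<le>?k i. y i j * apply_cont (b j) (fst (leaf bs (Ds c) (?Q c)))) = (\<Sum>j\<le>?k i. y i j * apply_cont (b j) (snd (leaf bs (Ds c) (?Q c)))))))"
    (is "\<exists>y Ds. ?y y \<and> ?orth y \<and> ?Ds y Ds")
    by (rule exact_solution[OF continuous_apply_cont k parity])
  then obtain y Ds where "?y y \<and> ?orth y \<and> ?Ds y Ds" by (elim exE) (rule that)
  then have y: "?y y" and orth0: "?orth y" and Ds: "?Ds y Ds" by (rule conjunct1, rule conjunct1[OF conjunct2], rule conjunct2[OF conjunct2])
  have y1: "(\<Sum>j\<le>?k i. \<bar>y i j\<bar>) = 1" and y0: "?k i < j \<Longrightarrow> y i j = 0" if "i < r" for i j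
    using y that by blast+
  have orth: "(\<Sum>j<N'. y i j * y l j) = 0" if "i < l" "l < r" for i l using orth0 that by blast
  have D: "range (Ds c) \<subseteq> sup_circle" if "c < length ms" for c using Ds that by blast
  have sol: "(\<Sum>j\<le>?k i. y i j * apply_cont (b j) (fst (leaf bs (Ds c) (?Q c)))) = (\<Sum>j\<le>?k i. y i j * apply_cont (b j) (snd (leaf bs (Ds c) (?Q c))))"
    if "c < length ms" "length bs = ms ! c" "i < r" for c bs i using Ds that by blast
  define S where "S = (\<Union>c<length ms. cluster_set (ms ! c) (Ds c) (?Q c))"
  note S = cluster_union[where Ds = Ds and ms = ms, OF D ms, folded S_def]
  obtain \<alpha> \<beta> where ab: "independent_conditions (card S) \<alpha> \<beta>"
    "solutions (card S) \<alpha> \<beta> = {f. \<forall>p\<in>S. apply_cont f (fst p) = apply_cont f (snd p)}"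
    using independent_conditions_forest[OF S(1-3)] by blast
  define f where "f i = (\<Sum>j<N'. y i j *\<^sub>R b j)" for i
  have fk: "apply_cont (f i) t = (\<Sum>j\<le>?k i. y i j * apply_cont (b j) t)" if "i < r" for i t
  proof -
    have "apply_cont (f i) t = (\<Sum>j<N'. y i j * apply_cont (b j) t)"
      by (simp add: f_def apply_cont_sum apply_cont_scaleR)
    also have "\<dots> = (\<Sum>j\<le>?k i. y i j * apply_cont (b j) t)"
      by (rule sum.mono_neutral_right) (use k[OF that] y0[OF that] in auto)
    finally show ?thesis .
  qed
  have fF: "f i \<in> F \<inter> solutions (card S) \<alpha> \<beta>" if i: "i < r" for i
  proof
    show "f i \<in> F"
      using F bF unfolding f_def subspace_of_dim_def by (intro subspace_sum subspace_scale) auto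
    have "apply_cont (f i) (fst p) = apply_cont (f i) (snd p)" if "p \<in> S" for p
      using that sol i unfolding fk[OF i] S_def cluster_set_def by auto
    then show "f i \<in> solutions (card S) \<alpha> \<beta>" unfolding ab(2) by blast
  qed
  have pos: "(\<Sum>j<N'. y l j * y l j) \<noteq> 0" if l: "l < r" for l
  proof
    assume "(\<Sum>j<N'. y l j * y l j) = 0"
    then have "y l j = 0" if "j < N'" for j using that by (simp add: sum_nonneg_eq_0_iff)
    then have "(\<Sum>j\<le>?k l. \<bar>y l j\<bar>) = 0" using k[OF l] by (intro sum.neutral) auto
    then show False using y1[OF l] by simp
  qed
  have ind: "c l = 0" if z: "(\<Sum>i<r. c i *\<^sub>R f i) = 0" and l: "l < r" for c l
  proof -
    have "(\<Sum>i<r. c i *\<^sub>R f i) = (\<Sum>j<N'. (\<Sum>i<r. c i * y i j) *\<^sub>R b j)"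
      unfolding f_def scaleR_sum_right scaleR_sum_left scaleR_scaleR by (rule sum.swap)
    then have cy: "(\<Sum>i<r. c i * y i j) = 0" if "j < N'" for j
      using b0[of "\<lambda>j. \<Sum>i<r. c i * y i j" j] z that by simp
    \<comment> \<open>The scalar product with row \<open>l\<close> isolates the coefficient
      \<open>c l\<close>.\<close>
    have "(\<Sum>j<N'. (\<Sum>i<r. c i * y i j) * y l j) = (\<Sum>i<r. c i * (\<Sum>j<N'. y i j * y l j))"
      unfolding sum_distrib_left sum_distrib_right by (subst sum.swap) (simp add: mult.assoc)
    also have "\<dots> = (\<Sum>i<r. if i = l then c l * (\<Sum>j<N'. y l j * y l j) else 0)"
    proof (rule sum.cong[OF refl])
      fix i assume "i \<in> {..<r}"
      then have "(\<Sum>j<N'. y i j * y l j) = 0" if "i \<noteq> l"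
        using orth[of i l] orth[of l i] that l by (cases "i < l") (auto simp: mult.commute)
      then show "c i * (\<Sum>j<N'. y i j * y l j) = (if i = l then c l * (\<Sum>j<N'. y l j * y l j) else 0)" by simp
    qed
    also have "\<dots> = c l * (\<Sum>j<N'. y l j * y l j)" using l by simp
    finally have "c l * (\<Sum>j<N'. y l j * y l j) = 0" using cy by simp
    then show "c l = 0" using pos[OF l] by simp
  qed
  have inj: "inj_on f {..<r}" "independent (f ` {..<r})"
    using independent_family[of "{..<r}" f] ind by auto
  obtain B0 where "finite B0" "F \<subseteq> span B0" using F unfolding subspace_of_dim_def by blast
  then have "card (f ` {..<r}) \<le> dim (F \<inter> solutions (card S) \<alpha> \<beta>)"
    using fF by (intro dim_ge_card[OF _ inj(2)]) auto
  then have "r \<le> dim (F \<inter> solutions (card S) \<alpha> \<beta>)" by (simp add: card_image[OF inj(1)])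
  moreover have "card S = n" using S(4) n by simp
  ultimately show "\<exists>a b. independent_conditions n a b \<and> dim (F \<inter> solutions n a b) \<ge> r"
    using ab(1) by blast
qed

lemma binary_parts_pos: "0 < p \<Longrightarrow> q \<in> set (binary_parts c p) \<Longrightarrow> 0 < q"
proof (induction c p rule: binary_parts.induct)
  case (1 c p)
  then show ?case by (subst (asm) (2) binary_parts.simps) (auto split: if_splits)
qed

text \<open>The numbers of clusters of 2, 4 and 8 chords are \<open>c1\<close>, \<open>c2\<close> and \<open>c3\<close>; the remaining chords are
  single. The values used below were found by a search.\<close>

lemma S'_bead_parity:
  assumes n: "2 * c1 + 4 * c2 + 8 * c3 \<le> n" "r + k \<le> n" "n - k \<le> N"
    and parity: "bead_parity (int r) (binary_parts c3 7 @ binary_parts c2 3 @ binary_parts c1 1)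
      (map (\<lambda>i. int i - int (r + k)) [0..<r])"
  shows "S' n N r"
proof -
  let ?c0 = "n - (2 * c1 + 4 * c2 + 8 * c3)"
  define ms :: "nat list" where "ms = replicate c3 3 @ replicate c2 2 @ replicate c1 1 @ replicate ?c0 0"
  have sum: "n = (\<Sum>m\<leftarrow>ms. 2 ^ m)" and "int n = (\<Sum>m\<leftarrow>ms. 2 ^ m)"
    using n(1) by (simp_all add: ms_def sum_list_replicate of_nat_diff algebra_simps)
  have parts: "parts ms = replicate c3 7 @ replicate c2 3 @ replicate c1 1"
    by (simp add: ms_def parts_def)
  let ?bs = "binary_parts c3 7 @ binary_parts c2 3 @ binary_parts c1 1"
  \<comment> \<open>The exponents \<open>N' - r + i\<close> for \<open>N' = n - k\<close>, after
    division by the common \<open>n\<close>-th power of the variables.\<close>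
  let ?v = "map (\<lambda>i. int i - int (r + k)) [0..<r]"
  have "bead_sum r (parts ms) = bead_sum r ?bs"
  proof -
    have "bead_sum r (parts ms) = bead_sum r (binary_parts c3 7 @ replicate c2 3 @ replicate c1 1)"
      unfolding parts by (rule bead_sum_binary)
    also have "\<dots> = bead_sum r (binary_parts c3 7 @ binary_parts c2 3 @ replicate c1 1)"
      by (rule bead_sum_append_cong[OF bead_sum_binary])
    also have "\<dots> = bead_sum r ?bs"
      using bead_sum_append_cong[OF bead_sum_append_cong[OF bead_sum_binary[of r c1 1 "[]"], of "binary_parts c2 3"], of "binary_parts c3 7"]
      by simp
    finally show ?thesis .
  qed
  then have "(\<Sum>w\<leftarrow>word_prod (system_words r ms). of_bool (\<forall>i<r. int (count_list w i) = int (n - k - r + i))) =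
      bead_sum r ?bs (\<lambda>i. int (n - k - r + i) - int n)"
    unfolding system_words_parity \<open>int n = _\<close> by simp
  also have "\<dots> = bead_sum r ?bs (\<lambda>i. ?v ! i)"
    by (rule bead_sum_cong) (use n(2) in \<open>simp add: of_nat_diff\<close>)
  also have "\<dots> = of_bool (bead_parity (int r) ?bs ?v)"
    by (rule bead_sum_parity) (auto simp: distinct_map inj_on_def dest: binary_parts_pos[rotated])
  finally have "(\<Sum>w\<leftarrow>word_prod (system_words r ms). of_bool (\<forall>i<r. count_list w i = n - k - r + i)) = (1 :: bit)"
    unfolding of_nat_eq_iff of_bool_def if_P[OF parity] .
  then show ?thesis
  proof (rule S'_clusters[OF _ sum n(3), rotated -1])
    show "r \<le> n - k" using n(2) by simp
  qed (auto simp: ms_def)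
qed

text \<open>Degrees force \<open>c1 + 3 * c2 + 7 * c3 = r * (r + k)\<close>, the total climb of the
  beads from -(r + k), ..., -(k + 1) to 0, ..., r - 1. In every case here and below the bound on
  \<open>n\<close> is \<open>2 * c1 + 4 * c2 + 8 * c3\<close>, so at the threshold there are no
  single chords. A larger \<open>N\<close> is covered as well, since only
  \<open>n - k \<le> N\<close> is required.\<close>

lemma S'_2:
  assumes "6 \<le> n \<and> n \<le> N
    \<or> 10 \<le> n \<and> n - 1 \<le> N
    \<or> 14 \<le> n \<and> n - 3 \<le> N
    \<or> 16 \<le> n \<and> n - 4 \<le> N
    \<or> 18 \<le> n \<and> n - 5 \<le> N
    \<or> 20 \<le> n \<and> n - 6 \<le> N
    \<or> 24 \<le> n \<and> n - 7 \<le> N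
    \<or> 28 \<le> n \<and> n - 9 \<le> N
    \<or> 32 \<le> n \<and> n - 11 \<le> N"
  shows "S' n N 2"
  using assms
proof (elim disjE conjE)
  assume "6 \<le> n" "n \<le> N"
  then show ?thesis by - (rule S'_bead_parity[of 1 1 0 n 2 0]; (linarith | code_simp))
next
  assume "10 \<le> n" "n - 1 \<le> N"
  then show ?thesis by - (rule S'_bead_parity[of 3 1 0 n 2 1]; (linarith | code_simp))
next
  assume "14 \<le> n" "n - 3 \<le> N"
  then show ?thesis by - (rule S'_bead_parity[of 1 3 0 n 2 3]; (linarith | code_simp))
next
  assume "16 \<le> n" "n - 4 \<le> N"
  then show ?thesis by - (rule S'_bead_parity[of 2 1 1 n 2 4]; (linarith | code_simp))
next
  assume "18 \<le> n" "n - 5 \<le> N"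
  then show ?thesis by - (rule S'_bead_parity[of 1 2 1 n 2 5]; (linarith | code_simp))
next
  assume "20 \<le> n" "n - 6 \<le> N"
  then show ?thesis by - (rule S'_bead_parity[of 0 3 1 n 2 6]; (linarith | code_simp))
next
  assume "24 \<le> n" "n - 7 \<le> N"
  then show ?thesis by - (rule S'_bead_parity[of 2 3 1 n 2 7]; (linarith | code_simp))
next
  assume "28 \<le> n" "n - 9 \<le> N"
  then show ?thesis by - (rule S'_bead_parity[of 0 5 1 n 2 9]; (linarith | code_simp))
next
  assume "32 \<le> n" "n - 11 \<le> N"
  then show ?thesis by - (rule S'_bead_parity[of 0 4 2 n 2 11]; (linarith | code_simp))
qed

lemma S'_3:
  assumes "18 \<le> n \<and> n - 1 \<le> N
    \<or> 22 \<le> n \<and> n - 2 \<le> N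
    \<or> 26 \<le> n \<and> n - 3 \<le> N
    \<or> 30 \<le> n \<and> n - 4 \<le> N
    \<or> 36 \<le> n \<and> n - 5 \<le> N
    \<or> 40 \<le> n \<and> n - 7 \<le> N
    \<or> 44 \<le> n \<and> n - 9 \<le> N"
  shows "S' n N 3"
  using assms
proof (elim disjE conjE)
  assume "18 \<le> n" "n - 1 \<le> N"
  then show ?thesis by - (rule S'_bead_parity[of 3 3 0 n 3 1]; (linarith | code_simp))
next
  assume "22 \<le> n" "n - 2 \<le> N"
  then show ?thesis by - (rule S'_bead_parity[of 5 1 1 n 3 2]; (linarith | code_simp))
next
  assume "26 \<le> n" "n - 3 \<le> N"
  then show ?thesis by - (rule S'_bead_parity[of 5 2 1 n 3 3]; (linarith | code_simp))
next
  assume "30 \<le> n" "n - 4 \<le> N"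
  then show ?thesis by - (rule S'_bead_parity[of 5 3 1 n 3 4]; (linarith | code_simp))
next
  assume "36 \<le> n" "n - 5 \<le> N"
  then show ?thesis by - (rule S'_bead_parity[of 8 3 1 n 3 5]; (linarith | code_simp))
next
  assume "40 \<le> n" "n - 7 \<le> N"
  then show ?thesis by - (rule S'_bead_parity[of 2 7 1 n 3 7]; (linarith | code_simp))
next
  assume "44 \<le> n" "n - 9 \<le> N"
  then show ?thesis by - (rule S'_bead_parity[of 0 5 3 n 3 9]; (linarith | code_simp))
qed

lemma S'_4:
  assumes "30 \<le> n \<and> n - 1 \<le> N
    \<or> 44 \<le> n \<and> n - 3 \<le> N
    \<or> 52 \<le> n \<and> n - 5 \<le> N
    \<or> 56 \<le> n \<and> n - 7 \<le> N"
  shows "S' n N 4"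
  using assms
proof (elim disjE conjE)
  assume "30 \<le> n" "n - 1 \<le> N"
  then show ?thesis by - (rule S'_bead_parity[of 7 2 1 n 4 1]; (linarith | code_simp))
next
  assume "44 \<le> n" "n - 3 \<le> N"
  then show ?thesis by - (rule S'_bead_parity[of 12 3 1 n 4 3]; (linarith | code_simp))
next
  assume "52 \<le> n" "n - 5 \<le> N"
  then show ?thesis by - (rule S'_bead_parity[of 8 7 1 n 4 5]; (linarith | code_simp))
next
  assume "56 \<le> n" "n - 7 \<le> N"
  then show ?thesis by - (rule S'_bead_parity[of 2 7 3 n 4 7]; (linarith | code_simp))
qed

lemma S'_5:
  assumes "48 \<le> n \<and> n - 1 \<le> N
    \<or> 60 \<le> n \<and> n - 3 \<le> N
    \<or> 68 \<le> n \<and> n - 5 \<le> N"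
  shows "S' n N 5"
  using assms
proof (elim disjE conjE)
  assume "48 \<le> n" "n - 1 \<le> N"
  then show ?thesis by - (rule S'_bead_parity[of 14 3 1 n 5 1]; (linarith | code_simp))
next
  assume "60 \<le> n" "n - 3 \<le> N"
  then show ?thesis by - (rule S'_bead_parity[of 12 7 1 n 5 3]; (linarith | code_simp))
next
  assume "68 \<le> n" "n - 5 \<le> N"
  then show ?thesis by - (rule S'_bead_parity[of 8 7 3 n 5 5]; (linarith | code_simp))
qed

lemma S'_6:
  assumes "64 \<le> n \<and> n - 1 \<le> N
    \<or> 76 \<le> n \<and> n - 3 \<le> N"
  shows "S' n N 6"
  using assms
proof (elim disjE conjE)
  assume "64 \<le> n" "n - 1 \<le> N"
  then show ?thesis by - (rule S'_bead_parity[of 14 7 1 n 6 1]; (linarith | code_simp))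
next
  assume "76 \<le> n" "n - 3 \<le> N"
  then show ?thesis by - (rule S'_bead_parity[of 12 7 3 n 6 3]; (linarith | code_simp))
qed

lemma S'_7:
  assumes "80 \<le> n \<and> n - 1 \<le> N"
  shows "S' n N 7"
  using assms by - (rule S'_bead_parity[of 14 7 3 n 7 1]; (linarith | code_simp))

theorem corollary3:
  fixes n N :: nat
  shows
    "(n \<ge> 6 \<and> N = n
      \<or> n \<ge> 10 \<and> N = n - 1
      \<or> n \<ge> 14 \<and> (N = n - 2 \<or> N = n - 3)
      \<or> n \<ge> 16 \<and> N = n - 4
      \<or> n \<ge> 18 \<and> N = n - 5
      \<or> n \<ge> 20 \<and> N = n - 6
      \<or> n \<ge> 24 \<and> N = n - 7
      \<or> n \<ge> 28 \<and> (N = n - 8 \<or> N = n - 9)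
      \<or> n \<ge> 32 \<and> (N = n - 10 \<or> N = n - 11)
      \<longrightarrow> S' n N 2)
   \<and> (n \<ge> 18 \<and> (N = n \<or> N = n - 1)
      \<or> n \<ge> 22 \<and> N = n - 2
      \<or> n \<ge> 26 \<and> N = n - 3
      \<or> n \<ge> 30 \<and> N = n - 4
      \<or> n \<ge> 36 \<and> N = n - 5
      \<or> n \<ge> 40 \<and> (N = n - 6 \<or> N = n - 7)
      \<or> n \<ge> 44 \<and> (N = n - 8 \<or> N = n - 9)
      \<longrightarrow> S' n N 3)
   \<and> (n \<ge> 30 \<and> (N = n \<or> N = n - 1)
      \<or> n \<ge> 44 \<and> (N = n - 2 \<or> N = n - 3)
      \<or> n \<ge> 52 \<and> (N = n - 4 \<or> N = n - 5)
      \<or> n \<ge> 56 \<and> (N = n - 6 \<or> N = n - 7)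
      \<longrightarrow> S' n N 4)
   \<and> (n \<ge> 48 \<and> (N = n \<or> N = n - 1)
      \<or> n \<ge> 60 \<and> (N = n - 2 \<or> N = n - 3)
      \<or> n \<ge> 68 \<and> (N = n - 4 \<or> N = n - 5)
      \<longrightarrow> S' n N 5)
   \<and> (n \<ge> 64 \<and> (N = n \<or> N = n - 1)
      \<or> n \<ge> 76 \<and> (N = n - 2 \<or> N = n - 3)
      \<longrightarrow> S' n N 6)
   \<and> (n \<ge> 80 \<and> (N = n \<or> N = n - 1)
      \<longrightarrow> S' n N 7)"
  by (intro conjI impI S'_2 S'_3 S'_4 S'_5 S'_6 S'_7; elim disjE conjE; simp add: diff_le_mono2)

end
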